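(* Let $p>1$ and let $q:[0,1]\to\mathbb{R}$ be continuous, single-barrier, and satisfy $q\le 0$ on $[0,1]$. Let $q^{*}=\inf\{q(0),q(1)\}$. For $\ell\in(0,1]$ let $\lambda_1(\ell)<\lambda_2(\ell)<\cdots$ be the eigenvalues of the Dirichlet problem $$-\big((y')^{(p-1)}\big)'=(p-1)(\lambda-q(x))y^{(p-1)},\quad x\in[0,\ell],\qquad y(0)=y(\ell)=0.$$ Then there exists $\ell_0\in(0,1]$, satisfying the estimate $0<\ell_0\le\sqrt[p]{\frac{-p}{3q^{*}}}$ (no upper restriction beyond $\ell_0\le 1$ if $q^{*}=0$), such that for all $\ell\in(0,\ell_0]$ one has $\lambda_1(\ell)>0$ and, for all $n>m\ge 1$, $$\frac{\lambda_n(\ell)}{\lambda_m(\ell)}\ge\frac{n^p}{m^p},$$ and if equality holds for two different $m$ and $n$, then $q\equiv 0$ in $[0,\ell_0]$.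
   Context: For real $f$, write $f^{(p-1)}=|f|^{p-1}\operatorname{sgn}(f)=|f|^{p-2}f$ (with value $0$ at $f=0$). An eigenvalue is a real $\lambda$ for which the boundary value problem has a nontrivial solution; it is known that the eigenvalues form an infinite increasing sequence, indexed starting from $n=1$. The function $q$ is called single-barrier on $[0,1]$ if there is $x_0\in[0,1]$ such that $q$ is increasing in $[0,x_0]$ and decreasing in $[x_0,1]$ (monotonicity in the non-strict sense). *)

theory Defs
  imports "HOL-Analysis.Analysis"
begin

definition spow :: "real \<Rightarrow> real \<Rightarrow> real"
  where "spow r f = \<bar>f\<bar> powr r * sgn f"

definition single_barrier :: "(real \<Rightarrow> real) \<Rightarrow> bool"
  where "single_barrier q \<longleftrightarrow>
    (\<exists>x0\<in>{0..1}. mono_on {0..x0} q \<and> antimono_on {x0..1} q)"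

text \<open>
  Classical solutions, with one-sided derivatives at the end points. The function \<open>y'\<close> stands
  for the derivative of \<open>y\<close>. Its continuity on \<open>{0..l}\<close> is automatic for \<open>p > 1\<close>, because
  \<open>spow (p - 1)\<close> is then a homeomorphism and \<open>spow (p - 1) \<circ> y'\<close> is differentiable.
\<close>

definition dirichlet_solution ::
    "real \<Rightarrow> (real \<Rightarrow> real) \<Rightarrow> real \<Rightarrow> real \<Rightarrow> (real \<Rightarrow> real) \<Rightarrow> bool"
  where "dirichlet_solution p q l lam y \<longleftrightarrow>
    (\<exists>y'. \<forall>x\<in>{0..l}.
        (y has_real_derivative y' x) (at x within {0..l}) \<and>
        ((\<lambda>t. spow (p - 1) (y' t)) has_real_derivative
            - ((p - 1) * (lam - q x) * spow (p - 1) (y x))) (at x within {0..l})) \<and>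
    y 0 = 0 \<and> y l = 0"

definition dirichlet_eigenvalues :: "real \<Rightarrow> (real \<Rightarrow> real) \<Rightarrow> real \<Rightarrow> real set"
  where "dirichlet_eigenvalues p q l =
    {lam. \<exists>y. dirichlet_solution p q l lam y \<and> (\<exists>x\<in>{0..l}. y x \<noteq> 0)}"

text \<open>The value of the sequence at index \<open>0\<close> is irrelevant.\<close>

definition increasing_enumeration :: "(nat \<Rightarrow> real) \<Rightarrow> real set \<Rightarrow> bool"
  where "increasing_enumeration s E \<longleftrightarrow> strict_mono_on {1..} s \<and> s ` {1..} = E"

end

theory Submission
  imports Defs
begin

text \<open>For \<open>\<lambda> = z\<^sup>p\<close> and \<open>Q = -q\<close> the modified Pruefer angle \<open>\<phi>\<close> of the Dirichlet solution satisfies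
  \<open>\<phi>' = z + Q z\<^bsup>1-p\<^esup> P(\<phi>)\<close> with \<open>P = \<bar>sin\<^sub>p\<bar>\<^sup>p\<close>, and \<open>z\<^sup>p\<close> is the \<open>n\<close>-th eigenvalue iff \<open>\<phi>\<close> reaches
  \<open>n \<pi>\<^sub>p\<close> at \<open>l\<close>. The ratio estimate thus says that \<open>\<phi>(l)/z\<close> decreases in \<open>z\<close>.
  For small \<open>l\<close> the barrier condition leaves \<open>q\<close> monotone on \<open>[0,l]\<close>, and after a reflection
  \<open>Q\<close> is nonincreasing. The difference of \<open>\<phi>/z\<close> for two values of \<open>z\<close> solves a linear equation whose
  forcing term is \<open>-Q\<close> times the derivative of a comparison function \<open>gap\<close> along \<open>\<phi>/z\<close>, up to factors close to 1.
  The function \<open>gap\<close> is positive and almost increasing because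
  \<open>(p+1) \<integral>\<^sub>0\<^sup>b P - b P(b)\<close> is, so the second mean value theorem gives the sign.
  As \<open>l\<^sub>0\<close> is only bounded from above, it may be shrunk at will; equality then forces \<open>Q\<close> to vanish at
  the end point of \<open>[0,l]\<close> where it is largest.\<close>

section \<open>Signed powers\<close>

text \<open>The derivative of \<open>gap\<close> along the first angle need not keep one sign, since
  \<open>P\<close> oscillates, so no pointwise comparison of the two angles is available; only its
  weighted integrals from \<open>0\<close> are positive, and a nonincreasing weight is what turns
  this into a sign at \<open>l\<close>. The factor \<open>p + 1\<close> comes from differentiating
  \<open>z powr - (p + 1) * intP (z * t)\<close> in \<open>z\<close>: the gap between
  \<open>z1\<close> and \<open>z2\<close> is an integral over \<open>z\<close> of
  \<open>z powr - (p + 2) * D (z * t)\<close>. Beyond \<open>hp\<close> the function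
  \<open>D\<close> is only enclosed between two linear bounds, which costs a factor
  \<open>K\<close>; the smallness \<open>Q 0 * l powr p \<le> eps\<close> pays for it. It also makes
  the linear coefficients integrate to at most \<open>1 / 8\<close>, so that phases exist by a
  single contraction. Only \<open>z \<ge> 1 / l\<close> has to be treated, because all eigenvalues
  exceed \<open>(1 / l) powr p\<close>. Finally, \<open>q = 0\<close> is claimed on all of
  \<open>[0, l0]\<close> although equality is observed at a single \<open>l \<le> l0\<close>; this
  affects the choice of \<open>l0\<close> when \<open>q\<close> is nonincreasing from the
  start.\<close>

lemma spow_0 [simp]: "spow r 0 = 0"
  by (simp add: spow_def)

lemma spow_minus [simp]: "spow r (- x) = - spow r x"
  by (simp add: spow_def sgn_minus)

lemma abs_spow: "\<bar>spow r x\<bar> = \<bar>x\<bar> powr r"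
  by (cases "x = 0") (auto simp: spow_def abs_mult)

lemma spow_one [simp]: "spow 1 x = x"
  by (simp add: spow_def abs_mult_sgn)

lemma spow_eq_0_iff [simp]: "spow r x = 0 \<longleftrightarrow> x = 0"
  by (auto simp: spow_def sgn_if)

lemma spow_pos_iff: "spow r x > 0 \<longleftrightarrow> x > 0"
  by (auto simp: spow_def sgn_if)

lemma spow_of_nonneg: "x \<ge> 0 \<Longrightarrow> spow r x = x powr r"
  by (auto simp: spow_def sgn_if)

lemma mult_spow: "x * spow r x = \<bar>x\<bar> powr (r + 1)"
proof (cases "x = 0")
  case False
  then have "x * spow r x = \<bar>x\<bar> powr r * \<bar>x\<bar>"
    by (simp add: spow_def abs_sgn)
  with False show ?thesis by (simp add: powr_add)
qed simp

lemma spow_mult_pos: "c > 0 \<Longrightarrow> spow r (c * x) = c powr r * spow r x"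
  by (simp add: spow_def abs_mult powr_mult sgn_mult)

lemma spow_spow: "spow a (spow b x) = spow (a * b) x"
proof -
  have "spow a (spow b x) = (\<bar>x\<bar> powr b) powr a * sgn (spow b x)"
    by (simp add: spow_def[of a] abs_spow)
  moreover have "sgn (spow b x) = sgn x"
    by (auto simp: spow_def sgn_if)
  ultimately show ?thesis
    by (simp add: spow_def powr_powr mult.commute)
qed

lemma isCont_spow:
  assumes "r > 0"
  shows "isCont (spow r) x"
proof -
  \<comment> \<open>Positive part minus negative part: continuity of \<open>powr\<close> for
    nonnegative bases then covers the change of sign at \<open>0\<close>.\<close>
  have eq: "spow r = (\<lambda>x. (max x 0) powr r - (max (- x) 0) powr r)"
    by (auto simp: spow_def fun_eq_iff max_def sgn_if)
  have "continuous_on UNIV (\<lambda>x::real. (max x 0) powr r - (max (- x) 0) powr r)"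
    by (intro continuous_intros continuous_on_powr') (use assms in auto)
  then show ?thesis
    unfolding eq by (simp add: continuous_on_eq_continuous_at)
qed

lemma continuous_on_spow [continuous_intros]:
  "r > 0 \<Longrightarrow> continuous_on A f \<Longrightarrow> continuous_on A (\<lambda>x. spow r (f x))"
  by (rule continuous_on_compose2[of UNIV "spow r"])
    (auto simp: continuous_on_eq_continuous_at isCont_spow)

text \<open>At \<open>0\<close> the difference quotient of \<open>\<bar>x\<bar> powr a\<close> is
  \<open>spow (a - 1)\<close> itself, so differentiability there is the continuity of
  \<open>spow\<close>; elsewhere the power rule applies.\<close>

lemma DERIV_abs_powr:
  assumes "a > 1"
  shows "((\<lambda>x. \<bar>x\<bar> powr a) has_real_derivative a * spow (a - 1) x) (at x)"
proof -
  consider "x > 0" | "x < 0" | "x = 0" by linarith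
  then show ?thesis
  proof cases
    case 1
    have "((\<lambda>x. x powr a) has_real_derivative a * spow (a - 1) x) (at x)"
      using 1 by (auto intro!: derivative_eq_intros simp: spow_of_nonneg)
    then show ?thesis
      by (rule has_field_derivative_transform_within_open[of _ _ _ "{0<..}"]) (use 1 in auto)
  next
    case 2
    have "((\<lambda>x. (- x) powr a) has_real_derivative a * spow (a - 1) x) (at x)"
      using 2 by (auto intro!: derivative_eq_intros simp: spow_def)
    then show ?thesis
      by (rule has_field_derivative_transform_within_open[of _ _ _ "{..<0}"]) (use 2 in auto)
  next
    case 3
    have "spow (a - 1) \<midarrow>0\<rightarrow> spow (a - 1) 0"
      using isCont_spow[of "a - 1" 0] assms by (simp add: isCont_def)
    moreover have "spow (a - 1) = (\<lambda>h. (\<bar>h\<bar> powr a - \<bar>0\<bar> powr a) / (h - 0))"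
    proof
      show "spow (a - 1) h = (\<bar>h\<bar> powr a - \<bar>0\<bar> powr a) / (h - 0)" for h
        using mult_spow[of h "a - 1"] by (cases "h = 0") (auto simp: field_simps)
    qed
    ultimately show ?thesis
      unfolding has_field_derivative_iff 3 by simp
  qed
qed

lemma spow_strict_mono: "r > 0 \<Longrightarrow> x < y \<Longrightarrow> spow r x < spow r y"
proof -
  assume r: "r > 0" and "x < y"
  then consider "0 \<le> x" | "x < 0" "0 \<le> y" | "y < 0" by linarith
  then show ?thesis
  proof cases
    case 1
    then show ?thesis using powr_less_mono2[OF r _ \<open>x < y\<close>] \<open>x < y\<close> by (simp add: spow_of_nonneg)
  next
    case 2
    have "spow r x < 0" using spow_pos_iff[of r "- x"] 2 by simp
    moreover have "spow r y \<ge> 0" using 2 by (simp add: spow_of_nonneg)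
    ultimately show ?thesis by simp
  next
    case 3
    have "(- y) powr r < (- x) powr r" using powr_less_mono2[OF r, of "- y" "- x"] 3 \<open>x < y\<close> by simp
    then have "spow r (- y) < spow r (- x)" using 3 \<open>x < y\<close> by (subst (1 2) spow_of_nonneg) auto
    then show ?thesis by simp
  qed
qed

lemma abs_le_1_if_powr_le_1:
  fixes x :: real
  shows "r > 0 \<Longrightarrow> \<bar>x\<bar> powr r \<le> 1 \<Longrightarrow> \<bar>x\<bar> \<le> 1"
  by (smt (verit) powr_less_mono2 powr_one_eq_one)

text \<open>The left-hand side increases strictly along each ray, so a ray meets the curve only
  once. This turns equal polar angles into equal points of the curve.\<close>

lemma curve_ray_unique:
  fixes a b p q t :: real
  assumes "p > 0" "q > 0" "t > 0"
    and 1: "\<bar>a\<bar> powr p + \<bar>b\<bar> powr q = 1"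
    and 2: "\<bar>t * a\<bar> powr p + \<bar>t * b\<bar> powr q = 1"
  shows "t = 1"
proof -
  have 2: "t powr p * \<bar>a\<bar> powr p + t powr q * \<bar>b\<bar> powr q = 1"
    using 2 \<open>t > 0\<close> by (simp add: abs_mult powr_mult)
  define A B where "A = \<bar>a\<bar> powr p" and "B = \<bar>b\<bar> powr q"
  have AB: "A \<ge> 0" "B \<ge> 0" "A + B = 1" "(t powr p - 1) * A + (t powr q - 1) * B = 0"
    using 1 2 by (simp_all add: A_def B_def algebra_simps)
  then have "A > 0 \<or> B > 0" by linarith
  show ?thesis
  proof (rule ccontr)
    assume "t \<noteq> 1"
    then consider "t > 1" | "t < 1" by linarith
    then show False
    proof cases
      case 1
      then have "t powr p - 1 > 0" "t powr q - 1 > 0" using assms by simp_all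
      then have "(t powr p - 1) * A + (t powr q - 1) * B > 0"
        using \<open>A > 0 \<or> B > 0\<close> AB(1,2) by (auto intro: add_pos_nonneg add_nonneg_pos)
      then show False using AB(4) by simp
    next
      case 2
      then have "t powr p < 1" "t powr q < 1"
        using assms powr_less_mono2[of p t 1] powr_less_mono2[of q t 1] by simp_all
      then have "(1 - t powr p) * A + (1 - t powr q) * B > 0"
        using \<open>A > 0 \<or> B > 0\<close> AB(1,2) by (auto intro: add_pos_nonneg add_nonneg_pos)
      then show False using AB(4) by (simp add: algebra_simps)
    qed
  qed
qed

section \<open>Scalar differential equations and monotone weights\<close>

lemma DERIV_nonneg_within_imp_le:
  fixes f :: "real \<Rightarrow> real"
  assumes "a \<le> b"
    and der: "\<And>x. x \<in> {a..b} \<Longrightarrow> (f has_real_derivative f' x) (at x within {a..b})"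
    and nn: "\<And>x. a < x \<Longrightarrow> x < b \<Longrightarrow> f' x \<ge> 0"
  shows "f a \<le> f b"
proof (rule DERIV_nonneg_imp_increasing_open[OF \<open>a \<le> b\<close>])
  show "\<exists>y. DERIV f x :> y \<and> y \<ge> 0" if "a < x" "x < b" for x
    using der[of x] nn[of x] that by (auto simp: at_within_Icc_at)
  show "continuous_on {a..b} f"
    using der by (rule DERIV_continuous_on)
qed

lemma DERIV_pos_within_imp_less:
  fixes f :: "real \<Rightarrow> real"
  assumes "a < b"
    and der: "\<And>x. x \<in> {a..b} \<Longrightarrow> (f has_real_derivative f' x) (at x within {a..b})"
    and nn: "\<And>x. a < x \<Longrightarrow> x < b \<Longrightarrow> f' x > 0"
  shows "f a < f b"
proof (rule DERIV_pos_imp_increasing_open[OF \<open>a < b\<close>])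
  show "\<exists>y. DERIV f x :> y \<and> y > 0" if "a < x" "x < b" for x
    using der[of x] nn[of x] that by (auto simp: at_within_Icc_at)
  show "continuous_on {a..b} f"
    using der by (rule DERIV_continuous_on)
qed

lemma antiderivative_from_0:
  fixes f :: "real \<Rightarrow> real"
  assumes "continuous_on {0..l} f"
  obtains F where "F 0 = 0"
    and "\<And>x. x \<in> {0..l} \<Longrightarrow> (F has_real_derivative f x) (at x within {0..l})"
proof (rule that[of "\<lambda>x. integral {0..x} f"])
  show "integral {0..0} f = 0" by simp
  show "((\<lambda>x. integral {0..x} f) has_real_derivative f x) (at x within {0..l})"
    if "x \<in> {0..l}" for x
    using integral_has_real_derivative[OF assms that] .
qed

text \<open>If \<open>A' = a\<close>, then \<open>exp (- A) * u\<close> has derivative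
  \<open>exp (- A) * r\<close>, which has the sign of \<open>r\<close>.\<close>

lemma linear_ode_nonneg:
  fixes u :: "real \<Rightarrow> real"
  assumes u0: "u 0 = 0"
    and der: "\<And>x. x \<in> {0..l} \<Longrightarrow> (u has_real_derivative a x * u x + r x) (at x within {0..l})"
    and a: "continuous_on {0..l} a"
    and x: "x \<in> {0..l}"
  shows "(\<And>t. 0 < t \<Longrightarrow> t < x \<Longrightarrow> r t \<ge> 0) \<Longrightarrow> u x \<ge> 0"
    and "0 < x \<Longrightarrow> (\<And>t. 0 < t \<Longrightarrow> t < x \<Longrightarrow> r t > 0) \<Longrightarrow> u x > 0"
proof -
  obtain A where A: "\<And>x. x \<in> {0..l} \<Longrightarrow> (A has_real_derivative a x) (at x within {0..l})"
    using antiderivative_from_0[OF a] by metis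
  define w where "w t = exp (- A t) * u t" for t
  have w: "(w has_real_derivative exp (- A t) * r t) (at t within {0..x})" if "t \<in> {0..x}" for t
  proof -
    have "(w has_real_derivative exp (- A t) * r t) (at t within {0..l})" if "t \<in> {0..l}" for t
      unfolding w_def
      by (rule derivative_eq_intros A[OF that] der[OF that] refl)+ (simp add: algebra_simps)
    from DERIV_subset[OF this] show ?thesis using x that by auto
  qed
  have w0: "w 0 = 0" by (simp add: w_def u0)
  show "u x \<ge> 0" if "\<And>t. 0 < t \<Longrightarrow> t < x \<Longrightarrow> r t \<ge> 0"
  proof -
    have "w 0 \<le> w x"
      by (rule DERIV_nonneg_within_imp_le[OF _ w]) (use that x in auto)
    then show ?thesis by (simp add: w0) (simp add: w_def zero_le_mult_iff)
  qed
  show "u x > 0" if "0 < x" "\<And>t. 0 < t \<Longrightarrow> t < x \<Longrightarrow> r t > 0"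
  proof -
    have "w 0 < w x"
      by (rule DERIV_pos_within_imp_less[OF _ w]) (use that x in auto)
    then show ?thesis by (simp add: w0) (simp add: w_def zero_less_mult_iff)
  qed
qed

text \<open>The bound \<open>m\<close> makes \<open>F\<close> grow at least linearly, hence
  \<open>F\<close> is onto and its inverse is Lipschitz with constant \<open>1 / m\<close>. It
  serves to pass between the polar angle and the time of the flow.\<close>

lemma diffeomorphism_from_derivative:
  fixes f :: "real \<Rightarrow> real"
  assumes cont: "continuous_on UNIV f" and m: "m > 0" "\<And>x. f x \<ge> m"
  obtains F G where "F 0 = 0" and "\<And>x. (F has_real_derivative f x) (at x)"
    and "strict_mono F" and "\<And>x. G (F x) = x" and "\<And>y. F (G y) = y"
    and "\<And>y. (G has_real_derivative inverse (f (G y))) (at y)"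
proof -
  have "\<exists>F. \<forall>x::real. - \<infinity> < ereal x \<longrightarrow> ereal x < \<infinity> \<longrightarrow> (F has_vector_derivative f x) (at x)"
    by (rule einterval_antiderivative) (use cont in \<open>auto simp: continuous_on_eq_continuous_at\<close>)
  then obtain F0 where F0: "\<And>x. (F0 has_real_derivative f x) (at x)"
    by (auto simp: has_real_derivative_iff_has_vector_derivative)
  define F where "F x = F0 x - F0 0" for x
  have F: "(F has_real_derivative f x) (at x)" for x
    unfolding F_def by (auto intro!: derivative_eq_intros F0)
  have F00: "F 0 = 0" by (simp add: F_def)
  have lower: "m * (y - x) \<le> F y - F x" if "x \<le> y" for x y
  proof -
    have "F x - m * x \<le> F y - m * y"
    proof (rule deriv_nonneg_imp_mono[where g = "\<lambda>x. F x - m * x" and g' = "\<lambda>x. f x - m"])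
      show "((\<lambda>x. F x - m * x) has_real_derivative f x - m) (at x)" for x
        by (auto intro!: derivative_eq_intros F)
    qed (use m that in auto)
    then show ?thesis by (simp add: algebra_simps)
  qed
  have mono: "strict_mono F"
  proof (rule strict_monoI)
    fix x y :: real assume "x < y"
    then have "0 < m * (y - x)" using m by simp
    then show "F x < F y" using lower[of x y] \<open>x < y\<close> by linarith
  qed
  have contF: "continuous_on UNIV F"
    using F by (auto simp: continuous_on_eq_continuous_at intro: DERIV_isCont)
  have surj: "\<exists>x. F x = y" for y
  proof -
    define b where "b = \<bar>y\<bar> / m"
    have b: "b \<ge> 0" "m * b = \<bar>y\<bar>" using m by (auto simp: b_def)
    have "F (- b) \<le> y" "y \<le> F b"
      using lower[of "- b" 0] lower[of 0 b] b F00 by auto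
    then have "\<exists>x. - b \<le> x \<and> x \<le> b \<and> F x = y"
      by (intro IVT') (use b continuous_on_subset[OF contF] in auto)
    then show ?thesis by auto
  qed
  define G where "G = inv F"
  have FG: "F (G y) = y" for y
    unfolding G_def using surj by (metis f_inv_into_f rangeI)
  have GF: "G (F x) = x" for x
    unfolding G_def by (intro inv_f_f strict_mono_imp_inj_on mono)
  have Glip: "\<bar>G y - G x\<bar> \<le> \<bar>y - x\<bar> / m" for x y
  proof -
    have *: "G b - G a \<le> (b - a) / m \<and> G a \<le> G b" if "a \<le> b" for a b
    proof -
      have "G a \<le> G b"
        using that FG strict_mono_less_eq[OF mono, of "G a" "G b"] by simp
      then show ?thesis using lower[of "G a" "G b"] m by (simp add: FG field_simps)
    qed
    show ?thesis using *[of x y] *[of y x] by (cases "x \<le> y") auto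
  qed
  have contG: "isCont G y" for y
  proof -
    have "((\<lambda>x. \<bar>x - y\<bar> / m) \<longlongrightarrow> \<bar>y - y\<bar> / m) (at y)"
      using m by (intro tendsto_intros) auto
    then have "((\<lambda>x. \<bar>x - y\<bar> / m) \<longlongrightarrow> 0) (at y)"
      by simp
    moreover have "\<forall>\<^sub>F x in at y. norm (G x - G y) \<le> \<bar>x - y\<bar> / m"
      using Glip by (intro always_eventually) (simp add: abs_minus_commute)
    ultimately have "((\<lambda>x. G x - G y) \<longlongrightarrow> 0) (at y)"
      by (rule Lim_null_comparison[rotated])
    then show ?thesis by (simp add: isCont_def LIM_zero_iff)
  qed
  have "(G has_real_derivative inverse (f (G y))) (at y)" for y
  proof (rule DERIV_inverse_function[OF F _ _ _ FG contG])
    show "f (G y) \<noteq> 0" using m(1) m(2)[of "G y"] by linarith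
    show "y - 1 < y" "y < y + 1" by simp_all
  qed
  with that[OF F00 F mono GF FG] show ?thesis by metis
qed

text \<open>Normalised and rotated back by \<open>B\<close>, the vector \<open>(U, V)\<close>
  becomes \<open>(f, g)\<close>, which has zero derivative and so stays at \<open>(0, 1)\<close>.
  The angle is measured from the \<open>V\<close> axis; taking it as an antiderivative avoids
  choosing branches of the argument.\<close>

lemma polar_angle:
  fixes U V :: "real \<Rightarrow> real"
  assumes X: "convex X" "0 \<in> X"
    and U: "\<And>x. x \<in> X \<Longrightarrow> (U has_real_derivative U' x) (at x within X)"
    and V: "\<And>x. x \<in> X \<Longrightarrow> (V has_real_derivative V' x) (at x within X)"
    and B: "\<And>x. x \<in> X \<Longrightarrow> (B has_real_derivative
              (U' x * V x - U x * V' x) / ((U x)\<^sup>2 + (V x)\<^sup>2)) (at x within X)"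
    and nz: "\<And>x. x \<in> X \<Longrightarrow> (U x)\<^sup>2 + (V x)\<^sup>2 > 0"
    and 0: "U 0 = 0" "V 0 > 0" "B 0 = 0"
    and x: "x \<in> X"
  shows "U x = sqrt ((U x)\<^sup>2 + (V x)\<^sup>2) * sin (B x)"
    and "V x = sqrt ((U x)\<^sup>2 + (V x)\<^sup>2) * cos (B x)"
proof -
  define N where "N x = (U x)\<^sup>2 + (V x)\<^sup>2" for x
  define R where "R x = sqrt (N x)" for x
  have Npos: "N x > 0" if "x \<in> X" for x using nz that by (simp add: N_def)
  have Rpos: "R x > 0" if "x \<in> X" for x using Npos that by (simp add: R_def)
  have RR: "R x * R x = U x * U x + V x * V x" if "x \<in> X" for x
    using Npos[OF that] by (simp add: R_def N_def power2_eq_square)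
  have R: "(R has_real_derivative (U x * U' x + V x * V' x) / R x) (at x within X)"
    if "x \<in> X" for x
  proof -
    have "(N has_real_derivative 2 * (U x * U' x + V x * V' x)) (at x within X)"
      unfolding N_def by (auto intro!: derivative_eq_intros U[OF that] V[OF that])
    from DERIV_chain2[OF DERIV_real_sqrt[OF Npos[OF that]] this] show ?thesis
      unfolding R_def
      by (rule back_subst[where P = "\<lambda>d. (_ has_real_derivative d) _"])
        (simp add: divide_simps)
  qed
  define f where "f x = (U x * cos (B x) - V x * sin (B x)) / R x" for x
  define g where "g x = (U x * sin (B x) + V x * cos (B x)) / R x" for x
  have B': "(B has_real_derivative (U' x * V x - U x * V' x) / (R x * R x)) (at x within X)"
    if "x \<in> X" for x
    using B[OF that] RR[OF that] by (simp add: power2_eq_square)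
  have f: "(f has_real_derivative 0) (at x within X)" if "x \<in> X" for x
    unfolding f_def
    apply (rule derivative_eq_intros R[OF that] B'[OF that] U[OF that] V[OF that] refl)+
    using Rpos[OF that] apply simp
    using Rpos[OF that] apply (simp add: field_simps)
    using RR[OF that] apply algebra
    done
  have g: "(g has_real_derivative 0) (at x within X)" if "x \<in> X" for x
    unfolding g_def
    apply (rule derivative_eq_intros R[OF that] B'[OF that] U[OF that] V[OF that] refl)+
    using Rpos[OF that] apply simp
    using Rpos[OF that] apply (simp add: field_simps)
    using RR[OF that] apply algebra
    done
  have "f 0 = 0" "g 0 = 1" using 0 by (simp_all add: f_def g_def R_def N_def)
  then have "f x = 0" "g x = 1"
    using has_field_derivative_zero_constant[OF X(1) f] has_field_derivative_zero_constant[OF X(1) g]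
      x X(2) by auto
  then have 1: "U x * cos (B x) = V x * sin (B x)" "U x * sin (B x) + V x * cos (B x) = R x"
    using Rpos[OF x] by (auto simp: f_def g_def field_simps)
  have c: "cos (B x) * cos (B x) = 1 - sin (B x) * sin (B x)"
    using sin_cos_squared_add[of "B x"] by (simp add: power2_eq_square algebra_simps)
  show "U x = sqrt ((U x)\<^sup>2 + (V x)\<^sup>2) * sin (B x)"
    unfolding N_def[of x, symmetric] R_def[of x, symmetric] 1(2)[symmetric] using 1(1) c by algebra
  show "V x = sqrt ((U x)\<^sup>2 + (V x)\<^sup>2) * cos (B x)"
    unfolding N_def[of x, symmetric] R_def[of x, symmetric] 1(2)[symmetric] using 1(1) c by algebra
qed

text \<open>Induction on the number of steps of length at most \<open>\<delta>\<close>;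
  \<open>antimono_weight\<close> can compare increments only over short intervals.\<close>

lemma locally_mono_imp_le:
  fixes f :: "real \<Rightarrow> real"
  assumes "a \<le> b" "\<delta> > 0"
    and loc: "\<And>x y. a \<le> x \<Longrightarrow> x \<le> y \<Longrightarrow> y \<le> b \<Longrightarrow> y - x \<le> \<delta> \<Longrightarrow> f x \<le> f y"
  shows "f a \<le> f b"
proof -
  have "f a \<le> f x" if "a \<le> x" "x \<le> b" "x - a \<le> real n * \<delta>" for n x
    using that
  proof (induction n arbitrary: x)
    case 0
    then show ?case by simp
  next
    case (Suc n)
    define y where "y = max a (x - \<delta>)"
    have y: "a \<le> y" "y \<le> x" "x - y \<le> \<delta>" "y - a \<le> real n * \<delta>"
      using Suc.prems \<open>\<delta> > 0\<close> by (auto simp: y_def max_def algebra_simps)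
    have "f a \<le> f y" by (rule Suc.IH) (use y Suc.prems in auto)
    also have "f y \<le> f x" by (rule loc) (use y Suc.prems in auto)
    finally show ?case .
  qed
  moreover obtain n :: nat where "(b - a) / \<delta> \<le> real n"
    using real_arch_simple by blast
  ultimately show ?thesis using assms(1,2) by (simp add: field_simps)
qed

text \<open>The reciprocal of the weight is \<open>e (1/Q + F)\<close>. As \<open>Q\<close> need not be differentiable,
  increments are compared over short intervals, with \<open>1/Q\<close> frozen at the left end.\<close>

lemma antimono_weight:
  fixes Q F F' e :: "real \<Rightarrow> real"
  assumes Q: "continuous_on {0..l} Q" "antimono_on {0..l} Q" "\<And>x. x \<in> {0..l} \<Longrightarrow> Q x \<ge> 0"
    and F: "\<And>x. x \<in> {0..l} \<Longrightarrow> (F has_real_derivative F' x) (at x within {0..l})"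
      "continuous_on {0..l} F'" "\<And>x. x \<in> {0..l} \<Longrightarrow> F x \<ge> 0"
    and e: "\<And>x. x \<in> {0..l} \<Longrightarrow> (e has_real_derivative
        - (e x * (Q x * F' x / (1 + Q x * F x)))) (at x within {0..l})"
      "\<And>x. x \<in> {0..l} \<Longrightarrow> e x > 0"
    and ab: "0 \<le> a" "a \<le> b" "b \<le> l"
  shows "Q b / (e b * (1 + Q b * F b)) \<le> Q a / (e a * (1 + Q a * F a))"
proof (cases "Q b = 0")
  case True
  then show ?thesis using Q(3)[of a] F(3)[of a] e(2)[of a] ab by simp
next
  case False
  \<comment> \<open>As \<open>Q\<close> is nonincreasing, this gives \<open>Q > 0\<close> on
    \<open>[a, b]\<close>, which the reciprocal of the weight requires.\<close>
  then have Qb: "Q b > 0" using Q(3)[of b] ab by simp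
  let ?I = "{0..l}"
  have Qpos: "Q x > 0" if "a \<le> x" "x \<le> b" for x
    using Qb monotone_onD[OF Q(2), of x b] that ab by auto
  define B where "B x = e x * (Q x * F' x / (1 + Q x * F x))" for x
  have contF: "continuous_on ?I F" and conte: "continuous_on ?I e"
    by (rule DERIV_continuous_on[OF F(1)], assumption) (rule DERIV_continuous_on[OF e(1)])
  have den: "1 + Q x * F x > 0" if "x \<in> ?I" for x
    using Q(3)[OF that] F(3)[OF that] by (simp add: add_pos_nonneg)
  have "continuous_on ?I B"
    unfolding B_def by (intro continuous_intros conte contF Q F(2)) (use den in force)
  then have "bounded (B ` ?I)"
    by (intro compact_imp_bounded compact_continuous_image) auto
  then obtain C where C: "\<And>x. x \<in> ?I \<Longrightarrow> \<bar>B x\<bar> \<le> C"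
    unfolding bounded_iff by (metis imageI real_norm_def)
  have "\<exists>x\<in>?I. \<forall>y\<in>?I. e x \<le> e y"
    by (intro continuous_attains_inf conte) (use ab in auto)
  then obtain e0 where e0: "e0 > 0" "\<And>x. x \<in> ?I \<Longrightarrow> e0 \<le> e x"
    using e(2) by blast
  have C0: "C \<ge> 0" using C[of 0] ab by (force simp: abs_le_iff)
  define k where "k x = 1 / Q x" for x
  define N where "N x = e x * (k x + F x)" for x
  have k_mono: "k x \<le> k y" if "a \<le> x" "x \<le> y" "y \<le> b" for x y
    using Qpos[of x] Qpos[of y] monotone_onD[OF Q(2), of x y] that ab
    by (auto simp: k_def intro!: divide_left_mono)
  have "N a \<le> N b"
  proof (rule locally_mono_imp_le[OF ab(2)])
    \<comment> \<open>On intervals of this length \<open>C * (y - x) \<le> e0 \<le> e y\<close>, so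
      the error \<open>C * (k y - k x) * (y - x)\<close> is absorbed by the gain
      \<open>e y * (k y - k x)\<close>.\<close>
    show "e0 / (C + 1) > 0" using e0 C0 by simp
    fix x y assume xy: "a \<le> x" "x \<le> y" "y \<le> b" "y - x \<le> e0 / (C + 1)"
    define h where "h t = e t * (k x + F t) + C * (k y - k x) * t" for t
    have "h x \<le> h y"
    proof (rule DERIV_nonneg_within_imp_le[where f = h
          and f' = "\<lambda>t. B t * (k t - k x) + C * (k y - k x)"])
      show "x \<le> y" by fact
      fix t assume t: "t \<in> {x..y}"
      then have tI: "t \<in> ?I" using xy ab by auto
      have Qt: "Q t > 0" using Qpos t xy by auto
      have "(h has_real_derivative
          - B t * (k x + F t) + F' t * e t + C * (k y - k x)) (at t within ?I)"
        unfolding h_def B_def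
        by (rule derivative_eq_intros e(1)[OF tI] F(1)[OF tI] refl)+ simp_all
      \<comment> \<open>The decay of \<open>e\<close> is designed so that \<open>e * (k + F)\<close>
        moves only through \<open>k\<close>. Freezing \<open>k\<close> at \<open>x\<close> leaves
        the error \<open>B t * (k t - k x)\<close>.\<close>
      moreover have "F' t * e t = B t * (k t + F t)"
        using Qt den[OF tI] by (simp add: B_def k_def divide_simps)
      ultimately have "(h has_real_derivative B t * (k t - k x) + C * (k y - k x)) (at t within ?I)"
        by (simp add: algebra_simps)
      then show "(h has_real_derivative B t * (k t - k x) + C * (k y - k x)) (at t within {x..y})"
        by (rule DERIV_subset) (use xy ab in auto)
    next
      fix t assume t: "x < t" "t < y"
      have "\<bar>B t * (k t - k x)\<bar> \<le> C * (k y - k x)"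
        unfolding abs_mult using C[of t] C0 k_mono[of x t] k_mono[of t y] t xy ab
        by (intro mult_mono) auto
      then show "B t * (k t - k x) + C * (k y - k x) \<ge> 0" by linarith
    qed
    then have "N x + e y * (k y - k x) - C * (k y - k x) * (y - x) \<le> N y"
      by (simp add: h_def N_def algebra_simps)
    moreover have "C * (k y - k x) * (y - x) \<le> e y * (k y - k x)"
    proof -
      have "C * (y - x) \<le> (C + 1) * (e0 / (C + 1))"
        using xy C0 by (intro mult_mono) auto
      also have "\<dots> \<le> e y" using e0(2)[of y] C0 xy ab by simp
      finally have "C * (y - x) * (k y - k x) \<le> e y * (k y - k x)"
        using k_mono[of x y] xy by (intro mult_right_mono) auto
      then show ?thesis by (simp add: mult_ac)
    qed
    ultimately show "N x \<le> N y" by linarith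
  qed
  moreover have "Q x / (e x * (1 + Q x * F x)) = 1 / N x" if "a \<le> x" "x \<le> b" for x
    using Qpos[OF that] by (simp add: N_def k_def field_simps)
  moreover have "N a > 0"
    using Qpos[of a] ab F(3)[of a] e(2)[of a] unfolding N_def k_def
    by (intro mult_pos_pos add_pos_nonneg) auto
  ultimately show ?thesis
    using ab by (simp add: divide_left_mono)
qed

text \<open>The second mean value theorem expresses the integral of \<open>m * f\<close> through
  integrals of \<open>f\<close> from \<open>0\<close> with nonnegative coefficients. One application
  does not give strictness, since its intermediate point may be \<open>0\<close> when
  \<open>m l = 0\<close>.\<close>

lemma weighted_integral_pos:
  fixes m f :: "real \<Rightarrow> real"
  assumes "l > 0" and f: "continuous_on {0..l} f" and m: "continuous_on {0..l} m"
    and anti: "\<And>x y. 0 \<le> x \<Longrightarrow> x \<le> y \<Longrightarrow> y \<le> l \<Longrightarrow> m y \<le> m x"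
    and nn: "m l \<ge> 0"
    and A: "\<And>c. 0 < c \<Longrightarrow> c \<le> l \<Longrightarrow> integral {0..c} f > 0"
  shows "integral {0..l} (\<lambda>x. m x * f x) \<ge> 0"
    and "m 0 > 0 \<Longrightarrow> integral {0..l} (\<lambda>x. m x * f x) > 0"
proof -
  have A0: "integral {0..c} f \<ge> 0" if "0 \<le> c" "c \<le> l" for c
    using A[of c] that by (cases "c = 0") auto
  have sub: "f integrable_on {a..b}" if "0 \<le> a" "b \<le> l" for a b
    by (rule integrable_continuous_real[OF continuous_on_subset[OF f]]) (use that in auto)
  have split: "integral {c..b} f = integral {0..b} f - integral {0..c} f"
    if "0 \<le> c" "c \<le> b" "b \<le> l" for c b
    using Henstock_Kurzweil_Integration.integral_combine[of 0 c b f] sub[of 0 b] that by auto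
  have smv: "\<exists>c\<in>{a..b}. integral {a..b} (\<lambda>x. m x * f x) = m a * integral {a..c} f + m b * integral {c..b} f"
    if "0 \<le> a" "a \<le> b" "b \<le> l" for a b
  proof -
    have "- m x \<le> - m y" if "a \<le> x" "x \<le> y" "y \<le> b" for x y
      using anti[of x y] that \<open>0 \<le> a\<close> \<open>b \<le> l\<close> by simp
    then obtain c where "c \<in> {a..b}" "integral {a..b} (\<lambda>x. - m x * f x) = - m a * integral {a..c} f + - m b * integral {c..b} f"
      using second_mean_value_theorem[OF sub[OF \<open>0 \<le> a\<close> \<open>b \<le> l\<close>] \<open>a \<le> b\<close>, of "\<lambda>x. - m x"] by blast
    then show ?thesis by (intro bexI[of _ c]) auto
  qed
  have m_ge: "m x \<ge> m l" if "0 \<le> x" "x \<le> l" for x using anti[of x l] that by simp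
  show "integral {0..l} (\<lambda>x. m x * f x) \<ge> 0"
  proof -
    obtain c where c: "c \<in> {0..l}" "integral {0..l} (\<lambda>x. m x * f x) = m 0 * integral {0..c} f + m l * integral {c..l} f"
      using smv[of 0 l] \<open>l > 0\<close> by auto
    have "integral {0..l} (\<lambda>x. m x * f x) = (m 0 - m l) * integral {0..c} f + m l * integral {0..l} f"
      using c split[of c l] by (simp add: algebra_simps)
    also have "\<dots> \<ge> 0"
      using m_ge[of 0] A0[of c] A0[of l] c \<open>l > 0\<close> nn by (intro add_nonneg_nonneg mult_nonneg_nonneg) auto
    finally show ?thesis .
  qed
  show "integral {0..l} (\<lambda>x. m x * f x) > 0" if m0: "m 0 > 0"
  proof -
    \<comment> \<open>Splitting at such a \<open>b\<close> keeps the intermediate point of the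
      second piece away from \<open>0\<close>, where the integral of \<open>f\<close> is strictly
      positive.\<close>
    have "\<exists>b. 0 < b \<and> b \<le> l \<and> m b > 0"
    proof -
      have "(m \<longlongrightarrow> m 0) (at 0 within {0..l})"
        using m \<open>l > 0\<close> by (auto simp: continuous_on_def)
      then have "\<forall>\<^sub>F x in at 0 within {0..l}. m x > 0"
        using m0 by (rule order_tendstoD)
      then obtain d where d: "d > 0" "\<And>x. x \<in> {0..l} \<Longrightarrow> x \<noteq> 0 \<Longrightarrow> dist x 0 < d \<Longrightarrow> m x > 0"
        by (auto simp: eventually_at)
      then show ?thesis using \<open>l > 0\<close> by (intro exI[of _ "min (d / 2) l"]) auto
    qed
    then obtain b where b: "0 < b" "b \<le> l" "m b > 0" by blast
    obtain c1 where c1: "c1 \<in> {0..b}" "integral {0..b} (\<lambda>x. m x * f x) = m 0 * integral {0..c1} f + m b * integral {c1..b} f"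
      using smv[of 0 b] b by auto
    obtain c2 where c2: "c2 \<in> {b..l}" "integral {b..l} (\<lambda>x. m x * f x) = m b * integral {b..c2} f + m l * integral {c2..l} f"
      using smv[of b l] b by auto
    have "(\<lambda>x. m x * f x) integrable_on {0..l}"
      by (intro integrable_continuous_real continuous_intros f m)
    then have "integral {0..l} (\<lambda>x. m x * f x) = integral {0..b} (\<lambda>x. m x * f x) + integral {b..l} (\<lambda>x. m x * f x)"
      using Henstock_Kurzweil_Integration.integral_combine[of 0 b l "\<lambda>x. m x * f x"] b by simp
    also have "\<dots> = (m 0 - m b) * integral {0..c1} f + ((m b - m l) * integral {0..c2} f + m l * integral {0..l} f)"
      using c1 c2 b split[of c1 b] split[of b c2] split[of c2 l] by (simp add: algebra_simps)
    also have "\<dots> > 0"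
    proof (rule add_nonneg_pos)
      show "(m 0 - m b) * integral {0..c1} f \<ge> 0"
        using anti[of 0 b] b c1 A0[of c1] by simp
      have ml: "m l \<le> m b" using m_ge[of b] b by simp
      have pos: "integral {0..c2} f > 0" "integral {0..l} f > 0" using A c2 b \<open>l > 0\<close> by auto
      show "(m b - m l) * integral {0..c2} f + m l * integral {0..l} f > 0"
      proof (cases "m l > 0")
        case True
        then show ?thesis using ml pos by (intro add_nonneg_pos) auto
      next
        case False
        then have "m l = 0" using nn by simp
        then show ?thesis using b pos by simp
      qed
    qed
    finally show ?thesis .
  qed
qed

section \<open>The generalized sine function\<close>

text \<open>\<open>S\<close> is the generalized sine, \<open>hp\<close> is its half period
  \<open>\<pi>\<^sub>p\<close>, and \<open>W\<close> is \<open>spow (p - 1)\<close> of the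
  derivative of \<open>S\<close>. With \<open>W\<close> as second unknown the half-linear equation
  becomes a first-order system, and \<open>pythagoras\<close> is its conserved energy.\<close>

locale generalized_sine =
  fixes p hp :: real and S W :: "real \<Rightarrow> real"
  assumes p_gt_1: "p > 1"
    and S_0: "S 0 = 0" and W_0: "W 0 = 1"
    and DERIV_S: "(S has_real_derivative spow (1 / (p - 1)) (W x)) (at x)"
    and DERIV_W: "(W has_real_derivative - ((p - 1) * spow (p - 1) (S x))) (at x)"
    and pythagoras: "\<bar>S x\<bar> powr p + \<bar>W x\<bar> powr (p / (p - 1)) = 1"
    and hp_pos: "hp > 0"
    and S_eq_0_iff: "S x = 0 \<longleftrightarrow> (\<exists>k::int. x = of_int k * hp)"
    and S_pos: "0 < x \<Longrightarrow> x < hp \<Longrightarrow> S x > 0"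

text \<open>The curve \<open>\<bar>s\<bar>\<^sup>p + \<bar>w\<bar>\<^bsup>p/(p-1)\<^esup> = 1\<close> is parametrised by \<open>a\<close> through the
  quasi-homogeneous projection \<open>(t sin a, t\<^bsup>p-1\<^esup> cos a)\<close> of the circle, and
  then reparametrised by the time of the half-linear flow.\<close>

lemma generalized_sine_exists:
  fixes p :: real
  assumes p: "p > 1"
  shows "\<exists>hp S W. generalized_sine p hp S W"
proof -
  define s where "s = 1 / (p - 1)"
  define q where "q = p / (p - 1)"
  have ps: "s > 0" "(p - 1) * s = 1" "q > 1" "q = s + 1" "p * s = q" "q * (p - 1) = p"
    using p by (auto simp: s_def q_def field_simps)
  define rho where "rho a = \<bar>sin a\<bar> powr p + \<bar>cos a\<bar> powr q" for a :: real
  define A where "A a = spow (p - 1) (sin a)" for a :: real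
  define C where "C a = spow s (cos a)" for a :: real
  \<comment> \<open>\<open>k\<close> and \<open>h\<close> are \<open>t\<close> and
    \<open>t powr (p - 1)\<close> for \<open>t = rho powr (- 1 / p)\<close>, the scaling that
    carries \<open>(sin a, cos a)\<close> to the curve.\<close>
  define k where "k a = rho a powr (- 1 / p)" for a
  define h where "h a = rho a powr (- 1 / q)" for a
  define U where "U a = sin a * k a" for a
  define V where "V a = cos a * h a" for a
  \<comment> \<open>Time of the flow per unit of angle: \<open>d_U\<close> and \<open>d_V\<close>
    below are the system up to this factor.\<close>
  define g where "g a = ((cos a)\<^sup>2 + s * (sin a)\<^sup>2) / rho a" for a
  have rho_eq: "rho a = sin a * A a + cos a * C a" for a
    using mult_spow[of "sin a" "p - 1"] mult_spow[of "cos a" s] ps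
    by (simp add: rho_def A_def C_def)
  have rho_pos: "rho a > 0" for a
  proof -
    have "sin a \<noteq> 0 \<or> cos a \<noteq> 0"
      using sin_cos_squared_add[of a] by (metis power_zero_numeral add_0 zero_neq_one)
    then show ?thesis
      unfolding rho_def by (auto intro: add_pos_nonneg add_nonneg_pos)
  qed
  have k_pos: "k a > 0" and h_pos: "h a > 0" for a
    using rho_pos[of a] by (auto simp: k_def h_def)
  have rho_le: "rho a \<le> 2" for a
  proof -
    have "\<bar>sin a\<bar> powr p \<le> 1" "\<bar>cos a\<bar> powr q \<le> 1"
      using p ps abs_sin_le_one[of a] abs_cos_le_one[of a] by (auto intro!: powr_le1)
    then show ?thesis by (simp add: rho_def)
  qed
  have d_rho: "(rho has_real_derivative p * (A a * cos a - s * C a * sin a)) (at a)" for a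
  proof -
    have "((\<lambda>a. \<bar>sin a\<bar> powr p) has_real_derivative p * A a * cos a) (at a)"
      unfolding A_def by (rule DERIV_chain2[OF DERIV_abs_powr]) (use p in \<open>auto intro!: derivative_eq_intros\<close>)
    moreover have "((\<lambda>a. \<bar>cos a\<bar> powr q) has_real_derivative q * spow (q - 1) (cos a) * (- sin a)) (at a)"
      by (rule DERIV_chain2[OF DERIV_abs_powr]) (use ps in \<open>auto intro!: derivative_eq_intros\<close>)
    ultimately have "(rho has_real_derivative p * A a * cos a + q * spow (q - 1) (cos a) * (- sin a)) (at a)"
      unfolding rho_def by (rule DERIV_add)
    moreover have "q - 1 = s" using ps(4) by simp
    moreover have "q * C a * (- sin a) = - (p * (s * C a * sin a))"
      by (simp flip: ps(5))
    ultimately show ?thesis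
      by (simp add: C_def algebra_simps)
  qed
  have d_powr: "((\<lambda>a. rho a powr e) has_real_derivative
      rho a powr e * (e * (p * (A a * cos a - s * C a * sin a)) / rho a)) (at a)" for a e
    using DERIV_chain2[OF has_real_derivative_powr[OF rho_pos] d_rho[of a], of e] rho_pos[of a]
    by (simp add: powr_diff field_simps)
  have d_k: "(k has_real_derivative - k a * (A a * cos a - s * C a * sin a) / rho a) (at a)" for a
  proof -
    have "- 1 / p * (p * X) = - X" for X
      using p by simp
    with d_powr[of "- 1 / p" a] show ?thesis unfolding k_def by simp
  qed
  have d_h: "(h has_real_derivative - h a * ((p - 1) * (A a * cos a - s * C a * sin a)) / rho a) (at a)" for a
  proof -
    have "- 1 / q * (p * X) = - ((p - 1) * X)" for X
      using ps by (simp add: q_def field_simps)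
    with d_powr[of "- 1 / q" a] show ?thesis
      unfolding h_def by (simp only: mult_minus_left mult_minus_right minus_divide_left times_divide_eq_right)
  qed
  have k_h: "h a powr s = k a" "k a powr (p - 1) = h a" for a
  proof -
    have "(- 1 / q) * s = - 1 / p" "(- 1 / p) * (p - 1) = - 1 / q"
      using p by (auto simp: q_def s_def field_simps)
    then show "h a powr s = k a" "k a powr (p - 1) = h a"
      unfolding h_def k_def powr_powr by metis+
  qed
  have spow_V: "spow s (V a) = k a * C a" for a
    using spow_mult_pos[OF h_pos, of s a "cos a"] by (simp add: V_def C_def k_h mult.commute)
  have spow_U: "spow (p - 1) (U a) = h a * A a" for a
    using spow_mult_pos[OF k_pos, of "p - 1" a "sin a"] by (simp add: U_def A_def k_h mult.commute)
  have d_U: "(U has_real_derivative spow s (V a) * g a) (at a)" for a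
    unfolding spow_V g_def U_def
    apply (rule derivative_eq_intros d_k refl)+
    using rho_pos[of a] apply (simp add: field_simps)
    using rho_eq[of a] apply algebra
    done
  have d_V: "(V has_real_derivative - ((p - 1) * spow (p - 1) (U a)) * g a) (at a)" for a
    unfolding spow_U g_def V_def
    apply (rule derivative_eq_intros d_h refl)+
    using rho_pos[of a] apply (simp add: field_simps)
    using rho_eq[of a] ps(2) apply algebra
    done
  have pyth: "\<bar>U a\<bar> powr p + \<bar>V a\<bar> powr q = 1" for a
  proof -
    have "- 1 / p * p = - 1" "- 1 / q * q = - 1" using p ps by auto
    then have "k a powr p = 1 / rho a" "h a powr q = 1 / rho a"
      unfolding k_def h_def powr_powr using rho_pos[of a]
      by (simp_all only: powr_minus_divide powr_one less_imp_le)
    then have "\<bar>U a\<bar> powr p + \<bar>V a\<bar> powr q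
        = (\<bar>sin a\<bar> powr p + \<bar>cos a\<bar> powr q) / rho a"
      using k_pos[of a] h_pos[of a]
      by (simp add: U_def V_def abs_mult powr_mult add_divide_distrib)
    then show ?thesis using rho_pos[of a] by (simp flip: rho_def)
  qed
  \<comment> \<open>The numerator of \<open>g\<close> is at least \<open>min 1 s\<close> and its
    denominator \<open>rho\<close> at most \<open>2\<close>.\<close>
  define m where "m = min 1 s / 2"
  have m: "m > 0" "g a \<ge> m" for a
  proof -
    show "m > 0" using ps by (simp add: m_def)
    have "min 1 s * 1 \<le> (cos a)\<^sup>2 + s * (sin a)\<^sup>2"
    proof -
      have "min 1 s * (cos a)\<^sup>2 \<le> 1 * (cos a)\<^sup>2" "min 1 s * (sin a)\<^sup>2 \<le> s * (sin a)\<^sup>2"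
        by (intro mult_right_mono; simp)+
      then have "min 1 s * ((cos a)\<^sup>2 + (sin a)\<^sup>2) \<le> (cos a)\<^sup>2 + s * (sin a)\<^sup>2"
        unfolding distrib_left by linarith
      then show ?thesis by simp
    qed
    moreover have "m * rho a \<le> m * 2"
      by (rule mult_left_mono) (use rho_le[of a] \<open>m > 0\<close> in auto)
    moreover have "m * 2 = min 1 s * 1" by (simp add: m_def)
    ultimately show "g a \<ge> m"
      unfolding g_def pos_le_divide_eq[OF rho_pos] by linarith
  qed
  have contg: "continuous_on UNIV g"
  proof -
    have "continuous_on UNIV rho"
      using d_rho by (auto intro!: DERIV_continuous_on)
    then show ?thesis
      unfolding g_def by (intro continuous_intros) (use rho_pos in \<open>auto simp: less_imp_neq[symmetric]\<close>)
  qed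
  obtain F G where F: "F 0 = 0" "\<And>x. (F has_real_derivative g x) (at x)" "strict_mono F"
    "\<And>x. G (F x) = x" "\<And>y. F (G y) = y"
    and G: "\<And>y. (G has_real_derivative inverse (g (G y))) (at y)"
    using diffeomorphism_from_derivative[OF contg m] by metis
  \<comment> \<open>As \<open>g\<close> has period \<open>pi\<close>, every half turn takes the same
    time; this puts the zeros at the multiples of \<open>hp\<close>.\<close>
  define hp where "hp = F pi"
  have g_pi: "g (a + pi) = g a" for a
    by (simp add: g_def rho_def)
  have F_pi: "F (a + pi) = F a + hp" for a
  proof -
    have "((\<lambda>a. F (a + pi) - F a) has_real_derivative 0) (at a)" for a
      by (auto intro!: derivative_eq_intros DERIV_chain2[OF F(2)] F(2) simp: g_pi)
    from DERIV_isconst_all[of "\<lambda>a. F (a + pi) - F a" a 0] this show ?thesis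
      by (simp add: F(1) hp_def)
  qed
  have F_int: "F (of_int j * pi) = of_int j * hp" for j :: int
  proof (induction j rule: int_induct[of _ 0])
    case base
    then show ?case by (simp add: F)
  next
    case (step1 i)
    then show ?case using F_pi[of "of_int i * pi"] by (simp add: algebra_simps)
  next
    case (step2 i)
    then show ?case using F_pi[of "of_int (i - 1) * pi"] by (simp add: algebra_simps)
  qed
  have "generalized_sine p hp (\<lambda>x. U (G x)) (\<lambda>x. V (G x))"
  proof
    show "p > 1" by fact
    have G0: "G 0 = 0" using F(4)[of 0] F(1) by simp
    have "rho 0 = 1" by (simp add: rho_def)
    then show "U (G 0) = 0" "V (G 0) = 1"
      by (auto simp: G0 U_def V_def h_def)
    have gnz: "g a \<noteq> 0" for a using m(1) m(2)[of a] by linarith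
    show "((\<lambda>x. U (G x)) has_real_derivative spow (1 / (p - 1)) (V (G x))) (at x)" for x
      using DERIV_chain2[OF d_U G[of x]] gnz by (simp add: s_def mult.assoc)
    show "((\<lambda>x. V (G x)) has_real_derivative - ((p - 1) * spow (p - 1) (U (G x)))) (at x)" for x
      using DERIV_chain2[OF d_V G[of x]] gnz by (simp add: mult.assoc)
    show "\<bar>U (G x)\<bar> powr p + \<bar>V (G x)\<bar> powr (p / (p - 1)) = 1" for x
      using pyth[of "G x"] by (simp add: q_def)
    show "hp > 0"
      using strict_monoD[OF F(3), of 0 pi] by (simp add: hp_def F)
    show "U (G x) = 0 \<longleftrightarrow> (\<exists>k::int. x = of_int k * hp)" for x
    proof -
      have "U (G x) = 0 \<longleftrightarrow> sin (G x) = 0"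
        using k_pos[of "G x"] by (simp add: U_def)
      also have "\<dots> \<longleftrightarrow> (\<exists>i::int. G x = of_int i * pi)"
        by (rule sin_zero_iff_int2)
      also have "\<dots> \<longleftrightarrow> (\<exists>i::int. x = of_int i * hp)"
        by (metis F_int F(4,5))
      finally show ?thesis .
    qed
    show "U (G x) > 0" if "0 < x" "x < hp" for x
    proof -
      have "F 0 < F (G x)" "F (G x) < F pi"
        using that by (auto simp: F hp_def)
      then have "0 < G x" "G x < pi"
        using strict_mono_less[OF F(3)] by blast+
      then show ?thesis using sin_gt_zero k_pos by (simp add: U_def)
    qed
  qed
  then show ?thesis by blast
qed

context generalized_sine
begin

section \<open>Pruefer angles of half-linear equations\<close>

definition P :: "real \<Rightarrow> real"
  where "P x = \<bar>S x\<bar> powr p"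

definition dP :: "real \<Rightarrow> real"
  where "dP x = p * spow (p - 1) (S x) * spow (1 / (p - 1)) (W x)"

text \<open>The antiderivative of \<open>P\<close> that vanishes at \<open>0\<close>; it is explicit
  because \<open>S * W\<close> has derivative \<open>1 - p * P\<close>.\<close>

definition intP :: "real \<Rightarrow> real"
  where "intP x = (x - S x * W x) / p"

lemma exponents:
  "1 / (p - 1) > 0" "1 / (p - 1) + 1 = p / (p - 1)"
  using p_gt_1 by (auto simp: field_simps)

lemma S_mult_spow: "S x * spow (p - 1) (S x) = P x"
  using mult_spow[of "S x" "p - 1"] by (simp add: P_def)

lemma W_mult_spow: "W x * spow (1 / (p - 1)) (W x) = 1 - P x"
  using mult_spow[of "W x" "1 / (p - 1)"] pythagoras[of x] exponents by (simp add: P_def)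

lemma P_nonneg: "P x \<ge> 0" by (simp add: P_def)

lemma P_le_1: "P x \<le> 1"
  using pythagoras[of x] by (simp add: P_def) (smt (verit) powr_ge_zero)

lemma abs_S_le_1: "\<bar>S x\<bar> \<le> 1"
  using P_le_1[of x] p_gt_1 by (intro abs_le_1_if_powr_le_1[of p]) (auto simp: P_def)

lemma abs_W_le_1: "\<bar>W x\<bar> \<le> 1"
proof (rule abs_le_1_if_powr_le_1)
  show "\<bar>W x\<bar> powr (p / (p - 1)) \<le> 1"
    using pythagoras[of x] by (smt (verit) powr_ge_zero)
qed (use p_gt_1 in auto)

lemma abs_spow_W_le_1: "\<bar>spow (1 / (p - 1)) (W x)\<bar> \<le> 1"
  using abs_W_le_1[of x] p_gt_1 by (auto simp: abs_spow intro!: powr_le1)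

lemma abs_dP_le: "\<bar>dP x\<bar> \<le> p"
proof -
  have "\<bar>spow (p - 1) (S x)\<bar> * \<bar>spow (1 / (p - 1)) (W x)\<bar> \<le> 1 * 1"
    using abs_S_le_1[of x] p_gt_1 abs_spow_W_le_1[of x]
    by (intro mult_mono) (auto simp: abs_spow intro!: powr_le1)
  then have "p * (\<bar>spow (p - 1) (S x)\<bar> * \<bar>spow (1 / (p - 1)) (W x)\<bar>) \<le> p * 1"
    using p_gt_1 by (intro mult_left_mono) auto
  then show ?thesis using p_gt_1 by (simp add: dP_def abs_mult)
qed

lemma DERIV_P: "(P has_real_derivative dP x) (at x)"
  unfolding P_def[abs_def] dP_def
  by (rule DERIV_chain2[OF DERIV_abs_powr DERIV_S]) (use p_gt_1 in auto)

lemma DERIV_SW: "((\<lambda>x. S x * W x) has_real_derivative 1 - p * P x) (at x)"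
proof -
  have "((\<lambda>x. S x * W x) has_real_derivative
      W x * spow (1 / (p - 1)) (W x) - (p - 1) * (S x * spow (p - 1) (S x))) (at x)"
    by (auto intro!: derivative_eq_intros DERIV_S DERIV_W simp: algebra_simps)
  then show ?thesis
    by (simp only: S_mult_spow W_mult_spow) (simp add: algebra_simps)
qed

lemma DERIV_intP: "(intP has_real_derivative P x) (at x)"
proof -
  have "((\<lambda>x. (x - S x * W x) / p) has_real_derivative (1 - (1 - p * P x)) / p) (at x)"
    by (intro DERIV_cdivide DERIV_diff DERIV_ident DERIV_SW)
  then show ?thesis
    using p_gt_1 by (simp add: intP_def[abs_def])
qed

lemma intP_0 [simp]: "intP 0 = 0" by (simp add: intP_def S_0)

lemma continuous_on_S [continuous_intros]: "continuous_on A f \<Longrightarrow> continuous_on A (\<lambda>x. S (f x))"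
  and continuous_on_W [continuous_intros]: "continuous_on A f \<Longrightarrow> continuous_on A (\<lambda>x. W (f x))"
  and continuous_on_P [continuous_intros]: "continuous_on A f \<Longrightarrow> continuous_on A (\<lambda>x. P (f x))"
  by (rule continuous_on_compose2[of UNIV], rule DERIV_continuous_on,
      rule DERIV_S DERIV_W DERIV_P, assumption, simp)+

lemma continuous_on_dP [continuous_intros]: "continuous_on A f \<Longrightarrow> continuous_on A (\<lambda>x. dP (f x))"
  unfolding dP_def using p_gt_1 by (intro continuous_intros) auto

text \<open>At an interior maximum the derivative of \<open>S\<close> vanishes, so
  \<open>W = 0\<close> and \<open>S = 1\<close>. As \<open>S\<close> is Lipschitz with constant
  \<open>1\<close>, the ascent to this value and the descent from it each take at least time
  \<open>1\<close>.\<close>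

lemma hp_ge_2: "hp \<ge> 2"
proof -
  have S_hp: "S hp = 0" using S_eq_0_iff[of hp] by (metis mult_1 of_int_1)
  have "\<exists>x\<in>{0..hp}. \<forall>y\<in>{0..hp}. S y \<le> S x"
    by (intro continuous_attains_sup) (use hp_pos in \<open>auto intro!: continuous_intros\<close>)
  then obtain x where x: "x \<in> {0..hp}" "\<And>y. y \<in> {0..hp} \<Longrightarrow> S y \<le> S x" by blast
  have "S x > 0" using x(2)[of "hp / 2"] S_pos[of "hp / 2"] hp_pos by auto
  then have x': "0 < x" "x < hp"
    using x(1) S_0 S_hp by (auto simp: order.strict_iff_order)
  have "spow (1 / (p - 1)) (W x) = 0"
  proof (rule DERIV_local_max[OF DERIV_S])
    show "0 < min x (hp - x)" using x' by simp
    show "\<forall>y. \<bar>x - y\<bar> < min x (hp - x) \<longrightarrow> S y \<le> S x"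
      using x(2) by (auto simp: abs_if split: if_splits)
  qed
  then have "P x = 1" using W_mult_spow[of x] by simp
  moreover have "\<bar>S x\<bar> powr p < 1" if "S x < 1"
    using \<open>S x > 0\<close> that p_gt_1 powr_less_mono2[of p "S x" 1] by simp
  ultimately have Sx: "S x \<ge> 1" by (force simp: P_def)
  have lip: "\<bar>S b - S a\<bar> \<le> b - a" if "a \<le> b" for a b
  proof -
    have "norm (S b - S a) \<le> 1 * norm (b - a)"
      by (rule field_differentiable_bound[of UNIV S "\<lambda>x. spow (1 / (p - 1)) (W x)"])
        (use DERIV_S abs_spow_W_le_1 in auto)
    then show ?thesis using that by simp
  qed
  show ?thesis using lip[of 0 x] lip[of x hp] Sx x' S_0 S_hp by auto
qed

text \<open>For \<open>c = 1\<close> the energy \<open>rho\<close> is conserved; in general its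
  derivative is at most a multiple of \<open>rho\<close>. The two exponential bounds play the part
  of a uniqueness theorem: nonzero initial data never reach zero energy, and zero data force the
  zero solution.\<close>

lemma energy_bounds:
  fixes u v c :: "real \<Rightarrow> real"
  assumes c: "continuous_on {0..l} c"
    and u: "\<And>x. x \<in> {0..l} \<Longrightarrow>
      (u has_real_derivative z * spow (1 / (p - 1)) (v x)) (at x within {0..l})"
    and v: "\<And>x. x \<in> {0..l} \<Longrightarrow>
      (v has_real_derivative - ((p - 1) * z * c x * spow (p - 1) (u x))) (at x within {0..l})"
  defines "rho \<equiv> \<lambda>x. \<bar>u x\<bar> powr p + \<bar>v x\<bar> powr (p / (p - 1))"
  shows "x \<in> {0..l} \<Longrightarrow> (rho has_real_derivative
      p * z * (1 - c x) * spow (p - 1) (u x) * spow (1 / (p - 1)) (v x)) (at x within {0..l})"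
    and "\<exists>L. \<forall>x\<in>{0..l}. rho 0 \<le> exp (L * x) * rho x \<and> rho x \<le> exp (L * x) * rho 0"
proof -
  let ?I = "{0..l}"
  define s where "s = 1 / (p - 1)"
  define q where "q = p / (p - 1)"
  have ps: "p > 1" "s > 0" "(p - 1) * s = 1" "q > 1" "q = s + 1" "p * s = q" "q * (p - 1) = p"
    using p_gt_1 by (auto simp: s_def q_def field_simps)
  note u = u[folded s_def]
  define A where "A x = spow (p - 1) (u x)" for x
  define B where "B x = spow s (v x)" for x
  have rho_def: "rho x = \<bar>u x\<bar> powr p + \<bar>v x\<bar> powr q" for x
    by (simp add: assms(4) q_def)
  have d_rho: "(rho has_real_derivative p * z * (1 - c x) * A x * B x) (at x within ?I)"
    if "x \<in> ?I" for x
  proof -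
    have d1: "((\<lambda>x. \<bar>u x\<bar> powr p) has_real_derivative p * A x * (z * B x)) (at x within ?I)"
      unfolding A_def B_def by (rule DERIV_chain2[OF DERIV_abs_powr[OF ps(1)] u[OF that]])
    have "q - 1 = s" using ps by simp
    then have d2: "((\<lambda>x. \<bar>v x\<bar> powr q) has_real_derivative
        q * B x * - ((p - 1) * z * c x * A x)) (at x within ?I)"
      using DERIV_chain2[OF DERIV_abs_powr[OF ps(4)] v[OF that]] unfolding A_def B_def by metis
    have "q * B x * - ((p - 1) * z * c x * A x) = - ((q * (p - 1)) * z * c x * A x * B x)"
      by (simp only: mult_minus_right mult_ac)
    then have "q * B x * - ((p - 1) * z * c x * A x) = - (p * z * c x * A x * B x)"
      unfolding ps(7) .
    with DERIV_add[OF d1 d2] show ?thesis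
      unfolding fun_eq_iff[THEN iffD2, OF allI, OF rho_def]
      by (elim back_subst[where P = "\<lambda>d. (_ has_real_derivative d) _"]) (simp add: algebra_simps)
  qed
  have AB_le: "\<bar>A x * B x\<bar> \<le> rho x" for x
  proof -
    \<comment> \<open>\<open>\<bar>A\<bar>\<close> and \<open>\<bar>B\<bar>\<close> are powers of
      the two summands of \<open>rho\<close> with exponents \<open>(p - 1) / p\<close> and
      \<open>1 / p\<close>, which add up to \<open>1\<close>.\<close>
    define M where "M = max (\<bar>u x\<bar> powr p) (\<bar>v x\<bar> powr q)"
    have M0: "M \<ge> 0" by (simp add: M_def max_def)
    have e: "p * ((p - 1) / p) = p - 1" "q * (1 / p) = s" "(p - 1) / p + 1 / p = 1"
      using ps(1) by (auto simp: q_def s_def field_simps)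
    have "\<bar>A x\<bar> = (\<bar>u x\<bar> powr p) powr ((p - 1) / p)"
      unfolding A_def abs_spow powr_powr e ..
    moreover have "\<bar>B x\<bar> = (\<bar>v x\<bar> powr q) powr (1 / p)"
      unfolding B_def abs_spow powr_powr e ..
    ultimately have "\<bar>A x\<bar> * \<bar>B x\<bar> \<le> M powr ((p - 1) / p) * M powr (1 / p)"
      using ps(1) by (auto intro!: mult_mono powr_mono2 simp: M_def)
    also have "\<dots> = M powr 1" unfolding powr_add[symmetric] e ..
    also have "\<dots> = M" using M0 by simp
    also have "M \<le> rho x" by (simp add: M_def rho_def)
    finally show ?thesis by (simp add: abs_mult)
  qed
  show "(rho has_real_derivative
      p * z * (1 - c x) * spow (p - 1) (u x) * spow (1 / (p - 1)) (v x)) (at x within ?I)" if "x \<in> ?I"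
    using d_rho[OF that] by (simp add: A_def B_def s_def)
  show "\<exists>L. \<forall>x\<in>?I. rho 0 \<le> exp (L * x) * rho x \<and> rho x \<le> exp (L * x) * rho 0"
  proof -
    have "bounded ((\<lambda>x. p * z * (1 - c x)) ` ?I)"
      by (intro compact_imp_bounded compact_continuous_image continuous_intros c) auto
    then obtain L where L: "\<And>x. x \<in> ?I \<Longrightarrow> \<bar>p * z * (1 - c x)\<bar> \<le> L"
      unfolding bounded_iff by (metis imageI real_norm_def)
    have est: "\<bar>p * z * (1 - c y) * A y * B y\<bar> \<le> L * rho y" if "y \<in> ?I" for y
      unfolding mult.assoc[of _ "A y"] abs_mult[of "p * z * (1 - c y)"]
      using L[OF that] AB_le[of y] abs_ge_zero[of "p * z * (1 - c y)"] by (intro mult_mono) linarith+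
    have d: "((\<lambda>x. exp (M * x) * rho x) has_real_derivative
        exp (M * y) * (M * rho y + p * z * (1 - c y) * A y * B y)) (at y within {0..x})"
      if "y \<in> {0..x}" "x \<in> ?I" for x y M
    proof -
      have yI: "y \<in> ?I" using that by auto
      have "((\<lambda>x. exp (M * x) * rho x) has_real_derivative
          exp (M * y) * (M * rho y + p * z * (1 - c y) * A y * B y)) (at y within ?I)"
        by (rule derivative_eq_intros d_rho[OF yI] refl)+ (simp add: algebra_simps)
      then show ?thesis by (rule DERIV_subset) (use that in auto)
    qed
    show ?thesis
    proof (intro exI ballI conjI)
      fix x assume x: "x \<in> ?I"
      have "exp (L * 0) * rho 0 \<le> exp (L * x) * rho x"
      proof (rule DERIV_nonneg_within_imp_le[where f = "\<lambda>x. exp (L * x) * rho x", OF _ d])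
        show "0 \<le> exp (L * y) * (L * rho y + p * z * (1 - c y) * A y * B y)" if "0 < y" "y < x" for y
          using est[of y] that x by (intro mult_nonneg_nonneg) (auto simp: abs_le_iff)
      qed (use x in auto)
      then show "rho 0 \<le> exp (L * x) * rho x" by simp
      have "- (exp (- L * 0) * rho 0) \<le> - (exp (- L * x) * rho x)"
      proof (rule DERIV_nonneg_within_imp_le[where f = "\<lambda>x. - (exp (- L * x) * rho x)", OF _ DERIV_minus[OF d]])
        show "0 \<le> - (exp (- L * y) * (- L * rho y + p * z * (1 - c y) * A y * B y))" if "0 < y" "y < x" for y
          using est[of y] that x unfolding mult_minus_right[symmetric]
          by (intro mult_nonneg_nonneg) (auto simp: abs_le_iff)
      qed (use x in auto)
      then show "rho x \<le> exp (L * x) * rho 0" by (simp add: exp_minus field_simps)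
    qed
  qed
qed

text \<open>A Pruefer angle is obtained by projecting the solution to the curve, taking its
  polar angle and comparing with the polar angle of the generalized sine; both are explicit
  integrals, so that no uniqueness theorem for the half-linear equation is needed.\<close>

lemma pruefer_angle_exists:
  fixes u v c :: "real \<Rightarrow> real"
  assumes z: "z > 0" and l: "l > 0" and c: "continuous_on {0..l} c"
    and u: "\<And>x. x \<in> {0..l} \<Longrightarrow>
      (u has_real_derivative z * spow (1 / (p - 1)) (v x)) (at x within {0..l})"
    and v: "\<And>x. x \<in> {0..l} \<Longrightarrow>
      (v has_real_derivative - ((p - 1) * z * c x * spow (p - 1) (u x))) (at x within {0..l})"
    and init: "u 0 = 0" "v 0 > 0"
  obtains \<phi> where "\<phi> 0 = 0"
    and "\<And>x. x \<in> {0..l} \<Longrightarrow>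
      (\<phi> has_real_derivative z * (1 + (c x - 1) * P (\<phi> x))) (at x within {0..l})"
    and "\<And>x. x \<in> {0..l} \<Longrightarrow> u x = 0 \<longleftrightarrow> S (\<phi> x) = 0"
proof -
  let ?I = "{0..l}"
  define s where "s = 1 / (p - 1)"
  define q where "q = p / (p - 1)"
  have ps: "p > 1" "s > 0" "(p - 1) * s = 1" "q > 1" "q = s + 1" "p * s = q" "q * (p - 1) = p"
    using p_gt_1 by (auto simp: s_def q_def field_simps)
  note u = u[folded s_def] and W_spow = W_mult_spow[folded s_def]
  define A where "A x = spow (p - 1) (u x)" for x
  define B where "B x = spow s (v x)" for x
  define rho where "rho x = \<bar>u x\<bar> powr p + \<bar>v x\<bar> powr q" for x
  have rho_eq: "rho x = u x * A x + v x * B x" for x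
    using mult_spow[of "u x" "p - 1"] mult_spow[of "v x" s] ps
    by (simp add: rho_def A_def B_def)
  have contu: "continuous_on ?I u"
    by (rule DERIV_continuous_on[OF u])
  have rho': "rho = (\<lambda>x. \<bar>u x\<bar> powr p + \<bar>v x\<bar> powr (p / (p - 1)))"
    by (simp add: rho_def fun_eq_iff q_def)
  have d_rho: "(rho has_real_derivative p * z * (1 - c x) * A x * B x) (at x within ?I)"
    if "x \<in> ?I" for x
    unfolding A_def B_def s_def rho'
    by (rule energy_bounds(1)[OF c u[unfolded s_def] v]) (use that in auto)
  have rho_pos: "rho x > 0" if x: "x \<in> ?I" for x
  proof -
    have "\<exists>L. \<forall>x\<in>?I. rho 0 \<le> exp (L * x) * rho x \<and> rho x \<le> exp (L * x) * rho 0"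
      unfolding rho' by (rule energy_bounds(2)[OF c u[unfolded s_def] v]) auto
    then obtain L where "rho 0 \<le> exp (L * x) * rho x" using x by blast
    moreover have "rho 0 > 0" using init by (simp add: rho_def)
    ultimately show ?thesis by (smt (verit) exp_gt_zero zero_less_mult_iff)
  qed
  define k where "k x = rho x powr (- 1 / p)" for x
  define h where "h x = rho x powr (- 1 / q)" for x
  define U where "U x = u x * k x" for x
  define V where "V x = v x * h x" for x
  \<comment> \<open>Speed of the projected point along the curve, in the time of the generalized
    sine; it turns out to be the derivative of \<open>\<phi>\<close>.\<close>
  define g where "g x = z * (1 + (c x - 1) * (u x * A x / rho x))" for x
  have kh_pos: "k x > 0" "h x > 0" if "x \<in> ?I" for x
    using rho_pos[OF that] by (auto simp: k_def h_def)
  have d_powr: "((\<lambda>x. rho x powr e) has_real_derivative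
      rho x powr e * (e * (p * (z * (1 - c x) * A x * B x)) / rho x)) (at x within ?I)"
    if "x \<in> ?I" for x e
    using DERIV_chain2[OF has_real_derivative_powr[OF rho_pos[OF that]] d_rho[OF that], of e]
      rho_pos[OF that]
    by (simp add: powr_diff field_simps)
  have d_k: "(k has_real_derivative - k x * (z * (1 - c x) * A x * B x) / rho x) (at x within ?I)"
    if "x \<in> ?I" for x
  proof -
    have "- 1 / p * (p * X) = - X" for X
      using ps(1) by simp
    with d_powr[OF that, of "- 1 / p"] show ?thesis
      unfolding k_def by (simp only: mult_minus_left mult_minus_right minus_divide_left times_divide_eq_right)
  qed
  have d_h: "(h has_real_derivative - h x * ((p - 1) * (z * (1 - c x) * A x * B x)) / rho x) (at x within ?I)"
    if "x \<in> ?I" for x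
  proof -
    have "- 1 / q * (p * X) = - ((p - 1) * X)" for X
      using ps(1) by (simp add: q_def field_simps)
    with d_powr[OF that, of "- 1 / q"] show ?thesis
      unfolding h_def by (simp only: mult_minus_left mult_minus_right minus_divide_left times_divide_eq_right)
  qed
  have k_h: "h x powr s = k x" "k x powr (p - 1) = h x" for x
  proof -
    have "(- 1 / q) * s = - 1 / p" "(- 1 / p) * (p - 1) = - 1 / q"
      using ps(1) by (auto simp: q_def s_def field_simps)
    then show "h x powr s = k x" "k x powr (p - 1) = h x"
      unfolding h_def k_def powr_powr by metis+
  qed
  have spow_V: "spow s (V x) = k x * B x" if "x \<in> ?I" for x
    using spow_mult_pos[OF kh_pos(2)[OF that], of s "v x"] by (simp add: V_def B_def k_h mult.commute)
  have spow_U: "spow (p - 1) (U x) = h x * A x" if "x \<in> ?I" for x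
    using spow_mult_pos[OF kh_pos(1)[OF that], of "p - 1" "u x"] by (simp add: U_def A_def k_h mult.commute)
  have d_U: "(U has_real_derivative spow s (V x) * g x) (at x within ?I)" if "x \<in> ?I" for x
    unfolding spow_V[OF that] g_def U_def
    apply (rule derivative_eq_intros d_k[OF that] u[OF that] refl)+
    using rho_pos[OF that] apply (simp add: field_simps flip: B_def)
    done
  have d_V: "(V has_real_derivative - ((p - 1) * spow (p - 1) (U x)) * g x) (at x within ?I)"
    if "x \<in> ?I" for x
    unfolding spow_U[OF that] g_def V_def
    apply (rule derivative_eq_intros d_h[OF that] v[OF that] refl)+
    using rho_pos[OF that] apply (simp add: field_simps flip: A_def)
    using rho_eq[of x] apply algebra
    done
  have powr_kh: "k x powr p = 1 / rho x" "h x powr q = 1 / rho x" if "x \<in> ?I" for x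
  proof -
    have "- 1 / p * p = - 1" "- 1 / q * q = - 1" using ps(1,4) by auto
    then show "k x powr p = 1 / rho x" "h x powr q = 1 / rho x"
      unfolding k_def h_def powr_powr using rho_pos[OF that]
      by (simp_all only: powr_minus_divide powr_one less_imp_le)
  qed
  have U_powr: "\<bar>U x\<bar> powr p = u x * A x / rho x" if "x \<in> ?I" for x
    using mult_spow[of "u x" "p - 1"] powr_kh[OF that] kh_pos[OF that]
    by (simp add: U_def A_def abs_mult powr_mult)
  have V_powr: "\<bar>V x\<bar> powr q = v x * B x / rho x" if "x \<in> ?I" for x
    using mult_spow[of "v x" s] powr_kh[OF that] kh_pos[OF that] ps(5)
    by (simp add: V_def B_def abs_mult powr_mult)
  have pyth: "\<bar>U x\<bar> powr p + \<bar>V x\<bar> powr q = 1" if "x \<in> ?I" for x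
    using rho_pos[OF that] unfolding U_powr[OF that] V_powr[OF that]
    by (simp add: rho_eq flip: add_divide_distrib)
  \<comment> \<open>Rate of the polar angle under the flow on the curve: the angle \<open>F\<close>
    of the generalized sine has derivative \<open>kap (S x) (W x)\<close>, the angle
    \<open>\<beta>\<close> of the projected solution has derivative
    \<open>g x * kap (U x) (V x)\<close>.\<close>
  define kap where "kap a b = (b * spow s b + (p - 1) * (a * spow (p - 1) a)) / (a\<^sup>2 + b\<^sup>2)" for a b :: real
  have nz: "a\<^sup>2 + b\<^sup>2 > 0" if "\<bar>a\<bar> powr p + \<bar>b\<bar> powr q = 1" for a b :: real
  proof -
    have "a \<noteq> 0 \<or> b \<noteq> 0" using that by auto
    then show ?thesis by (simp add: sum_power2_gt_zero_iff)
  qed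
  have pythS: "\<bar>S x\<bar> powr p + \<bar>W x\<bar> powr q = 1" for x
    using pythagoras by (simp add: q_def)
  have contU: "continuous_on ?I U" and contV: "continuous_on ?I V"
    by (rule DERIV_continuous_on[OF d_U], assumption) (rule DERIV_continuous_on[OF d_V])
  have cont_rho: "continuous_on ?I rho"
    using d_rho by (rule DERIV_continuous_on)
  have contg: "continuous_on ?I g"
    unfolding g_def A_def by (intro continuous_intros c contu cont_rho)
      (use ps(1,2,4) rho_pos in \<open>auto simp: less_imp_neq[symmetric]\<close>)
  have nzU: "\<forall>x\<in>?I. (U x)\<^sup>2 + (V x)\<^sup>2 \<noteq> 0" and nzS: "\<forall>x\<in>UNIV. (S x)\<^sup>2 + (W x)\<^sup>2 \<noteq> 0"
    using nz[OF pyth] nz[OF pythS] by (metis less_irrefl)+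
  have "s > 0" "p - 1 > 0" using ps(1,2) by simp_all
  note cont = continuous_on_divide continuous_on_add continuous_on_mult continuous_on_const
    continuous_on_power continuous_on_spow[OF \<open>s > 0\<close>] continuous_on_spow[OF \<open>p - 1 > 0\<close>]
  have "continuous_on ?I (\<lambda>x. g x * kap (U x) (V x))"
    unfolding kap_def by (intro cont contg contU contV nzU)
  then obtain \<beta> where \<beta>: "\<beta> 0 = 0"
    "\<And>x. x \<in> ?I \<Longrightarrow> (\<beta> has_real_derivative g x * kap (U x) (V x)) (at x within ?I)"
    using antiderivative_from_0 by blast
  have cont_kap: "continuous_on UNIV (\<lambda>x. kap (S x) (W x))"
    unfolding kap_def by (intro cont continuous_on_S continuous_on_W continuous_on_id nzS)
  define m where "m = min 1 (p - 1) / 2"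
  have m: "m > 0" "kap (S x) (W x) \<ge> m" for x
  proof -
    show "m > 0" using ps by (simp add: m_def)
    have "m * 2 \<le> 1" "m * 2 \<le> p - 1" by (simp_all add: m_def)
    then have "m * 2 * (1 - P x) \<le> 1 * (1 - P x)" "m * 2 * P x \<le> (p - 1) * P x"
      using P_nonneg P_le_1 by (simp_all only: mult_right_mono diff_ge_0_iff_ge)
    then have "m * 2 \<le> (1 - P x) + (p - 1) * P x"
      unfolding right_diff_distrib by linarith
    moreover have "m * ((S x)\<^sup>2 + (W x)\<^sup>2) \<le> m * 2"
    proof (rule mult_left_mono)
      have "(S x)\<^sup>2 \<le> 1" "(W x)\<^sup>2 \<le> 1"
        using abs_S_le_1[of x] abs_W_le_1[of x] by (auto simp: abs_square_le_1)
      then show "(S x)\<^sup>2 + (W x)\<^sup>2 \<le> 2" by simp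
    qed (use \<open>m > 0\<close> in simp)
    ultimately show "kap (S x) (W x) \<ge> m"
      unfolding kap_def pos_le_divide_eq[OF nz[OF pythS]] S_mult_spow W_spow by linarith
  qed
  obtain F G where F: "F 0 = 0" "\<And>x. (F has_real_derivative kap (S x) (W x)) (at x)"
    "\<And>x. G (F x) = x" "\<And>y. F (G y) = y"
    and G: "\<And>y. (G has_real_derivative inverse (kap (S (G y)) (W (G y)))) (at y)"
    using diffeomorphism_from_derivative[OF cont_kap m] by metis
  \<comment> \<open>The time at which the generalized sine has polar angle
    \<open>\<beta> x\<close>.\<close>
  define \<phi> where "\<phi> x = G (\<beta> x)" for x
  have polarS: "S y = sqrt ((S y)\<^sup>2 + (W y)\<^sup>2) * sin (F y)" "W y = sqrt ((S y)\<^sup>2 + (W y)\<^sup>2) * cos (F y)" for y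
  proof -
    have "(F has_real_derivative
        (spow s (W x) * W x - S x * - ((p - 1) * spow (p - 1) (S x))) / ((S x)\<^sup>2 + (W x)\<^sup>2)) (at x within UNIV)" for x
      using F(2)[of x] by (simp add: kap_def algebra_simps)
    from polar_angle[OF convex_UNIV UNIV_I DERIV_S[folded s_def] DERIV_W this nz[OF pythS] S_0 _ F(1) UNIV_I] W_0
    show "S y = sqrt ((S y)\<^sup>2 + (W y)\<^sup>2) * sin (F y)" "W y = sqrt ((S y)\<^sup>2 + (W y)\<^sup>2) * cos (F y)"
      by simp_all
  qed
  have polarU: "U x = sqrt ((U x)\<^sup>2 + (V x)\<^sup>2) * sin (\<beta> x)" "V x = sqrt ((U x)\<^sup>2 + (V x)\<^sup>2) * cos (\<beta> x)"
    if "x \<in> ?I" for x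
  proof -
    have b: "(\<beta> has_real_derivative
        (spow s (V x) * g x * V x - U x * (- ((p - 1) * spow (p - 1) (U x)) * g x)) / ((U x)\<^sup>2 + (V x)\<^sup>2)) (at x within ?I)"
      if "x \<in> ?I" for x
      using \<beta>(2)[OF that]
      by (rule back_subst[where P = "\<lambda>d. (_ has_real_derivative d) _"]) (simp add: kap_def algebra_simps)
    have "0 \<in> ?I" "U 0 = 0" "V 0 > 0"
      using l init kh_pos[of 0] by (auto simp: U_def V_def)
    then show "U x = sqrt ((U x)\<^sup>2 + (V x)\<^sup>2) * sin (\<beta> x)" "V x = sqrt ((U x)\<^sup>2 + (V x)\<^sup>2) * cos (\<beta> x)"
      using polar_angle[OF _ _ d_U d_V b nz[OF pyth] _ _ \<beta>(1) that] by blast+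
  qed
  have eq: "U x = S (\<phi> x)" "V x = W (\<phi> x)" if "x \<in> ?I" for x
  proof -
    define y where "y = \<phi> x"
    define \<sigma> \<tau> where "\<sigma> = sqrt ((S y)\<^sup>2 + (W y)\<^sup>2)" and "\<tau> = sqrt ((U x)\<^sup>2 + (V x)\<^sup>2)"
    define t where "t = \<tau> / \<sigma>"
    have pos: "\<tau> > 0" "\<sigma> > 0"
      unfolding \<sigma>_def \<tau>_def using nz[OF pyth[OF that]] nz[OF pythS[of y]] by (simp_all only: real_sqrt_gt_0_iff)
    then have t: "t > 0" "t * \<sigma> = \<tau>" by (simp_all add: t_def)
    have Fy: "F y = \<beta> x" by (simp add: y_def \<phi>_def F)
    have "S y = \<sigma> * sin (\<beta> x)" "W y = \<sigma> * cos (\<beta> x)" "U x = \<tau> * sin (\<beta> x)" "V x = \<tau> * cos (\<beta> x)"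
      using polarS[of y] polarU[OF that] unfolding Fy \<sigma>_def \<tau>_def by blast+
    then have tS: "t * S y = U x" "t * W y = V x"
      by (simp_all add: t(2) flip: mult.assoc)
    have "t = 1"
      using curve_ray_unique[of p q t "S y" "W y"] ps(1,4) t(1) pythS[of y] pyth[OF that]
      unfolding tS by simp
    then show "U x = S (\<phi> x)" "V x = W (\<phi> x)" using tS by (simp_all add: y_def)
  qed
  show ?thesis
  proof (rule that)
    show "\<phi> 0 = 0" using F(3)[of 0] by (simp add: \<phi>_def \<beta> F)
    fix x assume x: "x \<in> ?I"
    have "kap (U x) (V x) > 0" using m(1) m(2)[of "\<phi> x"] by (simp add: eq[OF x])
    then have "(\<phi> has_real_derivative g x) (at x within ?I)"
      using DERIV_chain2[OF G \<beta>(2)[OF x]] eq[OF x] unfolding \<phi>_def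
      by (elim back_subst[where P = "\<lambda>d. (_ has_real_derivative d) _"]) simp
    moreover have "g x = z * (1 + (c x - 1) * P (\<phi> x))"
      using U_powr[OF x] eq[OF x] by (simp add: g_def P_def)
    ultimately show "(\<phi> has_real_derivative z * (1 + (c x - 1) * P (\<phi> x))) (at x within ?I)" by simp
    show "u x = 0 \<longleftrightarrow> S (\<phi> x) = 0"
      using eq[OF x] kh_pos[OF x] by (auto simp: U_def)
  qed
qed

text \<open>Restores the amplitude: \<open>u = exp R * S \<phi>\<close> and
  \<open>v = exp ((p - 1) * R) * W \<phi>\<close> respect the scaling of the system, and inserting
  them into it dictates the derivative of \<open>R\<close>, which is then integrated.\<close>

lemma solution_from_pruefer_angle:
  fixes \<phi> c :: "real \<Rightarrow> real"
  assumes c: "continuous_on {0..l} c"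
    and \<phi>: "\<And>x. x \<in> {0..l} \<Longrightarrow>
      (\<phi> has_real_derivative z * (1 + (c x - 1) * P (\<phi> x))) (at x within {0..l})"
  obtains u v where
    "\<And>x. x \<in> {0..l} \<Longrightarrow>
      (u has_real_derivative z * spow (1 / (p - 1)) (v x)) (at x within {0..l})"
    "\<And>x. x \<in> {0..l} \<Longrightarrow>
      (v has_real_derivative - ((p - 1) * z * c x * spow (p - 1) (u x))) (at x within {0..l})"
    "\<And>x. u x = 0 \<longleftrightarrow> S (\<phi> x) = 0"
proof -
  let ?I = "{0..l}"
  define s where "s = 1 / (p - 1)"
  have ps: "p > 1" "s > 0" "(p - 1) * s = 1"
    using p_gt_1 by (auto simp: s_def field_simps)
  define A where "A x = spow (p - 1) (S (\<phi> x))" for x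
  define B where "B x = spow s (W (\<phi> x))" for x
  have SA: "S (\<phi> x) * A x = P (\<phi> x)" and WB: "W (\<phi> x) * B x = 1 - P (\<phi> x)" for x
    using S_mult_spow W_mult_spow by (simp_all add: A_def B_def s_def)
  have P_eq: "P (\<phi> x) = 1 - W (\<phi> x) * B x" for x using WB[of x] by simp
  have "continuous_on ?I \<phi>" using \<phi> by (rule DERIV_continuous_on)
  then have "continuous_on ?I (\<lambda>x. z * (1 - c x) * A x * B x)"
    unfolding A_def B_def by (intro continuous_intros c) (use ps in auto)
  then obtain R where R: "\<And>x. x \<in> ?I \<Longrightarrow> (R has_real_derivative z * (1 - c x) * A x * B x) (at x within ?I)"
    using antiderivative_from_0 by blast
  define u where "u x = exp (R x) * S (\<phi> x)" for x
  define v where "v x = exp ((p - 1) * R x) * W (\<phi> x)" for x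
  have spow_v: "spow s (v x) = exp (R x) * B x" for x
  proof -
    have "(p - 1) * R x * s = R x * ((p - 1) * s)" by (simp only: mult_ac)
    then have "(p - 1) * R x * s = R x" by (simp only: ps mult_1_right)
    then have "exp ((p - 1) * R x) powr s = exp (R x)"
      by (simp add: powr_def mult.commute)
    then show ?thesis unfolding v_def B_def by (subst spow_mult_pos) auto
  qed
  have spow_u: "spow (p - 1) (u x) = exp ((p - 1) * R x) * A x" for x
    unfolding u_def A_def by (subst spow_mult_pos) (auto simp: powr_def)
  show ?thesis
  proof (rule that[of u v])
    fix x assume x: "x \<in> ?I"
    have dS: "((\<lambda>x. S (\<phi> x)) has_real_derivative B x * (z * (1 + (c x - 1) * P (\<phi> x)))) (at x within ?I)"
      unfolding B_def s_def by (rule DERIV_chain2[OF DERIV_S \<phi>[OF x]])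
    have dW: "((\<lambda>x. W (\<phi> x)) has_real_derivative
        - ((p - 1) * A x) * (z * (1 + (c x - 1) * P (\<phi> x)))) (at x within ?I)"
      unfolding A_def by (rule DERIV_chain2[OF DERIV_W \<phi>[OF x]])
    have "(u has_real_derivative z * spow s (v x)) (at x within ?I)"
      unfolding spow_v unfolding u_def
      apply (rule derivative_eq_intros dS R[OF x] refl)+
      unfolding SA[symmetric] apply (simp add: algebra_simps)
      done
    then show "(u has_real_derivative z * spow (1 / (p - 1)) (v x)) (at x within ?I)"
      by (simp add: s_def)
    show "(v has_real_derivative - ((p - 1) * z * c x * spow (p - 1) (u x))) (at x within ?I)"
      unfolding spow_u unfolding v_def
      apply (rule derivative_eq_intros dW R[OF x] refl)+
      unfolding P_eq apply (simp add: algebra_simps)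
      done
  qed (simp add: u_def)
qed

section \<open>The comparison function\<close>

definition D :: "real \<Rightarrow> real"
  where "D b = (p + 1) * intP b - b * P b"

text \<open>Quotient of the slopes \<open>p + 1\<close> and \<open>(p - 1) / (2 * p\<^sup>2)\<close>
  of the linear bounds in \<open>D_upper\<close> and \<open>D_lower\<close>.\<close>

definition K :: real
  where "K = 2 * p\<^sup>2 * (p + 1) / (p - 1)"

lemma K_ge_1: "K \<ge> 1"
proof -
  have "p - 1 \<le> 2 * 1 * (p + 1)" using p_gt_1 by simp
  also have "\<dots> \<le> 2 * p\<^sup>2 * (p + 1)"
    using p_gt_1 by (intro mult_right_mono mult_left_mono) (auto simp: one_le_power)
  finally show ?thesis using p_gt_1 by (simp add: K_def)
qed

lemma D_0 [simp]: "D 0 = 0" by (simp add: D_def)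

lemma DERIV_D: "(D has_real_derivative p * P b - b * dP b) (at b)"
  unfolding D_def[abs_def]
  by (rule derivative_eq_intros DERIV_P DERIV_intP refl)+ (simp add: algebra_simps)

lemma continuous_on_D: "continuous_on A D"
  by (rule DERIV_continuous_on[OF DERIV_subset[OF DERIV_D]]) simp

text \<open>The expression is \<open>p * spow (p - 1) (S b)\<close> times
  \<open>S b - b * S' b\<close>. On \<open>(0, hp)\<close> the derivative of \<open>S\<close>
  decreases together with \<open>W\<close>, so \<open>S\<close> lies strictly above
  \<open>b * S' b\<close> by the mean value theorem.\<close>

lemma DERIV_D_pos:
  assumes "0 < b" "b < hp"
  shows "p * P b - b * dP b > 0"
proof -
  let ?C = "\<lambda>x. spow (1 / (p - 1)) (W x)"
  obtain \<xi> where \<xi>: "0 < \<xi>" "\<xi> < b" "S b - S 0 = (b - 0) * ?C \<xi>"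
    using MVT2[of 0 b S ?C] DERIV_S assms by blast
  have "W b < W \<xi>"
  proof (rule DERIV_neg_imp_decreasing[OF \<xi>(2)])
    fix x assume "\<xi> \<le> x" "x \<le> b"
    then have "spow (p - 1) (S x) > 0" using S_pos[of x] \<xi> assms by (simp add: spow_pos_iff)
    then show "\<exists>y. (W has_real_derivative y) (at x) \<and> y < 0"
      using DERIV_W[of x] p_gt_1 by (intro exI[of _ "- ((p - 1) * spow (p - 1) (S x))"]) auto
  qed
  then have "?C b < ?C \<xi>" using exponents by (intro spow_strict_mono)
  then have "b * ?C b < S b" using \<xi>(3) assms by (simp add: S_0)
  moreover have "p * P b - b * dP b = p * spow (p - 1) (S b) * (S b - b * ?C b)"
    by (simp add: dP_def algebra_simps flip: S_mult_spow)
  ultimately show ?thesis using S_pos[OF assms] p_gt_1 by (simp add: spow_pos_iff)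
qed

lemma D_strict_mono:
  assumes "0 \<le> a" "a < b" "b \<le> hp"
  shows "D a < D b"
proof (rule DERIV_pos_imp_increasing_open[OF assms(2) _ continuous_on_D])
  fix x assume "a < x" "x < b"
  then show "\<exists>y. (D has_real_derivative y) (at x) \<and> y > 0"
    using DERIV_D DERIV_D_pos[of x] assms by (intro exI conjI) auto
qed

text \<open>With \<open>w = 1 - P b\<close>, Young's inequality for the conjugate exponents
  \<open>p\<close> and \<open>p / (p - 1)\<close> bounds \<open>(p + 1) * (S b * W b)\<close> by
  \<open>(p + 1) / p + p * w\<close>. The term \<open>b * (p * w)\<close> in \<open>p * D b\<close>
  absorbs the second summand, and \<open>b \<ge> 2\<close> keeps a fixed fraction of
  \<open>b\<close> after subtracting the first.\<close>

lemma D_lower: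
  assumes "hp \<le> b"
  shows "D b \<ge> (p - 1) / (2 * p\<^sup>2) * b"
proof -
  define w where "w = \<bar>W b\<bar> powr (p / (p - 1))"
  have b: "b \<ge> 2" using assms hp_ge_2 by simp
  have w: "w \<ge> 0" "P b = 1 - w"
    using pythagoras[of b] by (auto simp: w_def P_def)
  have "1 * \<bar>W b\<bar> \<le> 1 powr p / p + w / (p / (p - 1))"
    unfolding w_def by (rule Youngs_inequality) (use p_gt_1 in \<open>auto simp: field_simps\<close>)
  then have "\<bar>W b\<bar> \<le> (1 + (p - 1) * w) / p" using p_gt_1 by (simp add: add_divide_distrib mult.commute)
  moreover have "\<bar>S b * W b\<bar> \<le> \<bar>W b\<bar>"
    using abs_S_le_1[of b] by (simp add: abs_mult mult_left_le_one_le)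
  ultimately have "S b * W b \<le> (1 + (p - 1) * w) / p" by linarith
  then have "(p + 1) * (S b * W b) \<le> (p + 1) * ((1 + (p - 1) * w) / p)"
    using p_gt_1 by (intro mult_left_mono) auto
  also have "\<dots> = (p + 1) / p + (p - 1 / p) * w"
    using p_gt_1 by (simp add: field_simps)
  also have "\<dots> \<le> (p + 1) / p + p * w"
    using p_gt_1 w by (intro add_left_mono mult_right_mono) auto
  finally have 1: "(p + 1) * (S b * W b) \<le> (p + 1) / p + p * w" .
  have "p * D b = (p + 1) * (b - S b * W b) - p * b * (1 - w)"
    using p_gt_1 by (simp add: D_def intP_def w(2) field_simps)
  also have "\<dots> = b + b * (p * w) - (p + 1) * (S b * W b)" by (simp add: algebra_simps)
  also have "\<dots> \<ge> b + 1 * (p * w) - ((p + 1) / p + p * w)"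
    using b w p_gt_1 1 by (intro diff_mono add_mono mult_right_mono) auto
  finally have "p * D b \<ge> b - (p + 1) / p" by simp
  moreover have "(p + 1) / p \<le> b * ((p + 1) / (2 * p))"
    using mult_right_mono[OF b, of "(p + 1) / (2 * p)"] p_gt_1 by (simp add: field_simps)
  ultimately have "p * D b \<ge> b - b * ((p + 1) / (2 * p))" by linarith
  also have "b - b * ((p + 1) / (2 * p)) = p * ((p - 1) / (2 * p\<^sup>2) * b)"
    using p_gt_1 by (simp add: field_simps power2_eq_square)
  finally have "p * ((p - 1) / (2 * p\<^sup>2) * b) \<le> p * D b" .
  then show ?thesis using p_gt_1 by (simp only: mult_le_cancel_left_pos)
qed

lemma D_pos:
  assumes "b > 0" shows "D b > 0"
proof (cases "b \<le> hp")
  case True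
  then show ?thesis using D_strict_mono[of 0 b] assms by simp
next
  case False
  then have "D b \<ge> (p - 1) / (2 * p\<^sup>2) * b" by (intro D_lower) simp
  moreover have "(p - 1) / (2 * p\<^sup>2) * b > 0" using p_gt_1 assms by simp
  ultimately show ?thesis by linarith
qed

lemma D_upper:
  assumes "b \<ge> 0" shows "D b \<le> (p + 1) * b"
proof -
  have "0 - intP 0 \<le> b - intP b"
  proof (rule deriv_nonneg_imp_mono[where g = "\<lambda>x. x - intP x" and g' = "\<lambda>x. 1 - P x"])
    show "((\<lambda>x. x - intP x) has_real_derivative 1 - P x) (at x)" for x
      by (intro DERIV_diff DERIV_ident DERIV_intP)
  qed (use P_le_1 assms in auto)
  then have "(p + 1) * intP b \<le> (p + 1) * b" using p_gt_1 by simp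
  moreover have "b * P b \<ge> 0" using assms P_nonneg by simp
  ultimately show ?thesis unfolding D_def by linarith
qed

text \<open>Up to \<open>hp\<close> the function \<open>D\<close> is increasing. For larger
  arguments \<open>b * dP b\<close> oscillates with growing amplitude, and the linear bounds on both
  sides take over.\<close>

lemma D_almost_mono:
  assumes "0 \<le> a" "a \<le> b"
  shows "D a \<le> K * D b"
proof (cases "b \<le> hp")
  case True
  have "D a \<le> D b" using D_strict_mono[of a b] assms True by (cases "a = b") auto
  moreover have "D b \<ge> 0" using D_pos[of b] assms by (cases "b = 0") auto
  then have "1 * D b \<le> K * D b" using K_ge_1 by (rule mult_right_mono[rotated])
  ultimately show ?thesis by simp
next
  case False
  have "D a \<le> (p + 1) * a" by (rule D_upper) fact
  also have "\<dots> \<le> (p + 1) * b" using assms p_gt_1 by simp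
  also have "\<dots> = K * ((p - 1) / (2 * p\<^sup>2) * b)"
    using p_gt_1 by (simp add: K_def)
  also have "\<dots> \<le> K * D b"
    using D_lower[of b] False K_ge_1 by (intro mult_left_mono) auto
  finally show ?thesis .
qed

text \<open>Antiderivative in \<open>t\<close> of
  \<open>z1 powr - p * P (z1 * t) - z2 powr - p * P (z2 * t)\<close>, the difference of the
  potential terms for \<open>z1\<close> and \<open>z2\<close> at a common value \<open>t\<close> of
  \<open>\<phi> / z\<close>.\<close>

definition gap :: "real \<Rightarrow> real \<Rightarrow> real \<Rightarrow> real"
  where "gap z1 z2 t = z1 powr - (p + 1) * intP (z1 * t) - z2 powr - (p + 1) * intP (z2 * t)"

lemma DERIV_scaled_intP:
  assumes "z > 0"
  shows "((\<lambda>z. z powr - (p + 1) * intP (z * t)) has_real_derivative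
    - (z powr - (p + 2) * D (z * t))) (at z)"
proof -
  have intP: "((\<lambda>z. intP (z * t)) has_real_derivative P (z * t) * t) (at z)"
    by (rule DERIV_chain2[OF DERIV_intP]) (auto intro!: derivative_eq_intros)
  have "- (p + 1) = 1 + - (p + 2)" by simp
  then have e: "z powr - (p + 1) = z * z powr - (p + 2)"
    unfolding powr_add using assms by (metis powr_one less_imp_le powr_add)
  have "((\<lambda>z. z powr - (p + 1)) has_real_derivative - (p + 1) * z powr - (p + 2)) (at z)"
    using has_real_derivative_powr[OF assms, of "- (p + 1)"] by (simp add: algebra_simps)
  from DERIV_mult[OF this intP] show ?thesis
    by (rule back_subst[where P = "\<lambda>d. (_ has_real_derivative d) _"])
      (simp only: e D_def, simp add: algebra_simps)
qed

text \<open>Both properties pass from \<open>D\<close> to \<open>gap\<close> by monotonicity in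
  \<open>z\<close> on \<open>[z1, z2]\<close>: the derivative of \<open>?g s - K * ?g t\<close> is
  nonnegative by \<open>D_almost_mono\<close>, that of \<open>?g t\<close> negative by
  \<open>D_pos\<close>.\<close>

lemma gap_bounds:
  assumes z: "0 < z1" "z1 < z2" and st: "0 \<le> s" "s \<le> t"
  shows "gap z1 z2 s \<le> K * gap z1 z2 t" and "t > 0 \<Longrightarrow> gap z1 z2 t > 0"
proof -
  let ?g = "\<lambda>t z. z powr - (p + 1) * intP (z * t)"
  have "?g s z1 - K * ?g t z1 \<le> ?g s z2 - K * ?g t z2"
  proof (rule deriv_nonneg_imp_mono[where g = "\<lambda>z. ?g s z - K * ?g t z"
        and g' = "\<lambda>z. - (z powr - (p + 2) * D (z * s)) - K * - (z powr - (p + 2) * D (z * t))"])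
    fix z assume "z \<in> {z1..z2}"
    then have zp: "z > 0" using z by simp
    show "((\<lambda>z. ?g s z - K * ?g t z) has_real_derivative
      - (z powr - (p + 2) * D (z * s)) - K * - (z powr - (p + 2) * D (z * t))) (at z)"
      by (intro DERIV_diff DERIV_cmult DERIV_scaled_intP zp)
    have "z powr - (p + 2) * D (z * s) \<le> z powr - (p + 2) * (K * D (z * t))"
      using st zp by (intro mult_left_mono D_almost_mono) auto
    then show "0 \<le> - (z powr - (p + 2) * D (z * s)) - K * - (z powr - (p + 2) * D (z * t))"
      by (simp add: mult_ac)
  qed (use z in auto)
  then have "K * ?g t z2 - K * ?g t z1 \<le> ?g s z2 - ?g s z1" by linarith
  then show "gap z1 z2 s \<le> K * gap z1 z2 t" by (simp add: gap_def right_diff_distrib)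
  show "gap z1 z2 t > 0" if "t > 0"
  proof -
    have "?g t z2 < ?g t z1"
    proof (rule DERIV_neg_imp_decreasing[OF z(2)])
      fix z assume "z1 \<le> z"
      then have zp: "z > 0" using z by simp
      show "\<exists>y. (?g t has_real_derivative y) (at z) \<and> y < 0"
        using DERIV_scaled_intP[OF zp, of t] D_pos[of "z * t"] zp that by (intro exI conjI) auto
    qed
    then show ?thesis by (simp add: gap_def)
  qed
qed

lemma DERIV_gap:
  assumes "0 < z1" "0 < z2"
  shows "(gap z1 z2 has_real_derivative
    z1 powr - p * P (z1 * t) - z2 powr - p * P (z2 * t)) (at t)"
proof -
  have *: "((\<lambda>t. z powr - (p + 1) * intP (z * t)) has_real_derivative z powr - p * P (z * t)) (at t)"
    if "z > 0" for z
  proof -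
    have e: "z powr - p = z powr - (p + 1) * z"
      using powr_add[of z "- (p + 1)" 1] that by simp
    have "((\<lambda>t. intP (z * t)) has_real_derivative P (z * t) * z) (at t)"
      by (rule DERIV_chain2[OF DERIV_intP]) (auto intro!: derivative_eq_intros)
    from DERIV_cmult[OF this, of "z powr - (p + 1)"] show ?thesis
      unfolding e by (rule back_subst[where P = "\<lambda>d. (_ has_real_derivative d) _"]) (simp only: mult_ac)
  qed
  show ?thesis unfolding gap_def[abs_def] by (intro DERIV_diff * assms)
qed

text \<open>Difference quotient of \<open>P\<close>, written as a mean of \<open>dP\<close> so that
  it is continuous also where \<open>a = b\<close>. It makes the equation for a difference of phases
  linear with a continuous coefficient.\<close>

definition slope :: "real \<Rightarrow> real \<Rightarrow> real"
  where "slope a b = integral (cbox 0 1) (\<lambda>s. dP (a + s * (b - a)))"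

lemma slope_eq: "P b - P a = slope a b * (b - a)"
proof -
  have "((\<lambda>s. dP (a + s * (b - a)) * (b - a)) has_integral
      P (a + 1 * (b - a)) - P (a + 0 * (b - a))) {0..1}"
  proof (rule fundamental_theorem_of_calculus)
    fix s :: real
    have "((\<lambda>s. P (a + s * (b - a))) has_real_derivative dP (a + s * (b - a)) * (b - a)) (at s within {0..1})"
      by (rule DERIV_chain2[OF DERIV_P]) (auto intro!: derivative_eq_intros)
    then show "((\<lambda>s. P (a + s * (b - a))) has_vector_derivative dP (a + s * (b - a)) * (b - a)) (at s within {0..1})"
      by (simp add: has_real_derivative_iff_has_vector_derivative)
  qed simp
  from integral_unique[OF this] show ?thesis by (simp add: slope_def)
qed

lemma abs_slope_le: "\<bar>slope a b\<bar> \<le> p"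
proof -
  have "norm (integral {0..1} (\<lambda>s. dP (a + s * (b - a)))) \<le> p * (1 - 0)"
    by (rule integral_bound) (auto intro!: continuous_intros abs_dP_le)
  then show ?thesis by (simp add: slope_def)
qed

lemma continuous_on_slope:
  assumes "continuous_on A f" "continuous_on A g"
  shows "continuous_on A (\<lambda>x. slope (f x) (g x))"
  unfolding slope_def
  by (rule integral_continuous_on_param)
    (auto simp: case_prod_unfold intro!: continuous_intros
      continuous_on_compose2[OF assms(1)] continuous_on_compose2[OF assms(2)])

text \<open>The first entry keeps the errors of the integrating factors small even after the loss of
  \<open>K\<close> in \<open>gap_bounds\<close>; the second is the constant in the required estimate
  of \<open>l0\<close>.\<close>

definition eps :: real
  where "eps = min (1 / (8 * p * K)) (p / 3)"

lemma eps_pos: "eps > 0"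
  using p_gt_1 K_ge_1 by (simp add: eps_def)

lemma eps_le: "p * eps \<le> 1 / 8" "eps \<le> 1 / 8" "p * eps * K \<le> 1 / 8"
proof -
  have "eps \<le> 1 / (8 * p * K)" by (simp add: eps_def)
  then have "p * K * eps \<le> p * K * (1 / (8 * p * K))"
    using p_gt_1 K_ge_1 by (intro mult_left_mono) auto
  also have "\<dots> = 1 / 8" using p_gt_1 K_ge_1 by simp
  finally show 1: "p * eps * K \<le> 1 / 8" by (simp add: mult_ac)
  have "p * eps * 1 \<le> p * eps * K" using K_ge_1 eps_pos p_gt_1 by (intro mult_left_mono) auto
  with 1 show 2: "p * eps \<le> 1 / 8" by simp
  have "1 * eps \<le> p * eps" using p_gt_1 eps_pos by (intro mult_right_mono) auto
  with 2 show "eps \<le> 1 / 8" by simp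
qed

definition phase :: "(real \<Rightarrow> real) \<Rightarrow> real \<Rightarrow> real \<Rightarrow> (real \<Rightarrow> real) \<Rightarrow> bool"
  where "phase Q l z \<phi> \<longleftrightarrow> \<phi> 0 = 0 \<and>
    (\<forall>x\<in>{0..l}. (\<phi> has_real_derivative z + Q x * z powr (1 - p) * P (\<phi> x)) (at x within {0..l}))"

end

section \<open>Phases for small nonincreasing potentials\<close>

text \<open>Here \<open>Q\<close> stands for \<open>-q\<close>, or for its reflection \<open>-q(l - x)\<close>.\<close>

locale small_potential = generalized_sine +
  fixes Q :: "real \<Rightarrow> real" and l :: real
  assumes l_pos: "l > 0"
    and cont_Q: "continuous_on {0..l} Q"
    and anti_Q: "antimono_on {0..l} Q"
    and Q_nonneg: "\<And>x. x \<in> {0..l} \<Longrightarrow> Q x \<ge> 0"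
    and small: "Q 0 * l powr p \<le> eps"
begin

lemma Q_le: "x \<in> {0..l} \<Longrightarrow> Q x \<le> Q 0"
  using monotone_onD[OF anti_Q, of 0 x] l_pos by auto

lemma Q0_nonneg: "Q 0 \<ge> 0"
  using Q_nonneg[of 0] l_pos by simp

lemma powr_bound:
  assumes "1 / l \<le> z"
  shows "z powr (1 - p) \<le> l powr (p - 1)" and "z powr - p \<le> l powr p" and "z > 0"
proof -
  have inv: "(1 / l) powr - a = l powr a" for a
    using l_pos by (simp add: powr_divide powr_minus)
  show "z > 0" using assms l_pos by (meson zero_less_divide_1_iff less_le_trans)
  show "z powr (1 - p) \<le> l powr (p - 1)"
    using powr_mono2'[of "- (p - 1)" "1 / l" z] inv[of "p - 1"] p_gt_1 l_pos assms by simp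
  show "z powr - p \<le> l powr p"
    using powr_mono2'[of "- p" "1 / l" z] inv[of "p"] p_gt_1 l_pos assms by simp
qed

text \<open>Among \<open>z \<ge> 1 / l\<close> the factor \<open>z powr (1 - p)\<close> is largest
  at \<open>1 / l\<close>. Integrated over the interval, the bound becomes \<open>p * eps\<close>,
  which is at most \<open>1 / 8\<close>.\<close>

lemma rate_bound:
  assumes "1 / l \<le> z" "x \<in> {0..l}" "\<bar>d\<bar> \<le> p"
  shows "\<bar>Q x * z powr (1 - p) * d\<bar> \<le> p * eps / l"
proof -
  have "\<bar>Q x * z powr (1 - p) * d\<bar> = Q x * z powr (1 - p) * \<bar>d\<bar>"
    using Q_nonneg[OF assms(2)] by (simp add: abs_mult)
  also have "\<dots> \<le> Q 0 * l powr (p - 1) * p"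
    using Q_le[OF assms(2)] Q0_nonneg powr_bound[OF assms(1)] assms(3) by (intro mult_mono) auto
  also have "\<dots> = p * (Q 0 * l powr p) / l"
    using l_pos by (simp add: powr_diff field_simps)
  also have "\<dots> \<le> p * eps / l"
    using small p_gt_1 l_pos by (intro divide_right_mono mult_left_mono) auto
  finally show ?thesis .
qed

text \<open>Let \<open>\<theta>\<^sub>i = \<phi>\<^sub>i / z\<^sub>i\<close>. With an integrating factor \<open>E\<close> the difference \<open>\<theta>\<^sub>2 - \<theta>\<^sub>1\<close> has derivative
  \<open>- E Q gap'(\<theta>\<^sub>1)\<close>. The change of variables from \<open>x\<close> to \<open>\<theta>\<^sub>1\<close> costs a factor \<open>1 / \<theta>\<^sub>1'\<close>, which is
  not monotone and not differentiable; the factor \<open>e\<close> is chosen so that \<open>m = Q / (e \<theta>\<^sub>1')\<close> is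
  nonincreasing while \<open>e\<close> stays close to 1.\<close>

lemma phase_ratio:
  assumes z: "1 / l \<le> z1" "z1 < z2"
    and ph: "phase Q l z1 \<phi>1" "phase Q l z2 \<phi>2"
  shows "\<phi>2 l / z2 \<le> \<phi>1 l / z1"
    and "Q 0 > 0 \<Longrightarrow> \<phi>2 l / z2 < \<phi>1 l / z1"
proof -
  let ?I = "{0..l}"
  have zp: "z1 > 0" "z2 > 0" "1 / l \<le> z2" using powr_bound(3)[OF z(1)] z by auto
  have zpow: "z powr (1 - p) = z powr - p * z" if "z > 0" for z
    using powr_add[of z "- p" 1] that by simp
  define \<theta>1 \<theta>2 where "\<theta>1 x = \<phi>1 x / z1" and "\<theta>2 x = \<phi>2 x / z2" for x
  have \<phi>\<theta>: "\<phi>1 x = z1 * \<theta>1 x" "\<phi>2 x = z2 * \<theta>2 x" for x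
    using zp by (simp_all add: \<theta>1_def \<theta>2_def)
  have d\<theta>1: "(\<theta>1 has_real_derivative 1 + Q x * (z1 powr - p * P (z1 * \<theta>1 x))) (at x within ?I)"
    and d\<theta>2: "(\<theta>2 has_real_derivative 1 + Q x * (z2 powr - p * P (z2 * \<theta>2 x))) (at x within ?I)"
    if "x \<in> ?I" for x
  proof -
    have d1: "(\<phi>1 has_real_derivative z1 + Q x * z1 powr (1 - p) * P (\<phi>1 x)) (at x within ?I)"
      and d2: "(\<phi>2 has_real_derivative z2 + Q x * z2 powr (1 - p) * P (\<phi>2 x)) (at x within ?I)"
      using ph that by (auto simp: phase_def)
    show "(\<theta>1 has_real_derivative 1 + Q x * (z1 powr - p * P (z1 * \<theta>1 x))) (at x within ?I)"
      using DERIV_cdivide[OF d1, of z1] zp(1) unfolding zpow[OF zp(1)] \<phi>\<theta>(1)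
      by (simp add: add_divide_distrib mult_ac)
    show "(\<theta>2 has_real_derivative 1 + Q x * (z2 powr - p * P (z2 * \<theta>2 x))) (at x within ?I)"
      using DERIV_cdivide[OF d2, of z2] zp(2) unfolding zpow[OF zp(2)] \<phi>\<theta>(2)
      by (simp add: add_divide_distrib mult_ac)
  qed
  have cont\<theta>1: "continuous_on ?I \<theta>1" and cont\<theta>2: "continuous_on ?I \<theta>2"
    by (rule DERIV_continuous_on[OF d\<theta>1], assumption) (rule DERIV_continuous_on[OF d\<theta>2])
  have \<theta>0: "\<theta>1 0 = 0" "\<theta>2 0 = 0" using ph by (auto simp: phase_def \<theta>1_def \<theta>2_def)
  define F where "F x = z1 powr - p * P (z1 * \<theta>1 x)" for x
  have F0: "F x \<ge> 0" for x using P_nonneg by (simp add: F_def)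
  have \<theta>1_mono: "y - x \<le> \<theta>1 y - \<theta>1 x" if "0 \<le> x" "x \<le> y" "y \<le> l" for x y
  proof -
    have "\<theta>1 x - x \<le> \<theta>1 y - y"
    proof (rule DERIV_nonneg_within_imp_le[where f = "\<lambda>x. \<theta>1 x - x" and f' = "\<lambda>x. Q x * F x"])
      fix t assume "t \<in> {x..y}"
      then have t: "t \<in> ?I" using that by auto
      have "((\<lambda>x. \<theta>1 x - x) has_real_derivative 1 + Q t * F t - 1) (at t within ?I)"
        unfolding F_def by (intro DERIV_diff d\<theta>1[OF t] DERIV_ident)
      then have "((\<lambda>x. \<theta>1 x - x) has_real_derivative Q t * F t) (at t within ?I)"
        by simp
      then show "((\<lambda>x. \<theta>1 x - x) has_real_derivative Q t * F t) (at t within {x..y})"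
        by (rule DERIV_subset) (use that in auto)
    qed (use that F0 Q_nonneg in auto)
    then show ?thesis by simp
  qed
  \<comment> \<open>\<open>a\<close> is the linear coefficient in the equation for
    \<open>\<theta>2 - \<theta>1\<close>; \<open>b\<close> equals
    \<open>Q * F' / (1 + Q * F)\<close>, the decay rate that \<open>antimono_weight\<close> requires
    of \<open>e\<close>.\<close>
  define a where "a x = Q x * z2 powr (1 - p) * slope (z2 * \<theta>1 x) (z2 * \<theta>2 x)" for x
  define b where "b x = Q x * z1 powr (1 - p) * dP (z1 * \<theta>1 x)" for x
  define \<mu> where "\<mu> = p * eps / l"
  have ab: "\<bar>a x\<bar> \<le> \<mu>" "\<bar>b x\<bar> \<le> \<mu>" if "x \<in> ?I" for x
    unfolding a_def b_def \<mu>_def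
    by (rule rate_bound[OF zp(3) that abs_slope_le]) (rule rate_bound[OF z(1) that abs_dP_le])
  have conta: "continuous_on ?I a" and contb: "continuous_on ?I b"
    unfolding a_def b_def by (intro continuous_intros cont_Q continuous_on_slope cont\<theta>1 cont\<theta>2)+
  obtain Ta where Ta: "Ta 0 = 0" "\<And>x. x \<in> ?I \<Longrightarrow> (Ta has_real_derivative a x) (at x within ?I)"
    using antiderivative_from_0[OF conta] by blast
  obtain Tb where Tb: "Tb 0 = 0" "\<And>x. x \<in> ?I \<Longrightarrow> (Tb has_real_derivative b x) (at x within ?I)"
    using antiderivative_from_0[OF contb] by blast
  define E e where "E x = exp (- Ta x)" and "e x = exp (- Tb x)" for x
  have dE: "(E has_real_derivative - (E x * a x)) (at x within ?I)"
    and de: "(e has_real_derivative - (e x * b x)) (at x within ?I)" if "x \<in> ?I" for x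
    unfolding E_def e_def
    by (rule derivative_eq_intros Ta(2)[OF that] Tb(2)[OF that] refl | simp)+
  have contE: "continuous_on ?I E" and conte: "continuous_on ?I e"
    by (rule DERIV_continuous_on[OF dE], assumption) (rule DERIV_continuous_on[OF de])
  define h where "h x = z1 powr - p * P (z1 * \<theta>1 x) - z2 powr - p * P (z2 * \<theta>1 x)" for x
  define G where "G x = gap z1 z2 (\<theta>1 x)" for x
  have dG: "(G has_real_derivative h x * (1 + Q x * F x)) (at x within ?I)" if "x \<in> ?I" for x
    unfolding G_def h_def F_def by (rule DERIV_chain2[OF DERIV_gap d\<theta>1]) (use zp that in auto)
  have G0: "G 0 = 0" by (simp add: G_def gap_def \<theta>0)
  have G_mono: "G x \<le> K * G y" and G_pos: "y > 0 \<Longrightarrow> G y > 0" if "0 \<le> x" "x \<le> y" "y \<le> l" for x y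
  proof -
    have "0 \<le> \<theta>1 x" "\<theta>1 x \<le> \<theta>1 y" "y \<le> \<theta>1 y"
      using \<theta>1_mono[of 0 x] \<theta>1_mono[of x y] \<theta>1_mono[of 0 y] that \<theta>0 by auto
    then show "G x \<le> K * G y" "y > 0 \<Longrightarrow> G y > 0"
      unfolding G_def using gap_bounds[OF zp(1) z(2), of "\<theta>1 x" "\<theta>1 y"] by auto
  qed
  \<comment> \<open>Now \<open>m * f = E * Q * h\<close>, while \<open>f\<close> is
    \<open>E * e\<close> times the derivative of \<open>G\<close>.\<close>
  define f where "f x = E x * e x * (h x * (1 + Q x * F x))" for x
  define m where "m x = Q x / (e x * (1 + Q x * F x))" for x
  have den: "1 + Q x * F x > 0" if "x \<in> ?I" for x
    using Q_nonneg[OF that] F0[of x] by (simp add: add_pos_nonneg)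
  have e_pos: "e x > 0" "E x > 0" for x by (simp_all add: e_def E_def)
  have contF: "continuous_on ?I F"
    unfolding F_def by (intro continuous_intros cont\<theta>1)
  have contf: "continuous_on ?I f"
    unfolding f_def h_def by (intro continuous_intros contE conte cont\<theta>1 cont_Q contF)
  have contm: "continuous_on ?I m"
    unfolding m_def
  proof (intro continuous_on_divide continuous_on_mult continuous_on_add continuous_on_const conte cont_Q contF ballI)
    fix x assume "x \<in> ?I"
    then show "e x * (1 + Q x * F x) \<noteq> 0" using den[of x] e_pos(1)[of x] by simp
  qed
  have dF: "(F has_real_derivative z1 powr (1 - p) * dP (z1 * \<theta>1 x) * (1 + Q x * F x)) (at x within ?I)"
    if "x \<in> ?I" for x
  proof -
    have "((\<lambda>x. P (z1 * \<theta>1 x)) has_real_derivative dP (z1 * \<theta>1 x) * (z1 * (1 + Q x * F x))) (at x within ?I)"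
      unfolding F_def by (rule DERIV_chain2[OF DERIV_P DERIV_cmult[OF d\<theta>1[OF that]]])
    from DERIV_cmult[OF this, of "z1 powr - p"] show ?thesis
      unfolding F_def[abs_def] zpow[OF zp(1)]
      by (rule back_subst[where P = "\<lambda>d. (_ has_real_derivative d) _"]) (simp only: mult_ac)
  qed
  have anti: "m y \<le> m x" if "0 \<le> x" "x \<le> y" "y \<le> l" for x y
    unfolding m_def
  proof (rule antimono_weight[OF cont_Q anti_Q Q_nonneg dF _ F0 _ e_pos(1) that])
    show "continuous_on ?I (\<lambda>x. z1 powr (1 - p) * dP (z1 * \<theta>1 x) * (1 + Q x * F x))"
      by (intro continuous_intros cont\<theta>1 cont_Q contF)
    fix t assume t: "t \<in> ?I"
    have "b t = Q t * (z1 powr (1 - p) * dP (z1 * \<theta>1 t) * (1 + Q t * F t)) / (1 + Q t * F t)"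
      using den[OF t] by (simp add: b_def)
    then show "(e has_real_derivative - (e t * (Q t * (z1 powr (1 - p) * dP (z1 * \<theta>1 t) *
        (1 + Q t * F t)) / (1 + Q t * F t)))) (at t within ?I)"
      using de[OF t] by simp
  qed auto
  \<comment> \<open>Integration by parts: the integral is \<open>g c * G c\<close> plus the integral
    of \<open>(a + b) * g * G\<close>, where \<open>G \<le> K * G c\<close>. The monotone function
    \<open>H\<close> below carries this out.\<close>
  have A_pos: "integral {0..c} f > 0" if c: "0 < c" "c \<le> l" for c
  proof -
    define \<kappa> where "\<kappa> = 2 * p * eps"
    have \<kappa>: "\<kappa> \<ge> 0" "\<kappa> \<le> 1 / 4" "\<kappa> * K \<le> 1 / 4" "2 * \<mu> * l = \<kappa>"
      using eps_le p_gt_1 eps_pos l_pos by (auto simp: \<kappa>_def \<mu>_def)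
    have \<mu>0: "\<mu> \<ge> 0" using p_gt_1 eps_pos l_pos by (simp add: \<mu>_def)
    define g where "g x = E x * e x" for x
    have dg: "(g has_real_derivative - ((a x + b x) * g x)) (at x within ?I)" if "x \<in> ?I" for x
      using DERIV_mult[OF dE[OF that] de[OF that]] unfolding g_def
      by (rule back_subst[where P = "\<lambda>d. (_ has_real_derivative d) _"]) (simp add: algebra_simps)
    have T: "\<bar>Ta x + Tb x\<bar> \<le> \<kappa>" if x: "x \<in> ?I" for x
    proof -
      have dT: "((\<lambda>x. Ta x + Tb x) has_real_derivative a x + b x) (at x within ?I)" if "x \<in> ?I" for x
        by (intro DERIV_add Ta Tb that)
      have "norm ((Ta x + Tb x) - (Ta 0 + Tb 0)) \<le> (2 * \<mu>) * norm (x - 0)"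
      proof (rule field_differentiable_bound[OF _ dT])
        show "norm (a x + b x) \<le> 2 * \<mu>" if "x \<in> ?I" for x
          using ab[OF that] by simp
      qed (use x l_pos in auto)
      also have "\<dots> \<le> 2 * \<mu> * l" using x \<mu>0 by (intro mult_left_mono) auto
      finally show ?thesis using \<kappa> Ta Tb by simp
    qed
    have g_exp: "g x = exp (- (Ta x + Tb x))" for x
      by (simp add: g_def E_def e_def flip: exp_add)
    have g_bounds: "exp (- \<kappa>) \<le> g x" "g x \<le> exp \<kappa>" if "x \<in> ?I" for x
      using T[OF that] by (auto simp: g_exp abs_le_iff)
    have Gc: "G c > 0" using G_pos[of c c] c by simp
    have K0: "K > 0" using K_ge_1 by simp
    have G_nonneg: "G t \<ge> 0" if "0 \<le> t" "t \<le> l" for t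
      using G_pos[of t t] that G0 by (cases "t = 0") auto
    define H where "H x = integral {0..x} f - g x * G x + 2 * \<mu> * exp \<kappa> * (K * G c) * x" for x
    have "H 0 \<le> H c"
    proof (rule DERIV_nonneg_within_imp_le[where f = H
          and f' = "\<lambda>t. (a t + b t) * g t * G t + 2 * \<mu> * exp \<kappa> * (K * G c)"])
      fix t assume "t \<in> {0..c}"
      then have t: "t \<in> ?I" using c by auto
      have "((\<lambda>x. integral {0..x} f) has_real_derivative f t) (at t within ?I)"
        by (rule integral_has_real_derivative[OF contf t])
      then have "(H has_real_derivative f t - (- ((a t + b t) * g t) * G t + h t * (1 + Q t * F t) * g t)
          + 2 * \<mu> * exp \<kappa> * (K * G c) * 1) (at t within ?I)"
        unfolding H_def by (intro DERIV_add DERIV_diff DERIV_mult DERIV_cmult DERIV_ident dg dG t)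
      then have "(H has_real_derivative (a t + b t) * g t * G t + 2 * \<mu> * exp \<kappa> * (K * G c)) (at t within ?I)"
        by (rule back_subst[where P = "\<lambda>d. (_ has_real_derivative d) _"])
          (simp add: f_def g_def algebra_simps)
      then show "(H has_real_derivative (a t + b t) * g t * G t + 2 * \<mu> * exp \<kappa> * (K * G c)) (at t within {0..c})"
        by (rule DERIV_subset) (use c in auto)
    next
      fix t assume "0 < t" "t < c"
      then have t: "t \<in> ?I" "0 \<le> t" "t \<le> c" "t \<le> l" using c by auto
      have "\<bar>(a t + b t) * g t * G t\<bar> = \<bar>a t + b t\<bar> * g t * G t"
        using G_nonneg[OF t(2,4)] by (simp add: abs_mult g_exp)
      also have "\<dots> \<le> 2 * \<mu> * exp \<kappa> * (K * G c)"
        using ab[OF t(1)] g_bounds[OF t(1)] G_mono[OF t(2,3) c(2)] G_nonneg[OF t(2,4)] \<mu>0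
        by (intro mult_mono) (auto simp: g_exp)
      finally show "0 \<le> (a t + b t) * g t * G t + 2 * \<mu> * exp \<kappa> * (K * G c)" by linarith
    qed (use c in simp)
    then have 1: "integral {0..c} f \<ge> g c * G c - 2 * \<mu> * exp \<kappa> * (K * G c) * c"
      by (simp add: H_def G0)
    have "2 * \<mu> * exp \<kappa> * (K * G c) * c \<le> 2 * \<mu> * exp \<kappa> * (K * G c) * l"
      using c Gc K0 \<mu>0 by (intro mult_left_mono) auto
    also have "\<dots> = (2 * \<mu> * l) * K * exp \<kappa> * G c" by (simp only: mult_ac)
    also have "\<dots> \<le> 1 / 4 * exp \<kappa> * G c"
      unfolding \<kappa>(4) using \<kappa> Gc by (intro mult_right_mono) auto
    finally have 2: "2 * \<mu> * exp \<kappa> * (K * G c) * c \<le> 1 / 4 * exp \<kappa> * G c" .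
    \<comment> \<open>By \<open>exp 1 \<le> 3\<close>, a quarter of \<open>exp \<kappa>\<close>, the
      size of the error, stays below \<open>exp (- \<kappa>)\<close>, the lower bound of the main
      factor \<open>g c\<close>.\<close>
    have "exp (\<kappa> + \<kappa>) \<le> exp 1" using \<kappa> by simp
    moreover have "exp \<kappa> * exp \<kappa> = exp (\<kappa> + \<kappa>)" by (rule exp_add[symmetric])
    ultimately have "exp \<kappa> * exp \<kappa> < 4" using exp_le by linarith
    then have "1 / 4 * exp \<kappa> < exp (- \<kappa>)"
      by (simp add: exp_minus field_simps)
    then have "1 / 4 * exp \<kappa> * G c < exp (- \<kappa>) * G c" using Gc by (intro mult_strict_right_mono)
    also have "\<dots> \<le> g c * G c" using g_bounds[of c] c Gc by (intro mult_right_mono) auto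
    finally show ?thesis using 1 2 by linarith
  qed
  define \<Delta> where "\<Delta> x = \<theta>2 x - \<theta>1 x" for x
  have d\<Delta>: "(\<Delta> has_real_derivative a x * \<Delta> x - Q x * h x) (at x within ?I)" if "x \<in> ?I" for x
  proof -
    have "P (z2 * \<theta>2 x) = P (z2 * \<theta>1 x) + slope (z2 * \<theta>1 x) (z2 * \<theta>2 x) * (z2 * \<Delta> x)"
      using slope_eq[of "z2 * \<theta>2 x" "z2 * \<theta>1 x"] by (simp add: \<Delta>_def algebra_simps)
    then have eq: "1 + Q x * (z2 powr - p * P (z2 * \<theta>2 x)) - (1 + Q x * (z1 powr - p * P (z1 * \<theta>1 x)))
        = a x * \<Delta> x - Q x * h x"
      unfolding a_def h_def zpow[OF zp(2)] by (simp add: algebra_simps)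
    show ?thesis
      using DERIV_diff[OF d\<theta>2[OF that] d\<theta>1[OF that]] unfolding eq \<Delta>_def .
  qed
  have "((\<lambda>x. - (m x * f x)) has_integral E l * \<Delta> l - E 0 * \<Delta> 0) ?I"
  proof (rule fundamental_theorem_of_calculus)
    fix x assume x: "x \<in> ?I"
    have "m x * f x = E x * (Q x * h x)"
      using den[OF x] e_pos(1)[of x] by (simp add: m_def f_def)
    then have "((\<lambda>x. E x * \<Delta> x) has_real_derivative - (m x * f x)) (at x within ?I)"
      using DERIV_mult[OF dE[OF x] d\<Delta>[OF x]]
      by (elim back_subst[where P = "\<lambda>d. (_ has_real_derivative d) _"]) (simp add: algebra_simps)
    then show "((\<lambda>x. E x * \<Delta> x) has_vector_derivative - (m x * f x)) (at x within ?I)"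
      by (simp add: has_real_derivative_iff_has_vector_derivative)
  qed (use l_pos in simp)
  from integral_unique[OF this] have "- integral ?I (\<lambda>x. m x * f x) = E l * \<Delta> l"
    by (simp add: \<Delta>_def \<theta>0)
  moreover have "m l \<ge> 0" "Q 0 > 0 \<Longrightarrow> m 0 > 0"
    unfolding m_def using Q_nonneg[of l] den[of l] den[of 0] e_pos(1)[of l] e_pos(1)[of 0] l_pos
    by (auto intro!: divide_nonneg_pos divide_pos_pos mult_pos_pos)
  moreover note weighted_integral_pos[OF l_pos contf contm anti _ A_pos]
  ultimately have "E l * \<Delta> l \<le> 0" "Q 0 > 0 \<Longrightarrow> E l * \<Delta> l < 0" by force+
  then have "\<Delta> l \<le> 0" "Q 0 > 0 \<Longrightarrow> \<Delta> l < 0"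
    using e_pos(2)[of l] by (auto simp: mult_le_0_iff mult_less_0_iff)
  then show "\<phi>2 l / z2 \<le> \<phi>1 l / z1" "Q 0 > 0 \<Longrightarrow> \<phi>2 l / z2 < \<phi>1 l / z1"
    by (auto simp: \<Delta>_def \<theta>1_def \<theta>2_def)
qed

text \<open>Picard iteration: the integral operator contracts with factor
  \<open>p * eps \<le> 1 / 8\<close> on the whole interval, so Banach's theorem applies once, with
  no continuation of local solutions.\<close>

lemma phase_exists:
  assumes z: "1 / l \<le> z"
  shows "\<exists>\<phi>. phase Q l z \<phi>"
proof -
  let ?I = "{0..l}"
  define f where "f \<psi> t = Q t * z powr (1 - p) * P (\<psi> t)" for \<psi> t
  \<comment> \<open>Clamping the argument to \<open>[0, l]\<close> lets the operator act on bounded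
    continuous functions of the whole line, a complete space.\<close>
  define cl where "cl x = min (max x 0) l" for x
  have cl: "cl x \<in> ?I" for x using l_pos by (auto simp: cl_def)
  have cl_id: "cl x = x" if "x \<in> ?I" for x using that by (auto simp: cl_def)
  have contf: "continuous_on ?I (f \<psi>)" if "continuous_on UNIV \<psi>" for \<psi>
    unfolding f_def by (intro continuous_intros cont_Q continuous_on_subset[OF that]) auto
  define T where "T \<psi> x = z * cl x + integral {0..cl x} (f \<psi>)" for \<psi> x
  have T_bcont: "T \<psi> \<in> bcontfun" if "continuous_on UNIV \<psi>" for \<psi>
  proof -
    have c1: "continuous_on ?I (\<lambda>y. z * y + integral {0..y} (f \<psi>))"
      by (intro continuous_intros indefinite_integral_continuous_1 integrable_continuous_real contf that)
    from compact_continuous_image[OF c1 compact_Icc]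
    have "bounded ((\<lambda>y. z * y + integral {0..y} (f \<psi>)) ` ?I)"
      by (rule compact_imp_bounded)
    then obtain B where "\<forall>w\<in>(\<lambda>y. z * y + integral {0..y} (f \<psi>)) ` ?I. norm w \<le> B"
      unfolding bounded_iff by blast
    then have B: "norm (z * y + integral {0..y} (f \<psi>)) \<le> B" if "y \<in> ?I" for y
      using that by blast
    have "continuous_on UNIV cl" unfolding cl_def by (intro continuous_intros)
    then have "continuous_on UNIV (T \<psi>)"
      unfolding T_def by (rule continuous_on_compose2[OF c1]) (use cl in auto)
    then show ?thesis by (rule bcontfun_normI) (use B[OF cl] in \<open>auto simp: T_def\<close>)
  qed
  define TT where "TT \<psi> = Bcontfun (T (apply_bcontfun \<psi>))" for \<psi> :: "real \<Rightarrow>\<^sub>C real"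
  have TT: "apply_bcontfun (TT \<psi>) x = T (apply_bcontfun \<psi>) x" for \<psi> x
    unfolding TT_def by (subst Bcontfun_inverse[OF T_bcont]) auto
  have "\<exists>!\<psi>. TT \<psi> = \<psi>"
  proof (rule banach_fix_type[of "1 / 8"])
    show "\<forall>\<psi> \<eta>. dist (TT \<psi>) (TT \<eta>) \<le> 1 / 8 * dist \<psi> \<eta>"
    proof (intro allI dist_bound)
      fix \<psi> \<eta> :: "real \<Rightarrow>\<^sub>C real" and x :: real
      let ?d = "dist \<psi> \<eta>"
      have sub: "continuous_on {0..cl x} (f (apply_bcontfun \<psi>))" "continuous_on {0..cl x} (f (apply_bcontfun \<eta>))"
        by (rule continuous_on_subset[OF contf]; use cl[of x] in auto)+
      have "norm (integral {0..cl x} (\<lambda>t. f \<psi> t - f \<eta> t)) \<le> (p * eps / l * ?d) * (cl x - 0)"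
      proof (rule integral_bound)
        show "continuous_on {0..cl x} (\<lambda>t. f \<psi> t - f \<eta> t)"
          by (intro continuous_intros sub)
        fix t assume "t \<in> {0..cl x}"
        then have t: "t \<in> ?I" using cl[of x] by auto
        have "f \<psi> t - f \<eta> t = (Q t * z powr (1 - p) * slope (\<eta> t) (\<psi> t)) * (\<psi> t - \<eta> t)"
          using slope_eq[of "\<psi> t" "\<eta> t"] by (simp add: f_def flip: right_diff_distrib)
        moreover have "\<bar>\<psi> t - \<eta> t\<bar> \<le> ?d"
          using dist_bounded[of \<psi> t \<eta>] by (simp add: dist_real_def)
        ultimately show "norm (f \<psi> t - f \<eta> t) \<le> p * eps / l * ?d"
          using mult_mono[OF rate_bound[OF z t abs_slope_le]] p_gt_1 eps_pos l_pos
          by (simp only: real_norm_def abs_mult[of _ "\<psi> t - \<eta> t"]) auto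
      qed (use cl[of x] in auto)
      also have "\<dots> \<le> (p * eps / l * ?d) * l"
        using cl[of x] p_gt_1 eps_pos l_pos by (intro mult_left_mono) auto
      also have "\<dots> = p * eps * ?d" using l_pos by simp
      also have "\<dots> \<le> 1 / 8 * ?d" using eps_le(1) by (intro mult_right_mono) auto
      finally have "norm (integral {0..cl x} (\<lambda>t. f \<psi> t - f \<eta> t)) \<le> 1 / 8 * ?d" .
      moreover have "integral {0..cl x} (\<lambda>t. f \<psi> t - f \<eta> t) = T \<psi> x - T \<eta> x"
        unfolding T_def
        by (subst Henstock_Kurzweil_Integration.integral_diff) (auto intro!: integrable_continuous_real sub)
      ultimately show "dist (TT \<psi> x) (TT \<eta> x) \<le> 1 / 8 * ?d"
        unfolding TT dist_real_def by simp
    qed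
  qed auto
  then obtain \<psi> where "TT \<psi> = \<psi>" by blast
  then have fix_eq: "\<psi> x = T \<psi> x" for x using TT[of \<psi> x] by simp
  have "phase Q l z (apply_bcontfun \<psi>)"
    unfolding phase_def
  proof (intro conjI ballI)
    have "cl 0 = 0" using l_pos by (intro cl_id) auto
    then show "\<psi> 0 = 0" using fix_eq[of 0] by (simp add: T_def)
    fix x assume x: "x \<in> ?I"
    have "((\<lambda>x. z * x + integral {0..x} (f \<psi>)) has_real_derivative z * 1 + f \<psi> x) (at x within ?I)"
      by (intro DERIV_add DERIV_cmult DERIV_ident integral_has_real_derivative contf x) auto
    moreover have "z * y + integral {0..y} (f \<psi>) = \<psi> y" if "y \<in> ?I" for y
      using fix_eq[of y] by (simp add: T_def cl_id[OF that])
    ultimately show "(\<psi> has_real_derivative z + Q x * z powr (1 - p) * P (\<psi> x)) (at x within ?I)"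
      using has_field_derivative_transform_within[where d = 1 and S = ?I and g = "apply_bcontfun \<psi>"] x
      by (simp add: f_def)
  qed
  then show ?thesis by blast
qed

section \<open>Dependence of the phase on \<open>z\<close>\<close>

lemma phase_continuous_on: "phase Q l z \<phi> \<Longrightarrow> continuous_on {0..l} \<phi>"
  by (rule DERIV_continuous_on) (auto simp: phase_def)

text \<open>Adding and subtracting the \<open>z1\<close> rate at \<open>\<phi>2\<close> leaves a
  linear term and a forcing term in which \<open>z1\<close> and \<open>z2\<close> meet the same
  value \<open>P (\<phi>2 x)\<close>.\<close>

lemma phase_difference:
  assumes "phase Q l z1 \<phi>1" "phase Q l z2 \<phi>2" "x \<in> {0..l}"
  shows "((\<lambda>x. \<phi>2 x - \<phi>1 x) has_real_derivative
    Q x * z1 powr (1 - p) * slope (\<phi>1 x) (\<phi>2 x) * (\<phi>2 x - \<phi>1 x) +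
    ((z2 + Q x * P (\<phi>2 x) * z2 powr (1 - p)) - (z1 + Q x * P (\<phi>2 x) * z1 powr (1 - p)))) (at x within {0..l})"
proof -
  have "((\<lambda>x. \<phi>2 x - \<phi>1 x) has_real_derivative (z2 + Q x * z2 powr (1 - p) * P (\<phi>2 x))
      - (z1 + Q x * z1 powr (1 - p) * P (\<phi>1 x))) (at x within {0..l})"
    using assms by (intro DERIV_diff) (auto simp: phase_def)
  moreover have "Q x * z1 powr (1 - p) * slope (\<phi>1 x) (\<phi>2 x) * (\<phi>2 x - \<phi>1 x)
      = Q x * z1 powr (1 - p) * (P (\<phi>2 x) - P (\<phi>1 x))"
    by (simp only: slope_eq mult.assoc)
  ultimately show ?thesis
    by (elim back_subst[where P = "\<lambda>d. (_ has_real_derivative d) _"]) (simp add: algebra_simps)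
qed

text \<open>With \<open>\<kappa> = Q x * P y\<close> this is the growth of the angular speed in
  \<open>z\<close>. The second summand decreases, but by
  \<open>\<kappa> * z powr - p \<le> eps\<close> more slowly than the first one grows.\<close>

lemma speed_strict_mono:
  assumes "0 \<le> \<kappa>" "\<kappa> \<le> Q 0" "1 / l \<le> z1" "z1 < z2"
  shows "z1 + \<kappa> * z1 powr (1 - p) < z2 + \<kappa> * z2 powr (1 - p)"
proof (rule DERIV_pos_imp_increasing[OF assms(4)])
  fix z assume "z1 \<le> z"
  then have z: "1 / l \<le> z" using assms by simp
  have "\<kappa> * (p - 1) * z powr - p \<le> Q 0 * p * l powr p"
    using assms Q0_nonneg p_gt_1 powr_bound(2)[OF z] by (intro mult_mono) auto
  also have "\<dots> \<le> p * eps" using small p_gt_1 by (simp add: mult_ac)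
  also have "\<dots> < 1" using eps_le(1) by simp
  finally have "1 + \<kappa> * ((1 - p) * z powr - p) > 0" by (simp add: algebra_simps)
  moreover have "((\<lambda>z. z + \<kappa> * z powr (1 - p)) has_real_derivative 1 + \<kappa> * ((1 - p) * z powr - p)) (at z)"
    using powr_bound(3)[OF z] by (auto intro!: derivative_eq_intros)
  ultimately show "\<exists>y. ((\<lambda>z. z + \<kappa> * z powr (1 - p)) has_real_derivative y) (at z) \<and> y > 0" by blast
qed

lemma QP_bounds: "x \<in> {0..l} \<Longrightarrow> 0 \<le> Q x * P y \<and> Q x * P y \<le> Q 0"
  using Q_nonneg[of x] Q_le[of x] P_nonneg[of y] P_le_1[of y] mult_mono[of "Q x" "Q 0" "P y" 1] Q0_nonneg
  by auto

text \<open>\<open>linear_ode_nonneg\<close> applied to the difference of the phases. The case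
  \<open>z1 = z2\<close> of the first claim gives uniqueness of the end value.\<close>

lemma phase_mono:
  assumes z: "1 / l \<le> z1" and ph: "phase Q l z1 \<phi>1" "phase Q l z2 \<phi>2"
  shows "z1 \<le> z2 \<Longrightarrow> \<phi>1 l \<le> \<phi>2 l" and "z1 < z2 \<Longrightarrow> \<phi>1 l < \<phi>2 l"
proof -
  have u0: "\<phi>2 0 - \<phi>1 0 = 0" using ph by (simp add: phase_def)
  have cont: "continuous_on {0..l} (\<lambda>x. Q x * z1 powr (1 - p) * slope (\<phi>1 x) (\<phi>2 x))"
    by (intro continuous_intros cont_Q continuous_on_slope phase_continuous_on[OF ph(1)] phase_continuous_on[OF ph(2)])
  note ode = linear_ode_nonneg[of "\<lambda>x. \<phi>2 x - \<phi>1 x", OF u0 phase_difference[OF ph] cont, of l]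
  have r: "(z1 + Q t * P (\<phi>2 t) * z1 powr (1 - p)) < (z2 + Q t * P (\<phi>2 t) * z2 powr (1 - p))"
    if "0 < t" "t < l" "z1 < z2" for t
    using QP_bounds[of t "\<phi>2 t"] that z by (intro speed_strict_mono) auto
  show "\<phi>1 l < \<phi>2 l" if "z1 < z2"
    using ode(2) r l_pos that by simp
  show "\<phi>1 l \<le> \<phi>2 l" if "z1 \<le> z2"
    using ode(1) r[THEN less_imp_le] l_pos that by (cases "z1 = z2") auto
qed

text \<open>At a maximum of \<open>\<bar>\<phi>2 - \<phi>1\<bar>\<close> the mean value inequality
  bounds this maximum by an eighth of itself plus \<open>\<rho> * l\<close>, so the linear term is
  absorbed. The result is continuity of the end value in \<open>z\<close>.\<close>

lemma phase_dependence:
  assumes z: "1 / l \<le> z1" "1 / l \<le> z2" and ph: "phase Q l z1 \<phi>1" "phase Q l z2 \<phi>2"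
  shows "\<bar>\<phi>2 l - \<phi>1 l\<bar> \<le> 2 * l * (\<bar>z2 - z1\<bar> + Q 0 * \<bar>z2 powr (1 - p) - z1 powr (1 - p)\<bar>)"
proof -
  let ?I = "{0..l}"
  define \<rho> where "\<rho> = \<bar>z2 - z1\<bar> + Q 0 * \<bar>z2 powr (1 - p) - z1 powr (1 - p)\<bar>"
  define u where "u x = \<phi>2 x - \<phi>1 x" for x
  have contu: "continuous_on ?I u"
    unfolding u_def by (intro continuous_intros phase_continuous_on[OF ph(1)] phase_continuous_on[OF ph(2)])
  have "\<exists>x\<in>?I. \<forall>y\<in>?I. \<bar>u y\<bar> \<le> \<bar>u x\<bar>"
    by (intro continuous_attains_sup continuous_intros contu) (use l_pos in auto)
  then obtain x where x: "x \<in> ?I" "\<And>y. y \<in> ?I \<Longrightarrow> \<bar>u y\<bar> \<le> \<bar>u x\<bar>" by blast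
  have \<rho>0: "\<rho> \<ge> 0" using Q0_nonneg by (simp add: \<rho>_def)
  have "norm (u x - u 0) \<le> (p * eps / l * \<bar>u x\<bar> + \<rho>) * norm (x - 0)"
  proof (rule field_differentiable_bound[OF _ phase_difference[OF ph, folded u_def]])
    fix t assume t: "t \<in> ?I"
    have 1: "\<bar>Q t * z1 powr (1 - p) * slope (\<phi>1 t) (\<phi>2 t) * u t\<bar> \<le> p * eps / l * \<bar>u x\<bar>"
      unfolding abs_mult[of _ "u t"] using rate_bound[OF z(1) t abs_slope_le] x(2)[OF t]
      by (intro mult_mono) (auto intro: order_trans[OF abs_ge_zero])
    have "\<bar>Q t * P (\<phi>2 t) * (z2 powr (1 - p) - z1 powr (1 - p))\<bar> \<le> Q 0 * \<bar>z2 powr (1 - p) - z1 powr (1 - p)\<bar>"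
      unfolding abs_mult[of "Q t * P (\<phi>2 t)"] using QP_bounds[OF t, of "\<phi>2 t"] by (intro mult_right_mono) auto
    then have 2: "\<bar>(z2 + Q t * P (\<phi>2 t) * z2 powr (1 - p)) - (z1 + Q t * P (\<phi>2 t) * z1 powr (1 - p))\<bar> \<le> \<rho>"
      unfolding \<rho>_def right_diff_distrib by linarith
    show "norm (Q t * z1 powr (1 - p) * slope (\<phi>1 t) (\<phi>2 t) * u t +
        ((z2 + Q t * P (\<phi>2 t) * z2 powr (1 - p)) - (z1 + Q t * P (\<phi>2 t) * z1 powr (1 - p))))
        \<le> p * eps / l * \<bar>u x\<bar> + \<rho>"
      unfolding real_norm_def using 1 2 by linarith
  qed (use x l_pos in auto)
  also have "\<dots> \<le> (p * eps / l * \<bar>u x\<bar> + \<rho>) * l"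
    using x \<rho>0 p_gt_1 eps_pos l_pos by (intro mult_left_mono) auto
  also have "\<dots> = p * eps * \<bar>u x\<bar> + \<rho> * l" using l_pos by (simp add: field_simps)
  also have "\<dots> \<le> 1 / 8 * \<bar>u x\<bar> + \<rho> * l" using eps_le(1) by (intro add_right_mono mult_right_mono) auto
  finally have "\<bar>u x\<bar> \<le> 1 / 8 * \<bar>u x\<bar> + \<rho> * l"
    using ph by (simp add: u_def phase_def)
  moreover have "\<bar>u l\<bar> \<le> \<bar>u x\<bar>" using x(2)[of l] l_pos by simp
  moreover have "\<rho> * l \<ge> 0" using \<rho>0 l_pos by simp
  ultimately have "\<bar>u l\<bar> \<le> 2 * (\<rho> * l)" by linarith
  then show ?thesis by (simp add: u_def \<rho>_def mult_ac)
qed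

lemma phase_lower:
  assumes "phase Q l z \<phi>" shows "z * l \<le> \<phi> l"
proof -
  have "\<phi> 0 - z * 0 \<le> \<phi> l - z * l"
  proof (rule DERIV_nonneg_within_imp_le[where f = "\<lambda>x. \<phi> x - z * x"
        and f' = "\<lambda>x. (z + Q x * z powr (1 - p) * P (\<phi> x)) - z * 1"])
    show "((\<lambda>x. \<phi> x - z * x) has_real_derivative (z + Q x * z powr (1 - p) * P (\<phi> x)) - z * 1) (at x within {0..l})"
      if "x \<in> {0..l}" for x
      using assms that by (intro DERIV_diff DERIV_cmult DERIV_ident) (auto simp: phase_def)
  qed (use l_pos Q_nonneg P_nonneg in auto)
  then show ?thesis using assms by (simp add: phase_def)
qed

text \<open>Together with \<open>hp_ge_2\<close> this places the end value at the smallest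
  admissible \<open>z\<close> below \<open>hp\<close>.\<close>

lemma phase_upper:
  assumes "phase Q l (1 / l) \<phi>" shows "\<phi> l < 2"
proof -
  let ?c = "Q 0 * (1 / l) powr (1 - p)"
  have "(1 / l + ?c) * 0 - \<phi> 0 \<le> (1 / l + ?c) * l - \<phi> l"
  proof (rule DERIV_nonneg_within_imp_le[where f = "\<lambda>x. (1 / l + ?c) * x - \<phi> x"
        and f' = "\<lambda>x. (1 / l + ?c) * 1 - (1 / l + Q x * (1 / l) powr (1 - p) * P (\<phi> x))"])
    show "((\<lambda>x. (1 / l + ?c) * x - \<phi> x) has_real_derivative
        (1 / l + ?c) * 1 - (1 / l + Q x * (1 / l) powr (1 - p) * P (\<phi> x))) (at x within {0..l})"
      if "x \<in> {0..l}" for x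
      using assms that by (intro DERIV_diff DERIV_cmult DERIV_ident) (auto simp: phase_def)
    show "0 \<le> (1 / l + ?c) * 1 - (1 / l + Q x * (1 / l) powr (1 - p) * P (\<phi> x))"
      if "0 < x" "x < l" for x
      using mult_right_mono[of "Q x * P (\<phi> x)" "Q 0" "(1 / l) powr (1 - p)"] QP_bounds[of x "\<phi> x"] that
      by (simp add: mult_ac)
  qed (use l_pos in auto)
  then have "\<phi> l \<le> 1 + ?c * l" using assms l_pos by (simp add: phase_def algebra_simps)
  also have "?c * l \<le> Q 0 * l powr (p - 1) * l"
    using powr_bound(1)[of "1 / l"] Q0_nonneg l_pos by (intro mult_right_mono mult_left_mono) auto
  also have "\<dots> = Q 0 * l powr p" using l_pos by (simp add: powr_diff)
  also have "\<dots> \<le> 1 / 8" using small eps_le(2) by simp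
  finally show ?thesis by simp
qed

text \<open>Intermediate value theorem in \<open>z\<close>: at \<open>1 / l\<close> the end value is
  below \<open>2 \<le> real k * hp\<close>, and at \<open>real k * hp / l\<close> it is at least
  \<open>z * l = real k * hp\<close>.\<close>

lemma phase_root_exists:
  assumes k: "k \<ge> (1::nat)"
  shows "\<exists>z \<phi>. 1 / l \<le> z \<and> phase Q l z \<phi> \<and> \<phi> l = real k * hp"
proof -
  define X where "X = {1 / l .. real k * hp / l}"
  have khp: "real k * hp \<ge> 2"
    using mult_mono[of 1 "real k" 2 hp] k hp_ge_2 by simp
  have "\<forall>z\<in>X. \<exists>\<phi>. phase Q l z \<phi>" using phase_exists by (auto simp: X_def)
  then obtain \<Phi> where \<Phi>: "\<And>z. z \<in> X \<Longrightarrow> phase Q l z (\<Phi> z)" by metis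
  have cont: "continuous_on X (\<lambda>z. \<Phi> z l)"
    unfolding continuous_on_def
  proof
    fix z assume z: "z \<in> X"
    then have zp: "z > 0" using powr_bound(3) by (auto simp: X_def)
    let ?g = "\<lambda>w. 2 * l * (\<bar>w - z\<bar> + Q 0 * \<bar>w powr (1 - p) - z powr (1 - p)\<bar>)"
    have "(?g \<longlongrightarrow> ?g z) (at z within X)"
      using zp by (intro tendsto_intros) auto
    then have "(?g \<longlongrightarrow> 0) (at z within X)" by simp
    moreover have "\<forall>\<^sub>F w in at z within X. norm (\<Phi> w l - \<Phi> z l) \<le> ?g w"
      unfolding eventually_at_filter real_norm_def
      by (intro always_eventually allI impI phase_dependence \<Phi> z) (use z in \<open>auto simp: X_def\<close>)
    ultimately have "((\<lambda>w. \<Phi> w l - \<Phi> z l) \<longlongrightarrow> 0) (at z within X)"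
      by (rule Lim_null_comparison[rotated])
    then show "((\<lambda>w. \<Phi> w l) \<longlongrightarrow> \<Phi> z l) (at z within X)" by (simp add: LIM_zero_iff)
  qed
  have le: "1 / l \<le> real k * hp / l"
    using khp l_pos by (simp add: divide_right_mono)
  have "\<exists>z. 1 / l \<le> z \<and> z \<le> real k * hp / l \<and> \<Phi> z l = real k * hp"
  proof (rule IVT')
    show "\<Phi> (1 / l) l \<le> real k * hp"
      using phase_upper[OF \<Phi>] le khp by (simp add: X_def)
    show "real k * hp \<le> \<Phi> (real k * hp / l) l"
      using phase_lower[OF \<Phi>, of "real k * hp / l"] le l_pos by (simp add: X_def)
  qed (use le cont in \<open>auto simp: X_def\<close>)
  then show ?thesis using \<Phi> unfolding X_def by (metis atLeastAtMost_iff)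
qed

end

section \<open>Eigenvalues\<close>

text \<open>Identifies the given enumeration of the eigenvalues with the one by phases. Each
  \<open>w k\<close> is some \<open>u i\<close>, and \<open>i < k\<close> is impossible because then
  \<open>u i = w i < w k\<close>; exchanging the two sequences gives equality.\<close>

lemma strictly_increasing_enumeration_unique:
  fixes s t :: "nat \<Rightarrow> real"
  assumes s: "strict_mono_on {1..} s" and t: "strict_mono_on {1..} t"
    and im: "s ` {1..} = t ` {1..}" and k: "1 \<le> k"
  shows "s k = t k"
  using k
proof (induction k rule: less_induct)
  case (less k)
  have "u k \<le> w k"
    if u: "strict_mono_on {1..} u" and w: "strict_mono_on {1..} w" and sub: "w ` {1..} \<subseteq> u ` {1..}"
      and IH: "\<And>j. j < k \<Longrightarrow> 1 \<le> j \<Longrightarrow> u j = w j" for u w :: "nat \<Rightarrow> real"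
  proof -
    obtain i where i: "1 \<le> i" "w k = u i" using sub less.prems by force
    have "k \<le> i"
    proof (rule ccontr)
      assume "\<not> k \<le> i"
      then have "u i = w i" "w i < w k" using IH[of i] i less.prems strict_mono_onD[OF w, of i k] by auto
      then show False using i by simp
    qed
    then show ?thesis
      using i less.prems strict_mono_onD[OF u, of k i] by (cases "k = i") auto
  qed
  from this[OF s t] this[OF t s] im less show ?case by (intro antisym) auto
qed

section \<open>Correspondence between eigenvalues and phases\<close>

context small_potential
begin

text \<open>The scale \<open>z\<close> is independent of \<open>lam\<close>, whose sign is still
  unknown here: \<open>z = 1 / l\<close> serves to exclude small \<open>lam\<close>, and then
  \<open>z = lam powr (1 / p)\<close> yields the phase.\<close>

lemma eigenfunction_angle:
  assumes lam: "lam \<in> dirichlet_eigenvalues p (\<lambda>x. - Q x) l" and z: "z > 0"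
  obtains \<phi> where "\<phi> 0 = 0"
    and "\<And>x. x \<in> {0..l} \<Longrightarrow> (\<phi> has_real_derivative
      z * (1 + ((lam + Q x) / z powr p - 1) * P (\<phi> x))) (at x within {0..l})"
    and "S (\<phi> l) = 0"
proof -
  let ?I = "{0..l}"
  define c where "c x = (lam + Q x) / z powr p" for x
  have contc: "continuous_on ?I c"
    unfolding c_def using z by (intro continuous_intros cont_Q) auto
  obtain y y' x0 where
    y: "\<And>x. x \<in> ?I \<Longrightarrow> (y has_real_derivative y' x) (at x within ?I)"
    and y': "\<And>x. x \<in> ?I \<Longrightarrow> ((\<lambda>t. spow (p - 1) (y' t)) has_real_derivative
        - ((p - 1) * (lam + Q x) * spow (p - 1) (y x))) (at x within ?I)"
    and bc: "y 0 = 0" "y l = 0" and x0: "x0 \<in> ?I" "y x0 \<noteq> 0"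
  proof -
    obtain y y' x0 where y: "\<forall>x\<in>?I. (y has_real_derivative y' x) (at x within ?I) \<and>
        ((\<lambda>t. spow (p - 1) (y' t)) has_real_derivative
          - ((p - 1) * (lam - - Q x) * spow (p - 1) (y x))) (at x within ?I)"
      "y 0 = 0" "y l = 0" "x0 \<in> ?I" "y x0 \<noteq> 0"
      using lam unfolding dirichlet_eigenvalues_def dirichlet_solution_def by blast
    show ?thesis by (rule that[of y y' x0]) (use y in simp_all)
  qed
  define v where "v x = (1 / z) powr (p - 1) * spow (p - 1) (y' x)" for x
  have v_eq: "v x = spow (p - 1) (1 / z * y' x)" for x
    unfolding v_def using z by (subst spow_mult_pos) auto
  have e: "(p - 1) * (1 / (p - 1)) = 1" "1 / (p - 1) * (p - 1) = 1" using p_gt_1 by auto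
  have dy: "(y has_real_derivative z * spow (1 / (p - 1)) (v x)) (at x within ?I)" if "x \<in> ?I" for x
    using y[OF that] z unfolding v_eq spow_spow e by simp
  have zp: "z * (1 / z powr p) = (1 / z) powr (p - 1)"
    using z by (simp add: powr_divide powr_diff)
  have dv: "(v has_real_derivative - ((p - 1) * z * c x * spow (p - 1) (y x))) (at x within ?I)"
    if "x \<in> ?I" for x
  proof -
    have "- ((p - 1) * z * c x * spow (p - 1) (y x)) =
        (z * (1 / z powr p)) * - ((p - 1) * (lam + Q x) * spow (p - 1) (y x))"
      by (simp add: c_def)
    then show ?thesis
      unfolding v_def zp by (simp only:) (intro DERIV_cmult y' that)
  qed
  \<comment> \<open>Otherwise the initial energy is zero, and the upper energy bound contradicts
    \<open>y x0 \<noteq> 0\<close>.\<close>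
  have "v 0 \<noteq> 0"
  proof
    assume "v 0 = 0"
    have "\<exists>L. \<forall>x\<in>?I. \<bar>y 0\<bar> powr p + \<bar>v 0\<bar> powr (p / (p - 1))
          \<le> exp (L * x) * (\<bar>y x\<bar> powr p + \<bar>v x\<bar> powr (p / (p - 1))) \<and>
        \<bar>y x\<bar> powr p + \<bar>v x\<bar> powr (p / (p - 1))
          \<le> exp (L * x) * (\<bar>y 0\<bar> powr p + \<bar>v 0\<bar> powr (p / (p - 1)))"
      by (rule energy_bounds(2)[OF contc dy dv]) auto
    then obtain L where "\<bar>y x0\<bar> powr p + \<bar>v x0\<bar> powr (p / (p - 1))
        \<le> exp (L * x0) * (\<bar>y 0\<bar> powr p + \<bar>v 0\<bar> powr (p / (p - 1)))"
      using x0(1) by blast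
    then have "\<bar>y x0\<bar> powr p + \<bar>v x0\<bar> powr (p / (p - 1)) \<le> 0" using bc \<open>v 0 = 0\<close> by simp
    moreover have "\<bar>y x0\<bar> powr p > 0" using x0(2) by simp
    ultimately show False by (smt (verit) powr_ge_zero)
  qed
  \<comment> \<open>The eigenfunction may start downwards; the sign makes the initial slope
    positive, and the equation is odd.\<close>
  define \<sigma> :: real where "\<sigma> = sgn (v 0)"
  have \<sigma>: "\<sigma> = 1 \<or> \<sigma> = - 1" "\<sigma> * v 0 > 0"
    using \<open>v 0 \<noteq> 0\<close> by (auto simp: \<sigma>_def sgn_if)
  have \<sigma>_spow: "spow r (\<sigma> * x) = \<sigma> * spow r x" for r x using \<sigma>(1) by auto
  have du: "((\<lambda>x. \<sigma> * y x) has_real_derivative z * spow (1 / (p - 1)) (\<sigma> * v x)) (at x within ?I)"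
    if "x \<in> ?I" for x
    using DERIV_cmult[OF dy[OF that], of \<sigma>] unfolding \<sigma>_spow by (simp add: mult_ac)
  have dw: "((\<lambda>x. \<sigma> * v x) has_real_derivative - ((p - 1) * z * c x * spow (p - 1) (\<sigma> * y x))) (at x within ?I)"
    if "x \<in> ?I" for x
    using DERIV_cmult[OF dv[OF that], of \<sigma>] unfolding \<sigma>_spow by (simp add: mult_ac)
  obtain \<phi> where \<phi>: "\<phi> 0 = 0"
    "\<And>x. x \<in> ?I \<Longrightarrow> (\<phi> has_real_derivative z * (1 + (c x - 1) * P (\<phi> x))) (at x within ?I)"
    "\<And>x. x \<in> ?I \<Longrightarrow> \<sigma> * y x = 0 \<longleftrightarrow> S (\<phi> x) = 0"
    by (rule pruefer_angle_exists[OF z l_pos contc du dw]) (use bc \<sigma> in auto)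
  moreover have "S (\<phi> l) = 0" using \<phi>(3)[of l] bc l_pos by simp
  ultimately show ?thesis using that[of \<phi>] by (simp add: c_def)
qed

text \<open>For smaller \<open>lam\<close> the angle at scale \<open>1 / l\<close> ends strictly
  between \<open>0\<close> and \<open>hp\<close>, in fact at most at \<open>1 + eps\<close>, so
  \<open>S\<close> cannot vanish there. This also excludes \<open>lam \<le> 0\<close>.\<close>

lemma eigenvalue_lower:
  assumes lam: "lam \<in> dirichlet_eigenvalues p (\<lambda>x. - Q x) l"
  shows "lam > (1 / l) powr p"
proof (rule ccontr)
  assume "\<not> lam > (1 / l) powr p"
  then have le: "lam \<le> (1 / l) powr p" by simp
  let ?I = "{0..l}" and ?z = "1 / l"
  have z: "?z > 0" using l_pos by simp
  define c where "c x = (lam + Q x) / ?z powr p" for x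
  obtain \<phi> where \<phi>: "\<phi> 0 = 0"
    "\<And>x. x \<in> ?I \<Longrightarrow> (\<phi> has_real_derivative ?z * (1 + (c x - 1) * P (\<phi> x))) (at x within ?I)"
    "S (\<phi> l) = 0"
    using eigenfunction_angle[OF lam z] unfolding c_def by blast
  have c_le: "c x - 1 \<le> eps" if "x \<in> ?I" for x
  proof -
    have "Q x * l powr p \<le> Q 0 * l powr p" using Q_le[OF that] by (rule mult_right_mono) simp
    then have "Q x * l powr p \<le> eps" using small by (rule order_trans)
    then have 1: "Q x / ?z powr p \<le> eps" using l_pos by (simp add: powr_divide)
    have "lam / ?z powr p \<le> 1" using le z by (simp add: divide_le_eq_1)
    with 1 show ?thesis by (simp add: c_def add_divide_distrib)
  qed
  have cont\<phi>: "continuous_on ?I \<phi>" using \<phi>(2) by (rule DERIV_continuous_on)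
  \<comment> \<open>By \<open>P 0 = 0\<close> the term with \<open>P\<close> is linear in
    \<open>\<phi>\<close>, and the remaining forcing \<open>1 / l\<close> is positive whatever the
    sign of \<open>lam\<close>.\<close>
  have "\<phi> l > 0"
  proof (rule linear_ode_nonneg(2)[where u = \<phi> and r = "\<lambda>_. ?z" and a = "\<lambda>x. ?z * (c x - 1) * slope 0 (\<phi> x)" and l = l, OF \<phi>(1)])
    have "P 0 = 0" by (simp add: P_def S_0)
    then have "P (\<phi> x) = slope 0 (\<phi> x) * \<phi> x" for x using slope_eq[of "\<phi> x" 0] by simp
    then show "(\<phi> has_real_derivative ?z * (c x - 1) * slope 0 (\<phi> x) * \<phi> x + ?z) (at x within ?I)"
      if "x \<in> ?I" for x
      using \<phi>(2)[OF that] by (simp add: algebra_simps)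
    show "continuous_on ?I (\<lambda>x. ?z * (c x - 1) * slope 0 (\<phi> x))"
      unfolding c_def using z by (intro continuous_intros cont_Q continuous_on_slope cont\<phi>) auto
  qed (use l_pos in auto)
  moreover have "\<phi> l < hp"
  proof -
    have "(?z * (1 + eps)) * 0 - \<phi> 0 \<le> (?z * (1 + eps)) * l - \<phi> l"
    proof (rule DERIV_nonneg_within_imp_le[where f = "\<lambda>x. (?z * (1 + eps)) * x - \<phi> x"
          and f' = "\<lambda>x. (?z * (1 + eps)) * 1 - ?z * (1 + (c x - 1) * P (\<phi> x))"])
      show "((\<lambda>x. (?z * (1 + eps)) * x - \<phi> x) has_real_derivative
          (?z * (1 + eps)) * 1 - ?z * (1 + (c x - 1) * P (\<phi> x))) (at x within ?I)" if "x \<in> ?I" for x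
        by (intro DERIV_diff DERIV_cmult DERIV_ident \<phi>(2) that)
      show "0 \<le> (?z * (1 + eps)) * 1 - ?z * (1 + (c x - 1) * P (\<phi> x))" if "0 < x" "x < l" for x
      proof -
        have "(c x - 1) * P (\<phi> x) \<le> eps * P (\<phi> x)"
          using c_le[of x] that P_nonneg by (intro mult_right_mono) auto
        also have "\<dots> \<le> eps * 1" using P_le_1 eps_pos by (intro mult_left_mono) auto
        finally have "?z * (1 + (c x - 1) * P (\<phi> x)) \<le> ?z * (1 + eps)" using z by (intro mult_left_mono) auto
        then show ?thesis by simp
      qed
    qed (use l_pos in auto)
    then have "\<phi> l \<le> 1 + eps" using \<phi>(1) l_pos by simp
    then show ?thesis using eps_le(2) hp_ge_2 by simp
  qed
  ultimately have "S (\<phi> l) > 0" by (rule S_pos)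
  then show False using \<phi>(3) by simp
qed

lemma eigenvalue_phase:
  assumes lam: "lam \<in> dirichlet_eigenvalues p (\<lambda>x. - Q x) l"
  shows "\<exists>k z \<phi>. 1 \<le> k \<and> 1 / l \<le> z \<and> lam = z powr p \<and> phase Q l z \<phi> \<and> \<phi> l = real k * hp"
proof -
  define z where "z = lam powr (1 / p)"
  have lam_pos: "lam > 0" using eigenvalue_lower[OF lam] by (smt (verit) powr_ge_zero)
  have zlam: "lam = z powr p" using p_gt_1 lam_pos by (simp add: z_def powr_powr)
  have "((1 / l) powr p) powr (1 / p) \<le> z"
    unfolding z_def using eigenvalue_lower[OF lam] p_gt_1 by (intro powr_mono2) auto
  then have z: "1 / l \<le> z" using p_gt_1 l_pos by (simp add: powr_powr)
  have zp: "z > 0" using powr_bound(3)[OF z] .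
  obtain \<phi> where \<phi>: "\<phi> 0 = 0"
    "\<And>x. x \<in> {0..l} \<Longrightarrow> (\<phi> has_real_derivative
      z * (1 + ((lam + Q x) / z powr p - 1) * P (\<phi> x))) (at x within {0..l})"
    "S (\<phi> l) = 0"
    using eigenfunction_angle[OF lam zp] by blast
  have "z * (1 + ((lam + Q x) / z powr p - 1) * y) = z + Q x * z powr (1 - p) * y" for x y
    using zp by (simp add: zlam powr_diff field_simps)
  then have ph: "phase Q l z \<phi>" using \<phi> by (simp add: phase_def)
  obtain k :: int where k: "\<phi> l = of_int k * hp" using \<phi>(3) S_eq_0_iff by blast
  have "0 < z * l" using zp l_pos by simp
  then have "of_int k * hp > 0" using phase_lower[OF ph] k by linarith
  then have "k > 0" using hp_pos by (simp add: zero_less_mult_iff)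
  then have "real (nat k) * hp = \<phi> l" "1 \<le> nat k" using k by auto
  with ph zlam z show ?thesis by metis
qed

lemma phase_eigenvalue:
  assumes k: "k \<ge> (1::nat)" and z: "1 / l \<le> z" and ph: "phase Q l z \<phi>" "\<phi> l = real k * hp"
  shows "z powr p \<in> dirichlet_eigenvalues p (\<lambda>x. - Q x) l"
proof -
  let ?I = "{0..l}"
  have zp: "z > 0" using powr_bound(3)[OF z] .
  define c where "c x = 1 + Q x / z powr p" for x
  have contc: "continuous_on ?I c"
    unfolding c_def using zp by (intro continuous_intros cont_Q) auto
  have eq: "z * (1 + (c x - 1) * y) = z + Q x * z powr (1 - p) * y" for x y
    using zp by (simp add: c_def powr_diff field_simps)
  have d\<phi>: "(\<phi> has_real_derivative z * (1 + (c x - 1) * P (\<phi> x))) (at x within ?I)" if "x \<in> ?I" for x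
    using ph(1) that by (simp add: phase_def eq)
  obtain u v where
    u: "\<And>x. x \<in> ?I \<Longrightarrow> (u has_real_derivative z * spow (1 / (p - 1)) (v x)) (at x within ?I)"
    and v: "\<And>x. x \<in> ?I \<Longrightarrow> (v has_real_derivative - ((p - 1) * z * c x * spow (p - 1) (u x))) (at x within ?I)"
    and u0: "\<And>x. u x = 0 \<longleftrightarrow> S (\<phi> x) = 0"
    by (rule solution_from_pruefer_angle[OF contc d\<phi>]) blast+
  have e: "1 / (p - 1) * (p - 1) = 1" "(p - 1) * (1 / (p - 1)) = 1" using p_gt_1 by auto
  have spow_y': "spow (p - 1) (z * spow (1 / (p - 1)) (v x)) = z powr (p - 1) * v x" for x
    using zp by (subst spow_mult_pos) (simp_all only: spow_spow e spow_one)
  have "dirichlet_solution p (\<lambda>x. - Q x) l (z powr p) u"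
    unfolding dirichlet_solution_def
  proof (intro conjI exI ballI)
    fix x assume x: "x \<in> ?I"
    show "(u has_real_derivative z * spow (1 / (p - 1)) (v x)) (at x within ?I)" by (rule u[OF x])
    have "z powr (p - 1) * - ((p - 1) * z * c x * spow (p - 1) (u x))
        = - ((p - 1) * (z powr (p - 1) * z * c x) * spow (p - 1) (u x))" by (simp only: mult_minus_right mult_ac)
    also have "z powr (p - 1) * z * c x = z powr p - - Q x"
      using zp by (simp add: c_def powr_diff field_simps)
    finally have E: "z powr (p - 1) * - ((p - 1) * z * c x * spow (p - 1) (u x))
        = - ((p - 1) * (z powr p - - Q x) * spow (p - 1) (u x))" .
    show "((\<lambda>t. spow (p - 1) (z * spow (1 / (p - 1)) (v t))) has_real_derivative
        - ((p - 1) * (z powr p - - Q x) * spow (p - 1) (u x))) (at x within ?I)"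
      unfolding spow_y' E[symmetric] by (rule DERIV_cmult[OF v[OF x]])
  next
    show "u 0 = 0" using ph(1) by (simp add: u0 phase_def S_0)
    show "u l = 0" unfolding u0 ph(2) S_eq_0_iff by (rule exI[of _ "int k"]) simp
  qed
  moreover have "\<exists>x\<in>?I. u x \<noteq> 0"
  proof -
    \<comment> \<open>The phase passes through \<open>hp / 2\<close>, where \<open>S\<close> is
      positive; hence \<open>u\<close> is nontrivial.\<close>
    have "hp \<le> real k * hp" using k hp_pos by simp
    then have "\<exists>x. 0 \<le> x \<and> x \<le> l \<and> \<phi> x = hp / 2"
      using ph hp_pos l_pos by (intro IVT' phase_continuous_on[OF ph(1)]) (auto simp: phase_def)
    then obtain x where "x \<in> ?I" "\<phi> x = hp / 2" by auto
    moreover have "S (hp / 2) > 0" using hp_pos by (intro S_pos) auto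
    ultimately show ?thesis using u0 by force
  qed
  ultimately show ?thesis unfolding dirichlet_eigenvalues_def by blast
qed

text \<open>The \<open>k\<close>-th eigenvalue is \<open>z k powr p\<close> with end value
  \<open>real k * hp\<close>. Then \<open>phase_ratio\<close> for \<open>z m < z n\<close> reads
  \<open>n / z n \<le> m / z m\<close> up to the factor \<open>hp\<close>, and the power
  \<open>p\<close> gives the claim.\<close>

theorem eigenvalue_ratio:
  assumes enum: "increasing_enumeration s (dirichlet_eigenvalues p (\<lambda>x. - Q x) l)"
  shows "s 1 > 0"
    and "1 \<le> m \<Longrightarrow> m < n \<Longrightarrow> s n / s m \<ge> real n powr p / real m powr p"
    and "1 \<le> m \<Longrightarrow> m < n \<Longrightarrow> Q 0 > 0 \<Longrightarrow> s n / s m > real n powr p / real m powr p"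
proof -
  have "\<forall>k::nat. \<exists>z \<phi>. 1 \<le> k \<longrightarrow> 1 / l \<le> z \<and> phase Q l z \<phi> \<and> \<phi> l = real k * hp"
    using phase_root_exists by blast
  then obtain z \<phi> where z: "\<And>k. 1 \<le> k \<Longrightarrow> 1 / l \<le> z k"
    and ph: "\<And>k. 1 \<le> k \<Longrightarrow> phase Q l (z k) (\<phi> k)" "\<And>k. 1 \<le> k \<Longrightarrow> \<phi> k l = real k * hp"
    by metis
  have zp: "z k > 0" if "1 \<le> k" for k using powr_bound(3)[OF z[OF that]] .
  \<comment> \<open>The \<open>z k\<close> were chosen separately for each \<open>k\<close>; their
    order comes from that of the end values.\<close>
  have z_mono: "z i < z j" if "1 \<le> i" "i < j" for i j
  proof (rule ccontr)
    assume "\<not> z i < z j"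
    then have "\<phi> j l \<le> \<phi> i l" using that by (intro phase_mono(1)[OF z ph(1) ph(1)]) auto
    then have "real j * hp \<le> real i * hp" using ph(2) that by simp
    then show False using hp_pos that by simp
  qed
  have image: "(\<lambda>k. z k powr p) ` {1..} = dirichlet_eigenvalues p (\<lambda>x. - Q x) l"
  proof (intro equalityI subsetI)
    fix x assume "x \<in> (\<lambda>k. z k powr p) ` {1..}"
    then obtain k where k: "1 \<le> k" "x = z k powr p" by auto
    show "x \<in> dirichlet_eigenvalues p (\<lambda>x. - Q x) l"
      unfolding k(2) by (rule phase_eigenvalue[OF k(1) z[OF k(1)] ph(1)[OF k(1)] ph(2)[OF k(1)]])
  next
    fix x assume "x \<in> dirichlet_eigenvalues p (\<lambda>x. - Q x) l"
    then obtain k w \<psi> where w: "1 \<le> k" "1 / l \<le> w" "x = w powr p" "phase Q l w \<psi>" "\<psi> l = real k * hp"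
      using eigenvalue_phase by blast
    have "w = z k"
    proof (rule ccontr)
      assume "w \<noteq> z k"
      then have "\<psi> l \<noteq> \<phi> k l"
        using phase_mono(2)[OF w(2) w(4) ph(1)[OF w(1)]] phase_mono(2)[OF z[OF w(1)] ph(1)[OF w(1)] w(4)]
        by linarith
      then show False using w ph by simp
    qed
    then show "x \<in> (\<lambda>k. z k powr p) ` {1..}" using w by auto
  qed
  have "strict_mono_on {1..} (\<lambda>k. z k powr p)"
    using z_mono zp p_gt_1 by (auto intro!: strict_mono_onI powr_less_mono2 less_imp_le)
  then have s_eq: "s k = z k powr p" if "1 \<le> k" for k
    using strictly_increasing_enumeration_unique[of s "\<lambda>k. z k powr p"] enum image that
    by (simp add: increasing_enumeration_def)
  show "s 1 > 0" using s_eq[of 1] zp[of 1] by simp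
  have main: "s n / s m \<ge> real n powr p / real m powr p"
    "Q 0 > 0 \<Longrightarrow> s n / s m > real n powr p / real m powr p" if mn: "1 \<le> m" "m < n"
  proof -
    have n: "1 \<le> n" using mn by simp
    note pos = zp[OF mn(1)] zp[OF n]
    have eq: "real n powr p / real m powr p = (real n / real m) powr p" "s n / s m = (z n / z m) powr p"
      using pos mn n by (simp_all add: s_eq powr_divide)
    have R: "real n * hp / z n \<le> real m * hp / z m"
      "Q 0 > 0 \<Longrightarrow> real n * hp / z n < real m * hp / z m"
      using phase_ratio[OF z[OF mn(1)] z_mono[OF mn] ph(1)[OF mn(1)] ph(1)[OF n]] ph(2)[OF mn(1)] ph(2)[OF n]
      by auto
    have "real n / real m \<le> z n / z m"
      using R(1) pos hp_pos mn by (simp add: field_simps)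
    then show "s n / s m \<ge> real n powr p / real m powr p"
      unfolding eq using p_gt_1 mn by (intro powr_mono2) auto
    assume "Q 0 > 0"
    then have "real n / real m < z n / z m"
      using R(2) pos hp_pos mn by (simp add: field_simps)
    then show "s n / s m > real n powr p / real m powr p"
      unfolding eq using p_gt_1 mn by (intro powr_less_mono2) auto
  qed
  show "1 \<le> m \<Longrightarrow> m < n \<Longrightarrow> s n / s m \<ge> real n powr p / real m powr p"
    "1 \<le> m \<Longrightarrow> m < n \<Longrightarrow> Q 0 > 0 \<Longrightarrow> s n / s m > real n powr p / real m powr p"
    using main by blast+
qed

end

section \<open>Single-barrier potentials\<close>

text \<open>Turns a nonincreasing \<open>q\<close> into a nondecreasing one, so that
  \<open>Q\<close> is largest at \<open>0\<close>. The derivative changes sign, and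
  \<open>spow\<close> is odd.\<close>

lemma dirichlet_solution_reflect:
  assumes "dirichlet_solution p q l lam y"
  shows "dirichlet_solution p (\<lambda>x. q (l - x)) l lam (\<lambda>x. y (l - x))"
proof -
  let ?I = "{0..l}"
  have refl: "((\<lambda>x. f (l - x)) has_real_derivative - d) (at x within ?I)"
    if "x \<in> ?I" "(f has_real_derivative d) (at (l - x) within ?I)" for f d x
  proof -
    have "(\<lambda>x. l - x) ` ?I = ?I" by simp
    then have "((f \<circ> (\<lambda>x. l - x)) has_real_derivative d * (0 - 1)) (at x within ?I)"
      using that by (intro DERIV_image_chain DERIV_diff DERIV_const DERIV_ident) auto
    then show ?thesis by (simp add: o_def)
  qed
  obtain y' where y': "\<And>x. x \<in> ?I \<Longrightarrow> (y has_real_derivative y' x) (at x within ?I)"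
      "\<And>x. x \<in> ?I \<Longrightarrow> ((\<lambda>t. spow (p - 1) (y' t)) has_real_derivative
        - ((p - 1) * (lam - q x) * spow (p - 1) (y x))) (at x within ?I)"
    and bc: "y 0 = 0" "y l = 0"
  proof -
    obtain y' where "\<forall>x\<in>?I. (y has_real_derivative y' x) (at x within ?I) \<and>
        ((\<lambda>t. spow (p - 1) (y' t)) has_real_derivative
          - ((p - 1) * (lam - q x) * spow (p - 1) (y x))) (at x within ?I)"
      "y 0 = 0" "y l = 0"
      using assms unfolding dirichlet_solution_def by blast
    then show ?thesis by (intro that[of y']) simp_all
  qed
  show ?thesis
    unfolding dirichlet_solution_def
  proof (intro conjI exI ballI)
    fix x assume x: "x \<in> ?I"
    then have lx: "l - x \<in> ?I" by simp
    show "((\<lambda>x. y (l - x)) has_real_derivative - y' (l - x)) (at x within ?I)"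
      by (rule refl[OF x y'(1)[OF lx]])
    show "((\<lambda>t. spow (p - 1) (- y' (l - t))) has_real_derivative
        - ((p - 1) * (lam - q (l - x)) * spow (p - 1) (y (l - x)))) (at x within ?I)"
      unfolding spow_minus by (rule DERIV_minus[OF refl[OF x y'(2)[OF lx]], simplified minus_minus])
  qed (use bc in simp_all)
qed

lemma dirichlet_eigenvalues_reflect:
  "dirichlet_eigenvalues p (\<lambda>x. q (l - x)) l = dirichlet_eigenvalues p q l"
proof -
  have sub: "dirichlet_eigenvalues p q l \<subseteq> dirichlet_eigenvalues p (\<lambda>x. q (l - x)) l" for q
  proof
    fix lam assume "lam \<in> dirichlet_eigenvalues p q l"
    then obtain y x where y: "dirichlet_solution p q l lam y" "x \<in> {0..l}" "y x \<noteq> 0"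
      unfolding dirichlet_eigenvalues_def by blast
    have "dirichlet_solution p (\<lambda>x. q (l - x)) l lam (\<lambda>x. y (l - x))"
      by (rule dirichlet_solution_reflect[OF y(1)])
    moreover have "l - x \<in> {0..l}" "y (l - (l - x)) \<noteq> 0" using y by auto
    ultimately show "lam \<in> dirichlet_eigenvalues p (\<lambda>x. q (l - x)) l"
      unfolding dirichlet_eigenvalues_def by blast
  qed
  show ?thesis using sub[of q] sub[of "\<lambda>x. q (l - x)"] by auto
qed

theorem theorem2p5:
  fixes p :: real and q :: "real \<Rightarrow> real" and lam :: "real \<Rightarrow> nat \<Rightarrow> real"
  assumes "p > 1"
    and "continuous_on {0..1} q"
    and "single_barrier q"
    and "\<forall>x\<in>{0..1}. q x \<le> 0"
    and "\<forall>l\<in>{0<..1}. increasing_enumeration (lam l) (dirichlet_eigenvalues p q l)"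
  shows "\<exists>l0\<in>{0<..1}.
    (min (q 0) (q 1) \<noteq> 0 \<longrightarrow> l0 \<le> (- p / (3 * min (q 0) (q 1))) powr (1 / p)) \<and>
    (\<forall>l\<in>{0<..l0}.
       lam l 1 > 0 \<and>
       (\<forall>m n. 1 \<le> m \<and> m < n \<longrightarrow>
          lam l n / lam l m \<ge> real n powr p / real m powr p) \<and>
       ((\<exists>m n. 1 \<le> m \<and> 1 \<le> n \<and> m \<noteq> n \<and>
           lam l n / lam l m = real n powr p / real m powr p) \<longrightarrow>
          (\<forall>x\<in>{0..l0}. q x = 0)))"
proof -
  note p = assms(1) and cont = assms(2) and nonpos = assms(4)[rule_format] and enum = assms(5)[rule_format]
  obtain hp S W where "generalized_sine p hp S W"
    using generalized_sine_exists[OF p] by blast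
  then interpret generalized_sine p hp S W .
  obtain x0 where x0: "x0 \<in> {0..1}" "mono_on {0..x0} q" "antimono_on {x0..1} q"
    using assms(3) by (auto simp: single_barrier_def)
  define M where "M = - min (q 0) (q 1)"
  have M0: "M \<ge> 0" using nonpos[of 0] by (simp add: M_def min_def)
  \<comment> \<open>For \<open>M > 0\<close> the solution of \<open>M * L powr p = eps\<close>;
    \<open>M\<close> dominates \<open>Q 0\<close> both for \<open>Q = - q\<close> and for the
    reflected potential.\<close>
  define L where "L = (if M = 0 then 1 else (eps / M) powr (1 / p))"
  have L: "L > 0" using M0 eps_pos by (auto simp: L_def)
  have L_small: "M * l powr p \<le> eps" if "0 < l" "l \<le> L" for l
  proof (cases "M = 0")
    case False
    then have "l powr p \<le> ((eps / M) powr (1 / p)) powr p"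
      using that p by (intro powr_mono2) (auto simp: L_def)
    also have "\<dots> = eps / M" using p M0 eps_pos by (simp add: powr_powr)
    finally show ?thesis using M0 False by (simp add: field_simps)
  qed (use eps_pos in simp)
  have L_bound: "L \<le> (- p / (3 * min (q 0) (q 1))) powr (1 / p)" if "min (q 0) (q 1) \<noteq> 0"
  proof -
    have "M > 0" using that M0 by (simp add: M_def)
    have "eps / M \<le> (p / 3) / M" using \<open>M > 0\<close> by (intro divide_right_mono) (auto simp: eps_def)
    also have "\<dots> = - p / (3 * min (q 0) (q 1))" by (simp add: M_def)
    finally have "eps / M \<le> - p / (3 * min (q 0) (q 1))" .
    then show ?thesis
      using \<open>M > 0\<close> p eps_pos by (auto simp: L_def intro!: powr_mono2)
  qed
  have "\<exists>l0. 0 < l0 \<and> l0 \<le> 1 \<and> l0 \<le> L \<and> (\<forall>l\<in>{0<..l0}. \<exists>Q. small_potential p hp S W Q l \<and>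
      dirichlet_eigenvalues p (\<lambda>x. - Q x) l = dirichlet_eigenvalues p q l \<and>
      (Q 0 = 0 \<longrightarrow> (\<forall>x\<in>{0..l0}. q x = 0)))"
  proof (cases "x0 > 0")
    case True
    show ?thesis
    proof (intro exI[of _ "min L x0"] conjI ballI)
      fix l assume l: "l \<in> {0<..min L x0}"
      show "\<exists>Q. small_potential p hp S W Q l \<and>
        dirichlet_eigenvalues p (\<lambda>x. - Q x) l = dirichlet_eigenvalues p q l \<and>
        (Q 0 = 0 \<longrightarrow> (\<forall>x\<in>{0..min L x0}. q x = 0))"
      proof (intro exI[of _ "\<lambda>x. - q x"] conjI impI ballI)
        show "small_potential p hp S W (\<lambda>x. - q x) l"
        proof
          show "l > 0" using l by simp
          show "continuous_on {0..l} (\<lambda>x. - q x)"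
            using l x0 by (intro continuous_intros continuous_on_subset[OF cont]) auto
          show "antimono_on {0..l} (\<lambda>x. - q x)"
            using monotone_onD[OF x0(2)] l by (intro monotone_onI) auto
          show "- q x \<ge> 0" if "x \<in> {0..l}" for x using nonpos[of x] that l x0 by auto
          have "- q 0 * l powr p \<le> M * l powr p"
            by (intro mult_right_mono) (auto simp: M_def)
          also have "\<dots> \<le> eps" using L_small l by simp
          finally show "- q 0 * l powr p \<le> eps" .
        qed
        \<comment> \<open>Here \<open>q\<close> is nondecreasing and nonpositive on
          \<open>[0, x0]\<close>, so \<open>q 0 = 0\<close> makes it vanish there.\<close>
        fix x assume "- q 0 = 0" and x: "x \<in> {0..min L x0}"
        then show "q x = 0"
          using monotone_onD[OF x0(2), of 0 x] nonpos[of x] x0(1) by auto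
      qed simp
    qed (use True L x0 in auto)
  next
    case False
    then have anti: "antimono_on {0..1} q" using x0 by auto
    \<comment> \<open>After reflection \<open>Q 0 = - q l\<close>, so equality at \<open>l\<close>
      only yields \<open>q = 0\<close> on \<open>[0, l]\<close>, possibly shorter than
      \<open>[0, l0]\<close>. Taking for \<open>d\<close> a positive zero of \<open>q\<close>
      whenever there is one makes \<open>q\<close> vanish on \<open>[0, d]\<close>, hence on
      \<open>[0, l0]\<close>.\<close>
    define d where "d = (if \<exists>d\<in>{0<..1}. q d = 0 then SOME d. d \<in> {0<..1} \<and> q d = 0 else 1)"
    have d: "0 < d" "d \<le> 1" "\<And>l. l \<in> {0<..1} \<Longrightarrow> q l = 0 \<Longrightarrow> q d = 0"
    proof -
      have "d \<in> {0<..1} \<and> ((\<exists>d\<in>{0<..1}. q d = 0) \<longrightarrow> q d = 0)"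
      proof (cases "\<exists>d\<in>{0<..1}. q d = 0")
        case True
        then have "d = (SOME d. d \<in> {0<..1} \<and> q d = 0)" by (simp add: d_def)
        then show ?thesis using someI_ex[of "\<lambda>d. d \<in> {0<..1} \<and> q d = 0"] True by blast
      qed (auto simp: d_def)
      then show "0 < d" "d \<le> 1" "\<And>l. l \<in> {0<..1} \<Longrightarrow> q l = 0 \<Longrightarrow> q d = 0" by auto
    qed
    show ?thesis
    proof (intro exI[of _ "min L d"] conjI ballI)
      fix l assume l: "l \<in> {0<..min L d}"
      show "\<exists>Q. small_potential p hp S W Q l \<and>
        dirichlet_eigenvalues p (\<lambda>x. - Q x) l = dirichlet_eigenvalues p q l \<and>
        (Q 0 = 0 \<longrightarrow> (\<forall>x\<in>{0..min L d}. q x = 0))"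
      proof (intro exI[of _ "\<lambda>x. - q (l - x)"] conjI impI ballI)
        show "small_potential p hp S W (\<lambda>x. - q (l - x)) l"
        proof
          show "l > 0" using l by simp
          show "continuous_on {0..l} (\<lambda>x. - q (l - x))"
            using l d by (intro continuous_intros continuous_on_compose2[OF cont]) auto
          show "antimono_on {0..l} (\<lambda>x. - q (l - x))"
            using monotone_onD[OF anti] l d by (intro monotone_onI) auto
          show "- q (l - x) \<ge> 0" if "x \<in> {0..l}" for x using nonpos[of "l - x"] that l d by auto
          have "- q l \<le> - q 1" using monotone_onD[OF anti, of l 1] l d by auto
          also have "\<dots> \<le> M" by (simp add: M_def)
          finally have "- q l * l powr p \<le> M * l powr p" by (rule mult_right_mono) simp
          also have "\<dots> \<le> eps" using L_small l by simp
          finally show "- q (l - 0) * l powr p \<le> eps" by simp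
        qed
        show "dirichlet_eigenvalues p (\<lambda>x. - (- q (l - x))) l = dirichlet_eigenvalues p q l"
          by (simp add: dirichlet_eigenvalues_reflect)
        fix x assume "- q (l - 0) = 0" and x: "x \<in> {0..min L d}"
        then have "q d = 0" using d(3)[of l] d(2) l by simp
        then show "q x = 0"
          using monotone_onD[OF anti, of x d] nonpos[of x] x d(1,2) by auto
      qed
    qed (use L d in auto)
  qed
  then obtain l0 where l0: "0 < l0" "l0 \<le> 1" "l0 \<le> L" and
    reduce: "\<And>l. l \<in> {0<..l0} \<Longrightarrow> \<exists>Q. small_potential p hp S W Q l \<and>
      dirichlet_eigenvalues p (\<lambda>x. - Q x) l = dirichlet_eigenvalues p q l \<and>
      (Q 0 = 0 \<longrightarrow> (\<forall>x\<in>{0..l0}. q x = 0))"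
    by blast
  have main: "lam l 1 > 0 \<and>
       (\<forall>m n. 1 \<le> m \<and> m < n \<longrightarrow>
          lam l n / lam l m \<ge> real n powr p / real m powr p) \<and>
       ((\<exists>m n. 1 \<le> m \<and> 1 \<le> n \<and> m \<noteq> n \<and>
           lam l n / lam l m = real n powr p / real m powr p) \<longrightarrow>
          (\<forall>x\<in>{0..l0}. q x = 0))" if l: "l \<in> {0<..l0}" for l
  proof -
    obtain Q where Q: "small_potential p hp S W Q l"
      "dirichlet_eigenvalues p (\<lambda>x. - Q x) l = dirichlet_eigenvalues p q l"
      "Q 0 = 0 \<longrightarrow> (\<forall>x\<in>{0..l0}. q x = 0)"
      using reduce[OF l] by blast
    interpret small_potential p hp S W Q l by (rule Q(1))
    have "increasing_enumeration (lam l) (dirichlet_eigenvalues p (\<lambda>x. - Q x) l)"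
      using enum[of l] l l0 Q(2) by auto
    note ratio = eigenvalue_ratio[OF this]
    show ?thesis
    proof (intro conjI allI impI)
      show "lam l 1 > 0" by (rule ratio)
      show "lam l n / lam l m \<ge> real n powr p / real m powr p" if "1 \<le> m \<and> m < n" for m n
        using ratio(2) that by blast
      assume "\<exists>m n. 1 \<le> m \<and> 1 \<le> n \<and> m \<noteq> n \<and>
           lam l n / lam l m = real n powr p / real m powr p"
      then obtain m n where mn: "1 \<le> m" "1 \<le> n" "m \<noteq> n"
        and eq: "lam l n / lam l m = real n powr p / real m powr p" by blast
      \<comment> \<open>Equality is symmetric under reciprocals, so the strict ratio estimate
        applies in either order of \<open>m\<close> and \<open>n\<close>.\<close>
      have eq': "lam l m / lam l n = real m powr p / real n powr p"
        using arg_cong[OF eq, of inverse] by simp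
      have "\<not> Q 0 > 0"
        using ratio(3)[of m n] ratio(3)[of n m] mn eq eq' by (cases "m < n") auto
      then show "\<forall>x\<in>{0..l0}. q x = 0" using Q(3) Q0_nonneg by simp
    qed
  qed
  show ?thesis
    using main l0 L_bound by (intro bexI[of _ l0]) auto
qed

end
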